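(* A countable $\{E,B,S\}$-structure satisfies the universal axioms and the extension axioms (listed in the context) if and only if it is isomorphic to $(\mathbb C_3,B,S)$.
   Context: **The structure $(\mathbb C_3,B,S)$.** $\mathbb C_3$ is the graph whose vertex set is a countable dense subset of the unit circle $S^1$ such that any two distinct points of it lie at a rational angle (in radians, hence never exactly $2\pi/3$), and $E(x,y)$ holds iff both circular arcs with end-points $x,y$ have length strictly larger than $1/3$ of the circumference. $B(x,y,z)$ holds iff $\{x,y,z\}$ is an independent set of three distinct vertices and $y$ lies on the shorter circular arc between $x$ and $z$. $S(x_1,x_2,x_3,x_4)$ holds iff the four points are pairwise distinct and $x_2,x_4$ lie in different connected components of $S^1\setminus\{x_1,x_3\}$. **Conventions.** $E,B,S$ have arities 2, 3, 4. $S$ holds only on 4-tuples of pairwise distinct elements. Variables are universally quantified unless stated otherwise. "Independent", "edge", "induce" refer to $E$. An index $i,j,k$ left free means that the statement is required for each value in $\{1,2\}$ (e.g. $E(v,x_i)$ means $E(v,x_1)\wedge E(v,x_2)$). For $n\ge 4$, $\mathrm{Sep}(x_1,\dots,x_n)$ is the conjunction of atomic and negated atomic $S$-formulas describing the separation relation of $n$ distinct points met in the order $x_1,\dots,x_n$ when traversing a circle clockwise; given US1–US3 below it says that $S(x_a,x_b,x_c,x_d)$ holds for all $a<b<c<d$. **Universal axioms.** UE1: $E$ is a loopless symmetric relation. UE2: $E$ contains no triangles. UB1: $B(x,y,z)$ iff $B(z,y,x)$. UB2: if $B(x,y,z)$ then $\neg B(y,z,x)$. UB3: if $B(x,y,z)$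 and $B(y,w,z)$, then $B(x,w,z)$ and $B(x,y,w)$. UB4: if $B(x,y,z)$ and $B(x,y,w)$ with $z\ne w$, then $B(x,z,w)$ or $B(x,w,z)$. US1: for pairwise distinct $x_1,\dots,x_4$, exactly one of $S(x_1,x_2,x_3,x_4)$, $S(x_1,x_2,x_4,x_3)$, $S(x_1,x_3,x_2,x_4)$ holds. US2: $S(x_1,x_2,x_3,x_4)$ iff $S(x_2,x_3,x_4,x_1)$. US3: $S(x_1,x_2,x_3,x_4)$ iff $S(x_4,x_3,x_2,x_1)$. US4: if $S(x_1,x_2,x_3,x_4)$ and $S(x_1,x_3,x_4,x_5)$, then $S(x_1,x_2,x_4,x_5)$. UM1: $\{x,y,z\}$ is an independent set of size 3 iff $B(x,y,z)$, $B(y,z,x)$ or $B(z,x,y)$. UM2: if $B(x,y,z)$, $B(y,z,w)$ and $\neg E(x,w)$, then $B(x,y,w)$ and $B(x,z,w)$. UM3: if $B(x,y,z)$ and $E(y,w)$, then $E(x,w)$ or $E(z,w)$. UM4: if $B(x,y,z)$, $E(x,w)$ and $E(z,w)$, then $E(y,w)$. UM5: if $S(x_1,x_2,x_3,x_4)$, $E(x_1,x_4)$ and $B(x_3,x_5,x_4)$, then $S(x_1,x_2,x_3,x_5)$. UM6: if $B(y_1,y_2,x)$, $B(x,z_1,z_2)$ and $E(y_1,z_2)$, then $S(y_1,y_2,z_1,z_2)$. UM7: if $x_1,x_2,x_3,x_4$ induce a $C_4$, a $P_4$ or a $2K_2$, then $S(x_1,x_2,x_3,x_4)$ implies $E(x_1,x_3)\wedge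 E(x_2,x_4)$. UM8: if $\{x_1,x_2,x_3\}$ is an independent set of size 3 and $x_4\notin\{x_1,x_2,x_3\}$, then $S(x_1,x_2,x_3,x_4)$ iff [$B(x_1,x_2,x_3)\wedge\neg B(x_1,x_4,x_3)$] or [$B(x_1,x_4,x_3)\wedge\neg B(x_1,x_2,x_3)$]. **Extension axioms.** EX: there exists a vertex. EX1a: if $\neg E(x_1,x_2)$, then there are $v_1,v_2$ with $E(v_1,x_i)$ and $\neg E(v_2,x_i)$. EX1b: if $\neg E(y_1,y_2)$ and $y_1\neq y_2$, then there are $v_1,v_2,v_3$ with $B(v_1,y_1,y_2)$, $B(y_1,v_2,y_2)$, $B(y_1,y_2,v_3)$. EX1c: if $B(x_i,y_1,y_2)$ and $B(x_1,x_2,y_i)$, then there is $v$ with $E(v,x_i)$ and $B(y_1,y_2,v)$. EX2a: if $E(y,z)$, then there is $v$ with $\neg E(v,y)$ and $\neg E(v,z)$. EX2b: if $E(y,z_2)$, $\neg E(z_1,z_2)$ and $z_1\ne z_2$, then there is $v$ with $\neg E(v,y)$, $\neg E(v,z_i)$, $B(v,z_1,z_2)$, $S(y,v,z_1,z_2)$. EX2c: if $S(y_1,y_2,z_1,z_2)$, $\neg E(y_1,y_2)$, $\neg E(z_1,z_2)$, $E(y_1,z_2)$, then there is $v$ with $\neg E(y_i,v)$, $\neg E(z_j,v)$, $B(y_1,y_2,v)$, $B(v,z_1,z_2)$, $\mathrm{Sep}(y_1,y_2,v,z_1,z_2)$. EX3a: if $E(x,y)$, then there is $v$ with $E(v,x)$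 and $\neg E(v,y)$. EX3b: if $\neg E(x_1,x_2)$, $E(x_1,y)$, $x_1\ne x_2$, then there is $v$ with $E(v,x_i)$, $\neg E(v,y)$, $S(y,v,x_1,x_2)$. EX3c: if $E(x,y_2)$, $\neg E(y_1,y_2)$, $y_1\neq y_2$, then there is $v$ with $E(v,x)$ and $B(y_1,y_2,v)$. EX3d: if $\neg E(x_1,x_2)$, $\neg E(y_1,y_2)$, $E(x_1,y_2)$, $S(x_1,x_2,y_1,y_2)$, then there is $v$ with $E(v,x_i)$, $\neg E(v,y_j)$, $B(y_1,y_2,v)$, $\mathrm{Sep}(x_1,x_2,y_1,y_2,v)$. EX4a: if $|\{x,y,z\}|=3$ and $x,y,z$ induce at least one edge, then there is $v$ with $E(v,x)$, $\neg E(v,y)$, $\neg E(v,z)$, $S(x,y,v,z)$. EX4b: if $S(x_1,x_2,y,z)$, $\neg E(x_1,x_2)$, and each triple $x_i,y,z$ induces at least one edge, then there is $v$ with $E(v,x_i)$, $\neg E(v,y)$, $\neg E(v,z)$, $\mathrm{Sep}(x_1,x_2,y,v,z)$. EX4c: if $S(x,y_1,y_2,z)$, $\neg E(y_1,y_2)$, and each triple $x,y_j,z$ induces at least one edge, then there is $v$ with $E(v,x)$, $\neg E(v,z)$, $B(y_1,y_2,v)$, $\mathrm{Sep}(x,y_1,y_2,v,z)$. EX4d: if $\mathrm{Sep}(x_1,x_2,y_1,y_2,z)$, $\neg E(x_1,x_2)$, $\neg E(y_1,y_2)$, and each triple $x_i,y_j,z$ induces at least one edge, then there is $v$ with $E(v,x_i)$,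 $\neg E(v,z)$, $B(y_1,y_2,v)$, $\mathrm{Sep}(x_1,x_2,y_1,y_2,v,z)$. EX4e: if $\mathrm{Sep}(x,y_1,y_2,z_1,z_2)$, $\neg E(y_1,y_2)$, $\neg E(z_1,z_2)$, and each triple $x,y_j,z_k$ induces at least one edge, then there is $v$ with $E(v,x)$, $B(y_1,y_2,v)$, $B(v,z_1,z_2)$, $\mathrm{Sep}(x,y_1,y_2,v,z_1,z_2)$. EX4f: if $\mathrm{Sep}(x_1,x_2,y_1,y_2,z_1,z_2)$, $\neg E(x_1,x_2)$, $\neg E(y_1,y_2)$, $\neg E(z_1,z_2)$, and each triple $x_i,y_j,z_k$ induces at least one edge, then there is $v$ with $E(v,x_i)$, $B(y_1,y_2,v)$, $B(v,z_1,z_2)$, $\mathrm{Sep}(x_1,x_2,y_1,y_2,v,z_1,z_2)$. *)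

theory Defs
  imports "HOL-Analysis.Analysis"
begin

section \<open>Induced subgraphs and separation diagrams\<close>

definition independent_set :: "('a \<Rightarrow> 'a \<Rightarrow> bool) \<Rightarrow> 'a set \<Rightarrow> bool" where
  "independent_set E X \<longleftrightarrow> (\<forall>x\<in>X. \<forall>y\<in>X. \<not> E x y)"

definition induces_edge :: "('a \<Rightarrow> 'a \<Rightarrow> bool) \<Rightarrow> 'a set \<Rightarrow> bool" where
  "induces_edge E X \<longleftrightarrow> (\<exists>x\<in>X. \<exists>y\<in>X. E x y)"

definition induces_C4 :: "('a \<Rightarrow> 'a \<Rightarrow> bool) \<Rightarrow> 'a set \<Rightarrow> bool" where
  "induces_C4 E X \<longleftrightarrow> (\<exists>a b c d. X = {a, b, c, d} \<and> distinct [a, b, c, d] \<and>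
     E a b \<and> E b c \<and> E c d \<and> E d a \<and> \<not> E a c \<and> \<not> E b d)"

definition induces_P4 :: "('a \<Rightarrow> 'a \<Rightarrow> bool) \<Rightarrow> 'a set \<Rightarrow> bool" where
  "induces_P4 E X \<longleftrightarrow> (\<exists>a b c d. X = {a, b, c, d} \<and> distinct [a, b, c, d] \<and>
     E a b \<and> E b c \<and> E c d \<and> \<not> E a c \<and> \<not> E a d \<and> \<not> E b d)"

definition induces_2K2 :: "('a \<Rightarrow> 'a \<Rightarrow> bool) \<Rightarrow> 'a set \<Rightarrow> bool" where
  "induces_2K2 E X \<longleftrightarrow> (\<exists>a b c d. X = {a, b, c, d} \<and> distinct [a, b, c, d] \<and>
     E a b \<and> E c d \<and> \<not> E a c \<and> \<not> E a d \<and> \<not> E b c \<and> \<not> E b d)"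

text \<open>For points labelled by naturals in the order in which they are met on a circle, the
  pair \<open>b, d\<close> separates the pair \<open>a, c\<close> iff exactly one of \<open>b, d\<close> is
  numerically between \<open>a\<close> and \<open>c\<close>.\<close>

definition index_sep :: "nat \<Rightarrow> nat \<Rightarrow> nat \<Rightarrow> nat \<Rightarrow> bool" where
  "index_sep a b c d \<longleftrightarrow> distinct [a, b, c, d] \<and>
     (b \<in> {min a c<..<max a c}) \<noteq> (d \<in> {min a c<..<max a c})"

text \<open>The full diagram, positive and negative atoms, of the separation relation. Lemma
  \<open>Sep_iff\<close> below shows that under the universal axioms the atoms with increasing
  indices suffice.\<close>

definition Sep :: "('a \<Rightarrow> 'a \<Rightarrow> 'a \<Rightarrow> 'a \<Rightarrow> bool) \<Rightarrow> 'a list \<Rightarrow> bool" where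
  "Sep S xs \<longleftrightarrow> (\<forall>a<length xs. \<forall>b<length xs. \<forall>c<length xs. \<forall>d<length xs.
     S (xs ! a) (xs ! b) (xs ! c) (xs ! d) \<longleftrightarrow> index_sep a b c d)"


section \<open>The axioms\<close>

text \<open>A structure is a carrier \<open>V\<close> with relations on the ambient type; only their
  values on \<open>V\<close> matter. The assumption \<open>S_distinct\<close> is the standing convention
  that \<open>S\<close> holds only on tuples of pairwise distinct elements.\<close>

locale universal_axioms =
  fixes V :: "'a set"
    and E :: "'a \<Rightarrow> 'a \<Rightarrow> bool"
    and B :: "'a \<Rightarrow> 'a \<Rightarrow> 'a \<Rightarrow> bool"
    and S :: "'a \<Rightarrow> 'a \<Rightarrow> 'a \<Rightarrow> 'a \<Rightarrow> bool"
  assumes S_distinct: "{x1, x2, x3, x4} \<subseteq> V \<Longrightarrow> S x1 x2 x3 x4 \<Longrightarrow> distinct [x1, x2, x3, x4]"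
    and UE1_loopless: "x \<in> V \<Longrightarrow> \<not> E x x"
    and UE1_sym: "{x, y} \<subseteq> V \<Longrightarrow> E x y \<Longrightarrow> E y x"
    and UE2: "{x, y, z} \<subseteq> V \<Longrightarrow> \<not> (E x y \<and> E y z \<and> E x z)"
    and UB1: "{x, y, z} \<subseteq> V \<Longrightarrow> B x y z \<longleftrightarrow> B z y x"
    and UB2: "{x, y, z} \<subseteq> V \<Longrightarrow> B x y z \<Longrightarrow> \<not> B y z x"
    and UB3: "{x, y, z, w} \<subseteq> V \<Longrightarrow> B x y z \<Longrightarrow> B y w z \<Longrightarrow> B x w z \<and> B x y w"
    and UB4: "{x, y, z, w} \<subseteq> V \<Longrightarrow> B x y z \<Longrightarrow> B x y w \<Longrightarrow> z \<noteq> w \<Longrightarrow> B x z w \<or> B x w z"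
    and US1: "{x1, x2, x3, x4} \<subseteq> V \<Longrightarrow> distinct [x1, x2, x3, x4] \<Longrightarrow>
        (S x1 x2 x3 x4 \<and> \<not> S x1 x2 x4 x3 \<and> \<not> S x1 x3 x2 x4) \<or>
        (\<not> S x1 x2 x3 x4 \<and> S x1 x2 x4 x3 \<and> \<not> S x1 x3 x2 x4) \<or>
        (\<not> S x1 x2 x3 x4 \<and> \<not> S x1 x2 x4 x3 \<and> S x1 x3 x2 x4)"
    and US2: "{x1, x2, x3, x4} \<subseteq> V \<Longrightarrow> S x1 x2 x3 x4 \<longleftrightarrow> S x2 x3 x4 x1"
    and US3: "{x1, x2, x3, x4} \<subseteq> V \<Longrightarrow> S x1 x2 x3 x4 \<longleftrightarrow> S x4 x3 x2 x1"
    and US4: "{x1, x2, x3, x4, x5} \<subseteq> V \<Longrightarrow> S x1 x2 x3 x4 \<Longrightarrow> S x1 x3 x4 x5 \<Longrightarrow> S x1 x2 x4 x5"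
    and UM1: "{x, y, z} \<subseteq> V \<Longrightarrow>
        distinct [x, y, z] \<and> independent_set E {x, y, z} \<longleftrightarrow> B x y z \<or> B y z x \<or> B z x y"
    and UM2: "{x, y, z, w} \<subseteq> V \<Longrightarrow> B x y z \<Longrightarrow> B y z w \<Longrightarrow> \<not> E x w \<Longrightarrow> B x y w \<and> B x z w"
    and UM3: "{x, y, z, w} \<subseteq> V \<Longrightarrow> B x y z \<Longrightarrow> E y w \<Longrightarrow> E x w \<or> E z w"
    and UM4: "{x, y, z, w} \<subseteq> V \<Longrightarrow> B x y z \<Longrightarrow> E x w \<Longrightarrow> E z w \<Longrightarrow> E y w"
    and UM5: "{x1, x2, x3, x4, x5} \<subseteq> V \<Longrightarrow>
        S x1 x2 x3 x4 \<Longrightarrow> E x1 x4 \<Longrightarrow> B x3 x5 x4 \<Longrightarrow> S x1 x2 x3 x5"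
    and UM6: "{x, y1, y2, z1, z2} \<subseteq> V \<Longrightarrow>
        B y1 y2 x \<Longrightarrow> B x z1 z2 \<Longrightarrow> E y1 z2 \<Longrightarrow> S y1 y2 z1 z2"
    and UM7: "{x1, x2, x3, x4} \<subseteq> V \<Longrightarrow>
        induces_C4 E {x1, x2, x3, x4} \<or> induces_P4 E {x1, x2, x3, x4} \<or>
        induces_2K2 E {x1, x2, x3, x4} \<Longrightarrow>
        S x1 x2 x3 x4 \<Longrightarrow> E x1 x3 \<and> E x2 x4"
    and UM8: "{x1, x2, x3, x4} \<subseteq> V \<Longrightarrow>
        distinct [x1, x2, x3] \<Longrightarrow> independent_set E {x1, x2, x3} \<Longrightarrow> x4 \<notin> {x1, x2, x3} \<Longrightarrow>
        S x1 x2 x3 x4 \<longleftrightarrow> (B x1 x2 x3 \<and> \<not> B x1 x4 x3) \<or> (B x1 x4 x3 \<and> \<not> B x1 x2 x3)"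

locale extension_axioms =
  fixes V :: "'a set"
    and E :: "'a \<Rightarrow> 'a \<Rightarrow> bool"
    and B :: "'a \<Rightarrow> 'a \<Rightarrow> 'a \<Rightarrow> bool"
    and S :: "'a \<Rightarrow> 'a \<Rightarrow> 'a \<Rightarrow> 'a \<Rightarrow> bool"
  assumes EX: "\<exists>v. v \<in> V"
    and EX1a: "{x1, x2} \<subseteq> V \<Longrightarrow> \<not> E x1 x2 \<Longrightarrow>
        \<exists>v1\<in>V. \<exists>v2\<in>V. E v1 x1 \<and> E v1 x2 \<and> \<not> E v2 x1 \<and> \<not> E v2 x2"
    and EX1b: "{y1, y2} \<subseteq> V \<Longrightarrow> \<not> E y1 y2 \<Longrightarrow> y1 \<noteq> y2 \<Longrightarrow>
        \<exists>v1\<in>V. \<exists>v2\<in>V. \<exists>v3\<in>V. B v1 y1 y2 \<and> B y1 v2 y2 \<and> B y1 y2 v3"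
    and EX1c: "{x1, x2, y1, y2} \<subseteq> V \<Longrightarrow>
        B x1 y1 y2 \<Longrightarrow> B x2 y1 y2 \<Longrightarrow> B x1 x2 y1 \<Longrightarrow> B x1 x2 y2 \<Longrightarrow>
        \<exists>v\<in>V. E v x1 \<and> E v x2 \<and> B y1 y2 v"
    and EX2a: "{y, z} \<subseteq> V \<Longrightarrow> E y z \<Longrightarrow> \<exists>v\<in>V. \<not> E v y \<and> \<not> E v z"
    and EX2b: "{y, z1, z2} \<subseteq> V \<Longrightarrow> E y z2 \<Longrightarrow> \<not> E z1 z2 \<Longrightarrow> z1 \<noteq> z2 \<Longrightarrow>
        \<exists>v\<in>V. \<not> E v y \<and> \<not> E v z1 \<and> \<not> E v z2 \<and> B v z1 z2 \<and> S y v z1 z2"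
    and EX2c: "{y1, y2, z1, z2} \<subseteq> V \<Longrightarrow>
        S y1 y2 z1 z2 \<Longrightarrow> \<not> E y1 y2 \<Longrightarrow> \<not> E z1 z2 \<Longrightarrow> E y1 z2 \<Longrightarrow>
        \<exists>v\<in>V. \<not> E y1 v \<and> \<not> E y2 v \<and> \<not> E z1 v \<and> \<not> E z2 v \<and>
          B y1 y2 v \<and> B v z1 z2 \<and> Sep S [y1, y2, v, z1, z2]"
    and EX3a: "{x, y} \<subseteq> V \<Longrightarrow> E x y \<Longrightarrow> \<exists>v\<in>V. E v x \<and> \<not> E v y"
    and EX3b: "{x1, x2, y} \<subseteq> V \<Longrightarrow> \<not> E x1 x2 \<Longrightarrow> E x1 y \<Longrightarrow> x1 \<noteq> x2 \<Longrightarrow>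
        \<exists>v\<in>V. E v x1 \<and> E v x2 \<and> \<not> E v y \<and> S y v x1 x2"
    and EX3c: "{x, y1, y2} \<subseteq> V \<Longrightarrow> E x y2 \<Longrightarrow> \<not> E y1 y2 \<Longrightarrow> y1 \<noteq> y2 \<Longrightarrow>
        \<exists>v\<in>V. E v x \<and> B y1 y2 v"
    and EX3d: "{x1, x2, y1, y2} \<subseteq> V \<Longrightarrow>
        \<not> E x1 x2 \<Longrightarrow> \<not> E y1 y2 \<Longrightarrow> E x1 y2 \<Longrightarrow> S x1 x2 y1 y2 \<Longrightarrow>
        \<exists>v\<in>V. E v x1 \<and> E v x2 \<and> \<not> E v y1 \<and> \<not> E v y2 \<and>
          B y1 y2 v \<and> Sep S [x1, x2, y1, y2, v]"
    and EX4a: "{x, y, z} \<subseteq> V \<Longrightarrow> distinct [x, y, z] \<Longrightarrow> induces_edge E {x, y, z} \<Longrightarrow>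
        \<exists>v\<in>V. E v x \<and> \<not> E v y \<and> \<not> E v z \<and> S x y v z"
    and EX4b: "{x1, x2, y, z} \<subseteq> V \<Longrightarrow> S x1 x2 y z \<Longrightarrow> \<not> E x1 x2 \<Longrightarrow>
        (\<And>x. x \<in> {x1, x2} \<Longrightarrow> induces_edge E {x, y, z}) \<Longrightarrow>
        \<exists>v\<in>V. E v x1 \<and> E v x2 \<and> \<not> E v y \<and> \<not> E v z \<and> Sep S [x1, x2, y, v, z]"
    and EX4c: "{x, y1, y2, z} \<subseteq> V \<Longrightarrow> S x y1 y2 z \<Longrightarrow> \<not> E y1 y2 \<Longrightarrow>
        (\<And>y. y \<in> {y1, y2} \<Longrightarrow> induces_edge E {x, y, z}) \<Longrightarrow>
        \<exists>v\<in>V. E v x \<and> \<not> E v z \<and> B y1 y2 v \<and> Sep S [x, y1, y2, v, z]"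
    and EX4d: "{x1, x2, y1, y2, z} \<subseteq> V \<Longrightarrow> Sep S [x1, x2, y1, y2, z] \<Longrightarrow>
        \<not> E x1 x2 \<Longrightarrow> \<not> E y1 y2 \<Longrightarrow>
        (\<And>x y. x \<in> {x1, x2} \<Longrightarrow> y \<in> {y1, y2} \<Longrightarrow> induces_edge E {x, y, z}) \<Longrightarrow>
        \<exists>v\<in>V. E v x1 \<and> E v x2 \<and> \<not> E v z \<and> B y1 y2 v \<and> Sep S [x1, x2, y1, y2, v, z]"
    and EX4e: "{x, y1, y2, z1, z2} \<subseteq> V \<Longrightarrow> Sep S [x, y1, y2, z1, z2] \<Longrightarrow>
        \<not> E y1 y2 \<Longrightarrow> \<not> E z1 z2 \<Longrightarrow>
        (\<And>y z. y \<in> {y1, y2} \<Longrightarrow> z \<in> {z1, z2} \<Longrightarrow> induces_edge E {x, y, z}) \<Longrightarrow>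
        \<exists>v\<in>V. E v x \<and> B y1 y2 v \<and> B v z1 z2 \<and> Sep S [x, y1, y2, v, z1, z2]"
    and EX4f: "{x1, x2, y1, y2, z1, z2} \<subseteq> V \<Longrightarrow> Sep S [x1, x2, y1, y2, z1, z2] \<Longrightarrow>
        \<not> E x1 x2 \<Longrightarrow> \<not> E y1 y2 \<Longrightarrow> \<not> E z1 z2 \<Longrightarrow>
        (\<And>x y z. x \<in> {x1, x2} \<Longrightarrow> y \<in> {y1, y2} \<Longrightarrow> z \<in> {z1, z2} \<Longrightarrow>
          induces_edge E {x, y, z}) \<Longrightarrow>
        \<exists>v\<in>V. E v x1 \<and> E v x2 \<and> B y1 y2 v \<and> B v z1 z2 \<and>
          Sep S [x1, x2, y1, y2, v, z1, z2]"

lemma (in universal_axioms) Sep_iff: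
  assumes V: "set xs \<subseteq> V"
  shows "Sep S xs \<longleftrightarrow> (\<forall>a b c d. a < b \<and> b < c \<and> c < d \<and> d < length xs \<longrightarrow>
    S (xs ! a) (xs ! b) (xs ! c) (xs ! d))"
    (is "_ \<longleftrightarrow> ?R")
proof
  assume "Sep S xs"
  then show ?R
    unfolding Sep_def index_sep_def by auto
next
  assume R: ?R
  let ?S = "\<lambda>a b c d. S (xs ! a) (xs ! b) (xs ! c) (xs ! d)"
  have rot: "?S a b c d \<longleftrightarrow> ?S b c d a" and ref: "?S a b c d \<longleftrightarrow> ?S d c b a"
    and dist: "?S a b c d \<Longrightarrow> distinct [xs ! a, xs ! b, xs ! c, xs ! d]"
    if "a < length xs" "b < length xs" "c < length xs" "d < length xs" for a b c d
  proof -
    have "{xs ! a, xs ! b, xs ! c, xs ! d} \<subseteq> V"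
      using that V by (auto simp: subset_iff)
    from US2[OF this] US3[OF this] S_distinct[OF this]
    show "?S a b c d \<longleftrightarrow> ?S b c d a" "?S a b c d \<longleftrightarrow> ?S d c b a"
      "?S a b c d \<Longrightarrow> distinct [xs ! a, xs ! b, xs ! c, xs ! d]"
      by blast+
  qed
  have base: "?S a b c d \<and> \<not> ?S a b d c \<and> \<not> ?S a c b d"
    if "a < b" "b < c" "c < d" "d < length xs" for a b c d
  proof -
    have s: "?S a b c d" using R that by blast
    have l: "a < length xs" "b < length xs" "c < length xs" "d < length xs" using that by auto
    have "{xs!a, xs!b, xs!c, xs!d} \<subseteq> V" using l V by (auto simp: subset_iff)
    then show ?thesis using US1[OF _ dist[OF l s]] s by blast
  qed
  have "?S a b c d \<longleftrightarrow> index_sep a b c d"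
    if l: "a < length xs" "b < length xs" "c < length xs" "d < length xs" for a b c d
  proof (cases "distinct [a, b, c, d]")
    case False
    then show ?thesis using dist[OF l] unfolding index_sep_def by auto
  next
    case True
    have *: "?S p q r s \<longleftrightarrow> index_sep p q r s"
      if "p < q" "p < r" "p < s" "distinct [q, r, s]"
        "p < length xs" "q < length xs" "r < length xs" "s < length xs" for p q r s
    proof -
      have flip: "?S p q r s \<longleftrightarrow> ?S p s r q"
        using ref[of p q r s] rot[of p s r q] rot[of s r q p] that by simp
      have "q \<noteq> r" "q \<noteq> s" "r \<noteq> s"
        using that by auto
      then consider "q < r" "r < s" | "q < s" "s < r" | "r < q" "q < s"
        | "r < s" "s < q" | "s < q" "q < r" | "s < r" "r < q"
        by (metis linorder_neqE_nat)
      then show ?thesis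
      proof cases
        case 1 then show ?thesis using base[of p q r s] that by (auto simp: index_sep_def)
      next
        case 2 then show ?thesis using base[of p q s r] that by (auto simp: index_sep_def)
      next
        case 3 then show ?thesis using base[of p r q s] that by (auto simp: index_sep_def)
      next
        case 4 then show ?thesis using flip base[of p r s q] that by (auto simp: index_sep_def)
      next
        case 5 then show ?thesis using flip base[of p s q r] that by (auto simp: index_sep_def)
      next
        case 6 then show ?thesis using flip base[of p s r q] that by (auto simp: index_sep_def)
      qed
    qed
    have irot: "index_sep p q r s \<longleftrightarrow> index_sep q r s p" for p q r s
      by (auto simp: index_sep_def min_def max_def)
    have "a \<noteq> b" "a \<noteq> c" "a \<noteq> d" "b \<noteq> c" "b \<noteq> d" "c \<noteq> d"
      using True by auto
    then consider "a < b" "a < c" "a < d" | "b < a" "b < c" "b < d"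
      | "c < a" "c < b" "c < d" | "d < a" "d < b" "d < c"
      by (metis linorder_neqE_nat less_trans)
    then show ?thesis
    proof cases
      case 1 then show ?thesis using *[of a b c d] l True by auto
    next
      case 2 then show ?thesis
        using *[of b c d a] l True rot[of a b c d] irot[of a b c d] by auto
    next
      case 3 then show ?thesis
        using *[of c d a b] l True rot[of a b c d] rot[of b c d a]
          irot[of a b c d] irot[of b c d a] by auto
    next
      case 4 then show ?thesis
        using *[of d a b c] l True rot[of d a b c] irot[of d a b c] by auto
    qed
  qed
  then show "Sep S xs" unfolding Sep_def by blast
qed


section \<open>The structure on the circle\<close>

text \<open>For unit complex numbers \<open>x\<close> and \<open>y\<close>, the circular arc traversed
  counterclockwise from \<open>x\<close> to \<open>y\<close>, and its length. The two circular arcs with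
  end-points \<open>x\<close> and \<open>y\<close> are \<open>ccw_arc x y\<close> and \<open>ccw_arc y x\<close>.\<close>

definition ccw_length :: "complex \<Rightarrow> complex \<Rightarrow> real" where
  "ccw_length x y = Arg2pi (y / x)"

definition ccw_arc :: "complex \<Rightarrow> complex \<Rightarrow> complex set" where
  "ccw_arc x y = (\<lambda>t. x * cis t) ` {0..ccw_length x y}"

text \<open>Two points lie at a rational angle if some value of the angle, which is only defined
  modulo \<open>2 * pi\<close>, is rational in radians. (Requiring this of the value in
  \<open>{0..pi}\<close> would rule out dense sets.)\<close>

definition C3_vertices :: "complex set \<Rightarrow> bool" where
  "C3_vertices P \<longleftrightarrow> P \<subseteq> sphere 0 1 \<and> countable P \<and> sphere 0 1 \<subseteq> closure P \<and>
     (\<forall>x\<in>P. \<forall>y\<in>P. x \<noteq> y \<longrightarrow> (\<exists>q\<in>\<rat>. y = x * cis q))"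

definition C3_E :: "complex \<Rightarrow> complex \<Rightarrow> bool" where
  "C3_E x y \<longleftrightarrow> ccw_length x y > 1/3 * (2 * pi) \<and> ccw_length y x > 1/3 * (2 * pi)"

definition C3_B :: "complex \<Rightarrow> complex \<Rightarrow> complex \<Rightarrow> bool" where
  "C3_B x y z \<longleftrightarrow> distinct [x, y, z] \<and> independent_set C3_E {x, y, z} \<and>
     ((ccw_length x z < ccw_length z x \<and> y \<in> ccw_arc x z) \<or>
      (ccw_length z x < ccw_length x z \<and> y \<in> ccw_arc z x))"

definition C3_S :: "complex \<Rightarrow> complex \<Rightarrow> complex \<Rightarrow> complex \<Rightarrow> bool" where
  "C3_S x1 x2 x3 x4 \<longleftrightarrow> distinct [x1, x2, x3, x4] \<and>
     \<not> connected_component (sphere 0 1 - {x1, x3}) x2 x4"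

lemma C3_vertices_cis_Rats: "C3_vertices (cis ` \<rat>)"
  unfolding C3_vertices_def
proof (intro conjI ballI impI)
  show "cis ` \<rat> \<subseteq> sphere 0 1" by auto
  show "countable (cis ` \<rat>)" by (simp add: countable_rat)
  have "cis ` closure \<rat> \<subseteq> closure (cis ` \<rat>)"
    by (intro image_closure_subset continuous_intros closure_subset closed_closure)
  moreover have "z \<in> range cis" if "z \<in> sphere 0 1" for z
    using that rcis_cmod_Arg[of z] by (auto simp: rcis_def intro: range_eqI[of _ _ "Arg z"])
  moreover have "closure (\<rat> :: real set) = UNIV"
    by (simp add: Rats_closure_real)
  ultimately show "sphere 0 1 \<subseteq> closure (cis ` \<rat>)"
    by auto
next
  fix x y assume "x \<in> cis ` \<rat>" "y \<in> cis ` \<rat>"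
  then obtain p q where "p \<in> \<rat>" "q \<in> \<rat>" "x = cis p" "y = cis q" by auto
  then show "\<exists>q\<in>\<rat>. y = x * cis q"
    by (intro bexI[of _ "q - p"]) (auto simp: cis_mult)
qed


section \<open>Isomorphism\<close>

definition isomorphic_EBS ::
  "'a set \<Rightarrow> ('a \<Rightarrow> 'a \<Rightarrow> bool) \<Rightarrow> ('a \<Rightarrow> 'a \<Rightarrow> 'a \<Rightarrow> bool) \<Rightarrow> ('a \<Rightarrow> 'a \<Rightarrow> 'a \<Rightarrow> 'a \<Rightarrow> bool) \<Rightarrow>
   'b set \<Rightarrow> ('b \<Rightarrow> 'b \<Rightarrow> bool) \<Rightarrow> ('b \<Rightarrow> 'b \<Rightarrow> 'b \<Rightarrow> bool) \<Rightarrow> ('b \<Rightarrow> 'b \<Rightarrow> 'b \<Rightarrow> 'b \<Rightarrow> bool) \<Rightarrow> bool" where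
  "isomorphic_EBS V E B S V' E' B' S' \<longleftrightarrow> (\<exists>f. bij_betw f V V' \<and>
     (\<forall>x\<in>V. \<forall>y\<in>V. E x y \<longleftrightarrow> E' (f x) (f y)) \<and>
     (\<forall>x\<in>V. \<forall>y\<in>V. \<forall>z\<in>V. B x y z \<longleftrightarrow> B' (f x) (f y) (f z)) \<and>
     (\<forall>x\<in>V. \<forall>y\<in>V. \<forall>z\<in>V. \<forall>w\<in>V. S x y z w \<longleftrightarrow> S' (f x) (f y) (f z) (f w)))"

end

theory Submission
  imports Defs "HOL-Computational_Algebra.Polynomial"
begin

text \<open>
  The theorem combines two facts: any two countable models of the axioms are isomorphic, and the
  structure on the circle is a model.

  \<^emph>\<open>Models are isomorphic.\<close> In the circle, orient every non-edge: \<open>x\<close> points to \<open>y\<close> when \<open>y\<close>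
  lies less than a third of the circumference counterclockwise of \<open>x\<close>. Let \<open>d x y\<close> be \<open>1\<close>, \<open>-1\<close>
  or \<open>0\<close> according to whether \<open>x\<close> points to \<open>y\<close>, \<open>y\<close> points to \<open>x\<close>, or neither. If the circle is
  wrapped three times around a circle of a third of its length, then modulo 3 the sum \<open>d x y + d
  y z + d z x\<close> is \<open>1\<close> or \<open>-1\<close> according to the cyclic order of the three images. Hence this sum
  is never divisible by 3, and this condition alone describes the finite substructures (locale
  \<open>turn_structure\<close>): since the sum is a coboundary, the transitivity of the cyclic order is
  automatic. It also shows that among any three points one gives no information about a new
  point that the other two do not give (\<open>redundant_point\<close>). So once all consistent types over at
  most two points are realized, all consistent finite types are (\<open>realize_type\<close>), and two
  countable structures are isomorphic by back and forth (\<open>turn_structure_unique\<close>).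

  To apply this to a model of the axioms, an orientation has to be found. The betweenness
  relation divides the non-neighbours of each vertex into two sides, and the sides at all
  vertices can be labelled positive and negative coherently, starting from one labelled side at
  one vertex (\<open>positive_side_antisym\<close>). The universal axioms then give the condition on
  triangles and the extension axioms the types over one and two points (\<open>turn_structure_turn\<close>).
  An isomorphism for \<open>d\<close> preserves \<open>E\<close> and \<open>B\<close>, hence also \<open>S\<close>, which in a model is definable
  from \<open>E\<close> and \<open>B\<close> (\<open>S_iff_separation_of\<close>).

  \<^emph>\<open>The circle is a model.\<close> A \<open>circle_chart\<close> places the vertices densely on a circle of length
  3, no two of them at distance exactly 1, so that \<open>E\<close>, \<open>B\<close> and \<open>S\<close> are given by the positions.
  Charts can be rotated and reflected, so the axioms become statements about points in a
  prescribed order starting at 0, where they reduce to linear inequalities (\<open>universal_axioms\<close>,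
  \<open>extension_axioms\<close>). The angle gives a chart of \<open>C3\<close> (\<open>chart_C3\<close>); two of its points are never
  a third of the circumference apart because \<open>pi\<close> is irrational. Charts can be pulled back along
  isomorphisms.
\<close>

section \<open>Back and forth between countable sets\<close>

text \<open>The conclusion speaks of pairs of points because the isomorphisms built below preserve a
  binary function.\<close>
lemma back_and_forth:
  fixes I :: "('a \<times> 'b) set \<Rightarrow> bool"
  assumes "countable V" "countable W" "V \<noteq> {}" "W \<noteq> {}"
    and start: "I {}"
    and forw: "\<And>R v. I R \<Longrightarrow> v \<in> V \<Longrightarrow> \<exists>R'. I R' \<and> R \<subseteq> R' \<and> v \<in> Domain R'"
    and backw: "\<And>R w. I R \<Longrightarrow> w \<in> W \<Longrightarrow> \<exists>R'. I R' \<and> R \<subseteq> R' \<and> w \<in> Range R'"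
    and func: "\<And>R. I R \<Longrightarrow> R \<subseteq> V \<times> W"
    and inj: "\<And>R a a' b b'. I R \<Longrightarrow> (a, a') \<in> R \<Longrightarrow> (b, b') \<in> R \<Longrightarrow> a = b \<longleftrightarrow> a' = b'"
  shows "\<exists>f. bij_betw f V W \<and> (\<forall>a\<in>V. \<forall>b\<in>V. \<exists>R. I R \<and> (a, f a) \<in> R \<and> (b, f b) \<in> R)"
proof -
  define Q where "Q n R R' \<longleftrightarrow> R \<subseteq> R' \<and> from_nat_into V n \<in> Domain R' \<and> from_nat_into W n \<in> Range R'"
    for n R R'
  have "\<exists>R'. I R' \<and> Q n R R'" if R: "I R" for n R
  proof -
    obtain R1 where R1: "I R1" "R \<subseteq> R1" "from_nat_into V n \<in> Domain R1"
      using forw[OF R from_nat_into[OF \<open>V \<noteq> {}\<close>]] by blast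
    obtain R2 where "I R2" "R1 \<subseteq> R2" "from_nat_into W n \<in> Range R2"
      using backw[OF R1(1) from_nat_into[OF \<open>W \<noteq> {}\<close>]] by blast
    with R1 show ?thesis unfolding Q_def by blast
  qed
  then obtain R where IR: "\<And>n. I (R n)" and QR: "\<And>n. Q n (R n) (R (Suc n))"
    using dependent_nat_choice[of "\<lambda>_. I" Q] start by metis
  have mono: "R m \<subseteq> R n" if "m \<le> n" for m n
    using that QR lift_Suc_mono_le[of R] unfolding Q_def by blast
  define G where "G = (\<Union>n. R n)"
  have common: "\<exists>R. I R \<and> p \<in> R \<and> q \<in> R" if pq: "p \<in> G" "q \<in> G" for p q
  proof -
    obtain m n where "p \<in> R m" "q \<in> R n" using pq unfolding G_def by blast
    then have "p \<in> R (max m n)" "q \<in> R (max m n)" using mono[of _ "max m n"]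
      by (meson in_mono max.cobounded1 max.cobounded2)+
    then show ?thesis using IR by blast
  qed
  have GVW: "G \<subseteq> V \<times> W" using func[OF IR] unfolding G_def by blast
  have G_inj: "a = b \<longleftrightarrow> a' = b'" if "(a, a') \<in> G" "(b, b') \<in> G" for a a' b b'
    using common[OF that] inj by blast
  have dom: "\<exists>a'. (a, a') \<in> G" if "a \<in> V" for a
  proof -
    from from_nat_into_surj[OF \<open>countable V\<close> that] obtain n where "from_nat_into V n = a"
      by blast
    then show ?thesis using QR[of n] unfolding Q_def G_def by blast
  qed
  have ran: "\<exists>a. (a, a') \<in> G" if "a' \<in> W" for a'
  proof -
    from from_nat_into_surj[OF \<open>countable W\<close> that] obtain n where "from_nat_into W n = a'"
      by blast
    then show ?thesis using QR[of n] unfolding Q_def G_def by blast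
  qed
  obtain f where f: "\<And>a. a \<in> V \<Longrightarrow> (a, f a) \<in> G" using dom by metis
  have "inj_on f V" using f G_inj by (intro inj_onI) metis
  moreover have "f ` V = W" using f ran GVW G_inj by (fastforce simp: image_iff)
  ultimately show ?thesis using common f unfolding bij_betw_def by blast
qed

section \<open>Structures determined by turns\<close>

text \<open>The sum in \<open>triangle\<close> is unchanged by cyclic rotation and changes its sign under a
  transposition. For the circle, reducing positions modulo a third of the circumference, it is
  \<open>1\<close> modulo 3 if the three reduced points are in counterclockwise order and \<open>-1\<close> otherwise. The
  assumptions \<open>extend1\<close> and \<open>extend2\<close> realize every type over one or two points that \<open>triangle\<close>
  permits.\<close>
locale turn_structure =
  fixes V :: "'a set" and d :: "'a \<Rightarrow> 'a \<Rightarrow> int"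
  assumes nonempty: "V \<noteq> {}"
    and d_range: "x \<in> V \<Longrightarrow> y \<in> V \<Longrightarrow> d x y \<in> {-1, 0, 1}"
    and antisym: "x \<in> V \<Longrightarrow> y \<in> V \<Longrightarrow> d y x = - d x y"
    and triangle: "x \<in> V \<Longrightarrow> y \<in> V \<Longrightarrow> z \<in> V \<Longrightarrow> distinct [x, y, z] \<Longrightarrow>
      \<not> 3 dvd d x y + d y z + d z x"
    and extend1: "p \<in> V \<Longrightarrow> c \<in> {-1, 0, 1} \<Longrightarrow> \<exists>r\<in>V. r \<noteq> p \<and> d r p = c"
    and extend2: "p \<in> V \<Longrightarrow> q \<in> V \<Longrightarrow> p \<noteq> q \<Longrightarrow> c \<in> {-1, 0, 1} \<Longrightarrow> c' \<in> {-1, 0, 1} \<Longrightarrow>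
      \<not> 3 dvd c + d p q - c' \<Longrightarrow> \<exists>r\<in>V. r \<noteq> p \<and> r \<noteq> q \<and> d r p = c \<and> d r q = c'"
begin

text \<open>Here \<open>ta\<close>, \<open>tb\<close>, \<open>tc\<close> is a type over \<open>a\<close>, \<open>b\<close>, \<open>c\<close>, so \<open>ta + d a b - tb\<close> is the
  orientation of a realization together with \<open>a\<close> and \<open>b\<close>. The assumption \<open>sides\<close> says that this
  orientation is opposite to that of \<open>c\<close>, \<open>a\<close>, \<open>b\<close>: on the reduced circle, \<open>a\<close> and \<open>b\<close> separate
  the realization from \<open>c\<close>. The orientations of \<open>v\<close> with \<open>b\<close>, \<open>c\<close> and with \<open>c\<close>, \<open>a\<close> are then
  forced, and they determine \<open>d v c\<close> modulo 3.\<close>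
lemma redundant_point:
  assumes V: "a \<in> V" "b \<in> V" "c \<in> V" "v \<in> V" and dist: "distinct [a, b, c]" "v \<noteq> a" "v \<noteq> b"
    and t: "ta \<in> {-1, 0, 1}" "tb \<in> {-1, 0, 1}" "tc \<in> {-1, 0, 1}"
    and bc: "\<not> 3 dvd tb + d b c - tc" and ca: "\<not> 3 dvd tc + d c a - ta"
    and sides: "3 dvd (ta + d a b - tb) + (d a b + d b c + d c a)"
    and v: "d v a = ta" "d v b = tb"
  shows "v \<noteq> c \<and> d v c = tc"
proof -
  note rng = d_range[OF \<open>a \<in> V\<close> \<open>b \<in> V\<close>] d_range[OF \<open>b \<in> V\<close> \<open>c \<in> V\<close>] d_range[OF \<open>c \<in> V\<close> \<open>a \<in> V\<close>]
  note tri = triangle[OF V(1-3) dist(1)]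
  have "v \<noteq> c"
  proof
    assume "v = c"
    then have "ta = d c a" "tb = - d b c" using v antisym[OF V(2,3)] by auto
    then have "3 dvd 2 * (d a b + d b c + d c a)" using sides by (simp add: algebra_simps)
    then show False using tri by presburger
  qed
  have n: "\<not> 3 dvd tb + d b c - d v c" "\<not> 3 dvd d v c + d c a - ta"
    using triangle[of v b c] triangle[of v c a] V dist \<open>v \<noteq> c\<close> v antisym[of v c] antisym[of v a]
    by auto
  have "d v c \<in> {-1, 0, 1}" using d_range V by blast
  then have "3 dvd (d v c - tc)"
    using n bc ca sides tri by presburger
  then have "d v c = tc" using \<open>d v c \<in> {-1, 0, 1}\<close> t by auto
  then show ?thesis using \<open>v \<noteq> c\<close> by blast
qed

text \<open>Any three points cut the reduced circle into three arcs. The new point falls into one of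
  them, and the third point, which is not an end of that arc, can be dropped.\<close>
lemma realize_type:
  assumes "finite A" "A \<subseteq> V" "\<And>a. a \<in> A \<Longrightarrow> \<tau> a \<in> {-1, 0, 1}"
    and "\<And>a b. a \<in> A \<Longrightarrow> b \<in> A \<Longrightarrow> a \<noteq> b \<Longrightarrow> \<not> 3 dvd \<tau> a + d a b - \<tau> b"
  shows "\<exists>v\<in>V - A. \<forall>a\<in>A. d v a = \<tau> a"
  using assms
proof (induction "card A" arbitrary: A rule: less_induct)
  case less
  consider "card A = 0" | "card A = 1" | "card A = 2" | "card A \<ge> 3" by linarith
  then show ?case
  proof cases
    case 1
    then show ?thesis using nonempty less.prems(1) by auto
  next
    case 2
    then obtain p where "A = {p}" by (auto simp: card_1_singleton_iff)
    then show ?thesis using extend1[of p "\<tau> p"] less.prems by auto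
  next
    case 3
    then obtain p q where "A = {p, q}" "p \<noteq> q" by (auto simp: card_2_iff)
    then show ?thesis using extend2[of p q "\<tau> p" "\<tau> q"] less.prems by auto
  next
    case 4
    then obtain A3 where "A3 \<subseteq> A" "card A3 = 3" by (meson obtain_subset_with_card_n)
    then obtain x y z where xyz: "x \<in> A" "y \<in> A" "z \<in> A" "distinct [x, y, z]"
      by (auto simp: card_3_iff)
    let ?side = "\<lambda>a b c. 3 dvd (\<tau> a + d a b - \<tau> b) + (d a b + d b c + d c a)"
    have "\<not> 3 dvd d x y + d y z + d z x" using triangle xyz less.prems(2) by blast
    moreover have "\<not> 3 dvd \<tau> x + d x y - \<tau> y" "\<not> 3 dvd \<tau> y + d y z - \<tau> z"
      "\<not> 3 dvd \<tau> z + d z x - \<tau> x"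
      using less.prems(4) xyz by auto
    \<comment> \<open>The three orientations involving \<open>\<tau>\<close> are \<open>1\<close> or \<open>-1\<close> and add up to that of \<open>x\<close>, \<open>y\<close>, \<open>z\<close>
      modulo 3, so exactly one of them is opposite to it.\<close>
    ultimately have "?side x y z \<or> ?side y z x \<or> ?side z x y" by presburger
    then obtain a b c where abc: "a \<in> A" "b \<in> A" "c \<in> A"
      "distinct [a, b, c]" and side: "?side a b c"
      using xyz by auto
    have "card (A - {c}) < card A" using abc less.prems(1) by (meson card_Diff1_less)
    then obtain v where v: "v \<in> V - (A - {c})" "\<forall>a\<in>A - {c}. d v a = \<tau> a"
      using less.hyps[of "A - {c}"] less.prems by blast
    have "v \<noteq> c \<and> d v c = \<tau> c"
    proof (rule redundant_point[of a b c v "\<tau> a" "\<tau> b"])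
      show "\<not> 3 dvd \<tau> b + d b c - \<tau> c" "\<not> 3 dvd \<tau> c + d c a - \<tau> a"
        using less.prems(4) abc by auto
    qed (use abc v less.prems(2,3) side in auto)
    then show ?thesis using v by (intro bexI[of _ v]) auto
  qed
qed

end

definition partial_iso ::
  "'a set \<Rightarrow> ('a \<Rightarrow> 'a \<Rightarrow> int) \<Rightarrow> 'b set \<Rightarrow> ('b \<Rightarrow> 'b \<Rightarrow> int) \<Rightarrow> ('a \<times> 'b) set \<Rightarrow> bool" where
  "partial_iso V d W e R \<longleftrightarrow> finite R \<and> R \<subseteq> V \<times> W \<and>
     (\<forall>a a' b b'. (a, a') \<in> R \<longrightarrow> (b, b') \<in> R \<longrightarrow> (a = b \<longleftrightarrow> a' = b') \<and> d a b = e a' b')"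

lemma partial_isoD:
  assumes "partial_iso V d W e R" "(a, a') \<in> R" "(b, b') \<in> R"
  shows "a = b \<longleftrightarrow> a' = b'" "d a b = e a' b'" "a \<in> V" "a' \<in> W"
  using assms unfolding partial_iso_def by blast+

text \<open>The type of \<open>v\<close> over the domain is carried over to the range and realized there.\<close>
lemma partial_iso_extend:
  assumes V: "turn_structure V d" and W: "turn_structure W e"
    and R: "partial_iso V d W e R" and v: "v \<in> V"
  shows "\<exists>R'. partial_iso V d W e R' \<and> R \<subseteq> R' \<and> v \<in> Domain R'"
proof (cases "v \<in> Domain R")
  case True
  then show ?thesis using R by blast
next
  case False
  interpret V: turn_structure V d by fact
  interpret W: turn_structure W e by fact
  define g where "g a' = (THE a. (a, a') \<in> R)" for a'
  have g: "g a' = a" if "(a, a') \<in> R" for a a'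
    unfolding g_def using that partial_isoD(1)[OF R that] by (intro the_equality) auto
  have "\<exists>w\<in>W - Range R. \<forall>a'\<in>Range R. e w a' = d v (g a')"
  proof (rule W.realize_type)
    show "finite (Range R)" "Range R \<subseteq> W" using R by (auto simp: partial_iso_def finite_Range)
    fix a' assume "a' \<in> Range R"
    then obtain a where a: "(a, a') \<in> R" by blast
    note a_V = partial_isoD(3)[OF R a a]
    show "d v (g a') \<in> {-1, 0, 1}" using g[OF a] V.d_range[OF v a_V] by simp
    fix b' assume "b' \<in> Range R" "a' \<noteq> b'"
    then obtain b where b: "(b, b') \<in> R" by blast
    note b_V = partial_isoD(3)[OF R b b]
    have "a \<noteq> b" "d a b = e a' b'" using partial_isoD(1,2)[OF R a b] \<open>a' \<noteq> b'\<close> by auto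
    moreover have "v \<noteq> a" "v \<noteq> b" using a b False by auto
    ultimately have "\<not> 3 dvd d v a + e a' b' + d b v" using V.triangle[of v a b] v a_V b_V by auto
    then show "\<not> 3 dvd d v (g a') + e a' b' - d v (g b')"
      using g[OF a] g[OF b] V.antisym[OF v b_V] by simp
  qed
  then obtain w where w: "w \<in> W" "w \<notin> Range R" "\<And>a a'. (a, a') \<in> R \<Longrightarrow> d v a = e w a'"
    using g by (metis DiffE RangeI)
  have "d v v = 0" "e w w = 0" using V.antisym[OF v v] W.antisym[OF w(1) w(1)] by auto
  moreover have "d a v = e a' w" if "(a, a') \<in> R" for a a'
    using w(3)[OF that] V.antisym[OF v] W.antisym[OF w(1)] partial_isoD(3,4)[OF R that that]
    by metis
  ultimately have "partial_iso V d W e (insert (v, w) R)"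
    using R v w False unfolding partial_iso_def by (auto 0 3)
  then show ?thesis by blast
qed

lemma partial_iso_converse: "partial_iso V d W e R \<longleftrightarrow> partial_iso W e V d (R\<inverse>)"
  unfolding partial_iso_def by (auto; blast)

theorem turn_structure_unique:
  assumes V: "turn_structure V d" "countable V" and W: "turn_structure W e" "countable W"
  shows "\<exists>f. bij_betw f V W \<and> (\<forall>a\<in>V. \<forall>b\<in>V. d a b = e (f a) (f b))"
proof -
  have "\<exists>f. bij_betw f V W \<and>
    (\<forall>a\<in>V. \<forall>b\<in>V. \<exists>R. partial_iso V d W e R \<and> (a, f a) \<in> R \<and> (b, f b) \<in> R)"
  proof (rule back_and_forth)
    show "V \<noteq> {}" "W \<noteq> {}" using V W turn_structure.nonempty by blast+
    show "partial_iso V d W e {}" by (simp add: partial_iso_def)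
    fix R assume R: "partial_iso V d W e R"
    show "R \<subseteq> V \<times> W" using R unfolding partial_iso_def by blast
    show "a = b \<longleftrightarrow> a' = b'" if "(a, a') \<in> R" "(b, b') \<in> R" for a a' b b'
      using partial_isoD(1)[OF R that] .
    show "\<exists>R'. partial_iso V d W e R' \<and> R \<subseteq> R' \<and> v \<in> Domain R'" if "v \<in> V" for v
      using partial_iso_extend[OF V(1) W(1) R that] .
    show "\<exists>R'. partial_iso V d W e R' \<and> R \<subseteq> R' \<and> w \<in> Range R'" if "w \<in> W" for w
    proof -
      have "partial_iso W e V d (R\<inverse>)" using R partial_iso_converse by blast
      from partial_iso_extend[OF W(1) V(1) this that]
      obtain R' where "partial_iso W e V d R'" "R\<inverse> \<subseteq> R'" "w \<in> Domain R'" by blast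
      then show ?thesis
        using partial_iso_converse[of V d W e "R'\<inverse>"] by (intro exI[of _ "R'\<inverse>"]) auto
    qed
  qed (use V W in auto)
  then show ?thesis using partial_isoD(2) by meson
qed

section \<open>The two sides of a vertex\<close>

context universal_axioms begin

text \<open>Meaningful for non-neighbours \<open>y\<close> and \<open>z\<close> of \<open>x\<close>; by \<open>same_side_iff\<close> it is then an
  equivalence relation with at most two classes, which on the circle are the two arcs of a third
  of the circumference that start at \<open>x\<close>.\<close>
definition same_side :: "'a \<Rightarrow> 'a \<Rightarrow> 'a \<Rightarrow> bool" where
  "same_side x y z \<longleftrightarrow> y = z \<or> B x y z \<or> B x z y"

definition nonnbrs :: "'a \<Rightarrow> 'a set" where
  "nonnbrs x = {y \<in> V. y \<noteq> x \<and> \<not> E x y}"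

lemma E_commute: "x \<in> V \<Longrightarrow> y \<in> V \<Longrightarrow> E x y \<longleftrightarrow> E y x"
  using UE1_sym[of x y] UE1_sym[of y x] by auto

lemma B_commute: "x \<in> V \<Longrightarrow> y \<in> V \<Longrightarrow> z \<in> V \<Longrightarrow> B x y z \<longleftrightarrow> B z y x"
  using UB1[of x y z] by auto

lemma B_exclusive: "x \<in> V \<Longrightarrow> y \<in> V \<Longrightarrow> z \<in> V \<Longrightarrow> B x y z \<Longrightarrow> \<not> B y z x \<and> \<not> B y x z \<and> \<not> B z x y \<and> \<not> B x z y"
  using UB2[of x y z] UB2[of z y x] B_commute by auto

lemma B_imp:
  assumes "x \<in> V" "y \<in> V" "z \<in> V" "B x y z"
  shows "x \<noteq> y" "y \<noteq> z" "x \<noteq> z" "\<not> E x y" "\<not> E y z" "\<not> E x z"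
  using assms UM1[of x y z] unfolding independent_set_def by auto

lemma B_cases:
  assumes "x \<in> V" "y \<in> V" "z \<in> V" "x \<noteq> y" "y \<noteq> z" "x \<noteq> z" "\<not> E x y" "\<not> E y z" "\<not> E x z"
  shows "B x y z \<or> B y z x \<or> B z x y"
proof -
  have "independent_set E {x, y, z}" using assms UE1_loopless E_commute
    unfolding independent_set_def by auto
  then show ?thesis using assms UM1[of x y z] by auto
qed

lemma same_side_commute: "same_side x y z \<longleftrightarrow> same_side x z y"
  unfolding same_side_def by auto

lemma not_same_side:
  assumes "x \<in> V" "y \<in> nonnbrs x" "z \<in> nonnbrs x"
  shows "\<not> same_side x y z \<longleftrightarrow> E y z \<or> B y x z"
proof -
  have V: "y \<in> V" "z \<in> V" and n: "y \<noteq> x" "z \<noteq> x" "\<not> E x y" "\<not> E x z"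
    using assms unfolding nonnbrs_def by auto
  have "B x y z \<or> B x z y \<or> B y x z" if "y \<noteq> z" "\<not> E y z"
    using B_cases[of x y z] n that V \<open>x \<in> V\<close> B_commute by metis
  moreover have "\<not> E y z" if "same_side x y z"
    using that B_imp(5)[OF \<open>x \<in> V\<close>] E_commute V UE1_loopless unfolding same_side_def by blast
  moreover have "\<not> B y x z" if "same_side x y z"
    using that B_exclusive[of y x z] B_imp(3)[of y x z] B_commute V \<open>x \<in> V\<close> unfolding same_side_def
    by blast
  ultimately show ?thesis unfolding same_side_def by blast
qed

lemma same_side_edge: "x \<in> V \<Longrightarrow> y \<in> nonnbrs x \<Longrightarrow> z \<in> nonnbrs x \<Longrightarrow> E y z \<Longrightarrow> \<not> same_side x y z"
  using not_same_side by blast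

lemma same_side_if_opposite_B:
  assumes V: "x \<in> V" "y \<in> V" "z \<in> V" "w \<in> V" and yz: "B y x z" and yw: "B y x w"
  shows "same_side x z w"
proof -
  have *: "B x z w" if "B y x z" "B y z w" "z \<in> V" "w \<in> V" for z w
  proof -
    have "B z x y" "B w z y" using that B_commute V by blast+
    then have "B w z x" using UB3[of w z y x] V that by auto
    then show ?thesis using B_commute V that by blast
  qed
  show ?thesis
  proof (cases "z = w")
    case False
    then have "B y z w \<or> B y w z" using UB4[of y x z w] yz yw V by auto
    then show ?thesis using * yz yw V unfolding same_side_def by blast
  qed (simp add: same_side_def)
qed

lemma same_side_if_opposite:
  assumes x: "x \<in> V" and N: "y \<in> nonnbrs x" "z \<in> nonnbrs x" "w \<in> nonnbrs x"
    and yz: "\<not> same_side x y z" and yw: "\<not> same_side x y w"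
  shows "same_side x z w"
proof -
  have V: "y \<in> V" "z \<in> V" "w \<in> V" and nE: "\<not> E x y" "\<not> E x z" "\<not> E x w"
    using N unfolding nonnbrs_def by auto
  have mixed: "same_side x z w"
    if "E y z" "B y x w" "z \<in> V" "w \<in> V" "z \<in> nonnbrs x" "w \<in> nonnbrs x" for z w
  proof (rule ccontr)
    assume "\<not> same_side x z w"
    then have "E z w \<or> B z x w" using not_same_side x that by blast
    then show False
    proof
      assume "E z w"
      then have "E x z" using UM4[of y x w z] that x V E_commute[of w z] by auto
      then show False using that unfolding nonnbrs_def by auto
    next
      assume "B z x w"
      then have "same_side x y z" using same_side_if_opposite_B[of x w y z] x V that B_commute
        by blast
      then show False using same_side_edge[OF x N(1)] that by blast
    qed
  qed
  have "E y z \<or> B y x z" "E y w \<or> B y x w" using not_same_side x N yz yw by blast+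
  moreover have "same_side x z w" if "E y z" "E y w"
  proof (rule ccontr)
    assume "\<not> same_side x z w"
    then have "E z w \<or> B z x w" using not_same_side x N by blast
    then show False using UE2[of y z w] UM4[of z x w y] that V x nE E_commute by auto
  qed
  ultimately show ?thesis
    using mixed[of z w] mixed[of w z] same_side_if_opposite_B[of x y z w] same_side_commute V N x
    by blast
qed

lemma same_side_trans:
  assumes x: "x \<in> V" and N: "y \<in> nonnbrs x" "z \<in> nonnbrs x" "w \<in> nonnbrs x"
    and yz: "same_side x y z" and zw: "same_side x z w"
  shows "same_side x y w"
proof -
  have V: "y \<in> V" "z \<in> V" "w \<in> V" and nE: "\<not> E x y" "\<not> E x z" "\<not> E x w"
    using N unfolding nonnbrs_def by auto
  have inner: "B x y w" if "B x y z" "B x z w" "y \<in> V" "w \<in> V" for y w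
  proof -
    have "B z y x" "B w z x" using that B_commute V x by blast+
    then have "B w y x" using UB3[of w z x y] V x that by auto
    then show ?thesis using B_commute V x that by blast
  qed
  have both: "same_side x y w" if yz: "B x y z" and wz: "B x w z"
  proof (rule ccontr)
    assume "\<not> same_side x y w"
    then have "E y w \<or> B y x w" using not_same_side x N by blast
    then show False
    proof
      assume "E y w"
      then show False using UM3[of x y z w] B_imp[OF x V(3,2) wz] yz V x nE E_commute by auto
    next
      assume "B y x w"
      then have "B w x y" using B_commute V x by blast
      then have "B w x z" using UM2[of w x y z] yz V x B_imp[OF x V(3,2) wz] by auto
      then show False using B_exclusive[OF x V(3,2) wz] by blast
    qed
  qed
  have outer: "same_side x y w" if "B x z y" "B x z w"
    using UB4[of x z y w] that V x unfolding same_side_def by auto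
  show ?thesis
    using yz zw inner[of y w] inner[of w y] both outer V unfolding same_side_def by blast
qed

lemma same_side_iff:
  assumes "x \<in> V" "y \<in> nonnbrs x" "z \<in> nonnbrs x" "w \<in> nonnbrs x"
  shows "same_side x y w \<longleftrightarrow> (same_side x y z \<longleftrightarrow> same_side x z w)"
  using same_side_if_opposite[of x z y w] same_side_trans[of x] same_side_commute[of x] assms
  by blast

text \<open>Two adjacent vertices divide their common non-neighbours in the same way. If \<open>p\<close> and \<open>q\<close>
  are adjacent, they are on different sides of both. Otherwise \<open>x\<close> cannot be between them, as
  its neighbour \<open>y\<close> would be adjacent to one of them.\<close>
lemma same_side_edge_eq:
  assumes "x \<in> V" "y \<in> V" "E x y" "p \<in> nonnbrs x \<inter> nonnbrs y" "q \<in> nonnbrs x \<inter> nonnbrs y"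
  shows "same_side x p q \<longleftrightarrow> same_side y p q"
proof -
  have "\<not> B p x q"
    if "x \<in> V" "y \<in> V" "E x y" "p \<in> nonnbrs x \<inter> nonnbrs y" "q \<in> nonnbrs x \<inter> nonnbrs y" for x y
    using UM3[of p x q y] that E_commute[of p y] E_commute[of q y] unfolding nonnbrs_def by auto
  then show ?thesis using not_same_side[of x p q] not_same_side[of y p q] assms E_commute[of x y]
    by blast
qed

lemma B_same_side:
  assumes "x \<in> V" "y \<in> V" "z \<in> V" "B x y z"
  shows "\<not> same_side y x z" "same_side x y z" "same_side z x y"
proof -
  have "B z y x" using assms B_commute by blast
  then show "same_side x y z" "same_side z x y" using assms(4) unfolding same_side_def by auto
  have "x \<in> nonnbrs y" "z \<in> nonnbrs y"
    using B_imp[OF assms] assms E_commute unfolding nonnbrs_def by blast+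
  then show "\<not> same_side y x z" using not_same_side assms by blast
qed

text \<open>The vertex with the other two on different sides is the one that \<open>B\<close> puts in the middle.\<close>
lemma independent_sides:
  assumes "x \<in> V" "y \<in> nonnbrs x" "z \<in> nonnbrs x" "z \<in> nonnbrs y"
  shows "(\<not> same_side x y z \<and> same_side y x z \<and> same_side z x y) \<or>
    (same_side x y z \<and> \<not> same_side y x z \<and> same_side z x y) \<or>
    (same_side x y z \<and> same_side y x z \<and> \<not> same_side z x y)"
proof -
  have V: "y \<in> V" "z \<in> V" using assms unfolding nonnbrs_def by auto
  then have "B x y z \<or> B y z x \<or> B z x y"
    using assms B_cases[of x y z] E_commute unfolding nonnbrs_def by blast
  then show ?thesis
    using B_same_side[of x y z] B_same_side[of y z x] B_same_side[of z x y]
    same_side_commute V \<open>x \<in> V\<close>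
    by blast
qed

text \<open>The side of \<open>x0\<close> that contains \<open>y0\<close> is declared positive. At a non-neighbour \<open>x\<close> of \<open>x0\<close>
  the label of the side of \<open>x0\<close> is then prescribed: if \<open>x\<close> is on the positive side of \<open>x0\<close>, then
  \<open>x0\<close> must be on the negative side of \<open>x\<close>. A neighbour \<open>x\<close> of \<open>x0\<close> is compared with \<open>x0\<close>
  through a common non-neighbour \<open>p\<close>.\<close>
definition positive_side :: "'a \<Rightarrow> 'a \<Rightarrow> 'a \<Rightarrow> 'a \<Rightarrow> bool" where
  "positive_side x0 y0 x y \<longleftrightarrow>
    (if x = x0 then same_side x0 y0 y
     else if E x0 x then \<exists>p \<in> nonnbrs x0 \<inter> nonnbrs x. same_side x0 y0 p \<longleftrightarrow> \<not> same_side x p y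
     else same_side x0 y0 x \<longleftrightarrow> \<not> same_side x x0 y)"

lemma nonnbrs_commute: "x \<in> V \<Longrightarrow> y \<in> nonnbrs x \<Longrightarrow> x \<in> nonnbrs y"
  using E_commute unfolding nonnbrs_def by auto

text \<open>By \<open>same_side_edge_eq\<close>, the choice of the common non-neighbour does not matter.\<close>
lemma positive_side_reference:
  assumes "x0 \<in> V" "y0 \<in> nonnbrs x0" "x \<in> V" "E x0 x" "p \<in> nonnbrs x0 \<inter> nonnbrs x" "y \<in> nonnbrs x"
  shows "positive_side x0 y0 x y \<longleftrightarrow> (same_side x0 y0 p \<longleftrightarrow> \<not> same_side x p y)"
proof -
  have "x \<noteq> x0" using assms UE1_loopless by auto
  have "(same_side x0 y0 p \<longleftrightarrow> \<not> same_side x p y) \<longleftrightarrow> (same_side x0 y0 q \<longleftrightarrow> \<not> same_side x q y)"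
    if q: "q \<in> nonnbrs x0 \<inter> nonnbrs x" for q
    using same_side_iff[of x0 y0 p q] same_side_iff[of x p q y] same_side_edge_eq[of x0 x p q]
    assms q by auto
  moreover have "positive_side x0 y0 x y \<longleftrightarrow>
      (\<exists>q \<in> nonnbrs x0 \<inter> nonnbrs x. same_side x0 y0 q \<longleftrightarrow> \<not> same_side x q y)"
    using \<open>x \<noteq> x0\<close> \<open>E x0 x\<close> unfolding positive_side_def by simp
  ultimately show ?thesis using assms(5) by blast
qed

lemma positive_side_same_side:
  assumes "x0 \<in> V" "y0 \<in> nonnbrs x0" "x \<in> V" "y \<in> nonnbrs x" "z \<in> nonnbrs x"
    and ref: "E x0 x \<Longrightarrow> nonnbrs x0 \<inter> nonnbrs x \<noteq> {}"
  shows "same_side x y z \<longleftrightarrow> (positive_side x0 y0 x y \<longleftrightarrow> positive_side x0 y0 x z)"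
proof -
  consider "x = x0" | p where "E x0 x" "p \<in> nonnbrs x0 \<inter> nonnbrs x" | "x \<noteq> x0" "\<not> E x0 x" using ref
  by blast
  then show ?thesis
  proof cases
    case 1
    have "same_side x y z \<longleftrightarrow> (same_side x y0 y \<longleftrightarrow> same_side x y0 z)"
      using same_side_iff[of x y y0 z] same_side_commute assms(2-5) 1 by blast
    then show ?thesis using 1 unfolding positive_side_def by simp
  next
    case 2
    have "same_side x y z \<longleftrightarrow> (same_side x p y \<longleftrightarrow> same_side x p z)"
      using same_side_iff[of x y p z] same_side_commute assms(3-5) 2 by blast
    then show ?thesis
      using positive_side_reference[OF assms(1-3) 2 assms(4)]
      positive_side_reference[OF assms(1-3) 2 assms(5)] by blast
  next
    case 3
    then have "x0 \<in> nonnbrs x" using assms(1,3) E_commute unfolding nonnbrs_def by auto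
    then have "same_side x y z \<longleftrightarrow> (same_side x x0 y \<longleftrightarrow> same_side x x0 z)"
      using same_side_iff[of x y x0 z] same_side_commute assms(3-5) by blast
    then show ?thesis using 3 unfolding positive_side_def by auto
  qed
qed

text \<open>The labels are coherent: of two non-adjacent vertices, exactly one is on the positive side
  of the other. The proof distinguishes the positions of both relative to \<open>x0\<close>. The case that is
  not immediate from the definition is that of two neighbours of \<open>x0\<close>.\<close>
lemma positive_side_antisym:
  assumes x0: "x0 \<in> V" and y0: "y0 \<in> nonnbrs x0" and x: "x \<in> V" and xy: "y \<in> nonnbrs x"
    and ref: "\<And>z. z \<in> V \<Longrightarrow> E x0 z \<Longrightarrow> nonnbrs x0 \<inter> nonnbrs z \<noteq> {}"
  shows "positive_side x0 y0 x y \<longleftrightarrow> \<not> positive_side x0 y0 y x"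
proof -
  note pos = positive_side_reference[OF x0 y0]
  have y: "y \<in> V" and "x \<noteq> y" "\<not> E x y" using xy unfolding nonnbrs_def by auto
  have yx: "x \<in> nonnbrs y" using x xy nonnbrs_commute by blast
  have base: "positive_side x0 y0 x0 y \<longleftrightarrow> \<not> positive_side x0 y0 y x0" if "y \<in> nonnbrs x0" for y
    using that unfolding positive_side_def same_side_def nonnbrs_def by auto
  have mixed: "positive_side x0 y0 x y \<longleftrightarrow> \<not> positive_side x0 y0 y x"
    if "x \<in> V" "E x0 x" "y \<in> nonnbrs x" "y \<in> nonnbrs x0" for x y
  proof -
    have "y \<in> V" using that unfolding nonnbrs_def by auto
    have "x \<in> nonnbrs y" "x0 \<in> nonnbrs y" using that x0 nonnbrs_commute by blast+
    then have "\<not> same_side y x0 x" using same_side_edge that \<open>y \<in> V\<close> by blast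
    moreover have "positive_side x0 y0 x y \<longleftrightarrow> \<not> same_side x0 y0 y"
      using pos[of x y y] that unfolding same_side_def by auto
    ultimately show ?thesis using that unfolding positive_side_def nonnbrs_def by auto
  qed
  consider "x = x0" | "y = x0" | "x \<in> nonnbrs x0" "y \<in> nonnbrs x0"
    | "E x0 x" "y \<in> nonnbrs x0" | "E x0 y" "x \<in> nonnbrs x0" | "E x0 x" "E x0 y"
    using x y unfolding nonnbrs_def by blast
  then show ?thesis
  proof cases
    case 1 then show ?thesis using base xy by blast
  next
    case 2 then show ?thesis using base yx by blast
  next
    case 3
    then have "\<not> E x0 x" "\<not> E x0 y" "x \<noteq> x0" "y \<noteq> x0" unfolding nonnbrs_def by auto
    then show ?thesis
      using 3 independent_sides[OF x0 3 xy] same_side_iff[OF x0 3(1) y0 3(2)] same_side_commute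
      unfolding positive_side_def by auto
  next
    case 4 then show ?thesis using mixed x xy by blast
  next
    case 5 then show ?thesis using mixed y yx by blast
  next
    case 6
    \<comment> \<open>A non-neighbour \<open>p\<close> of \<open>x0\<close>, \<open>x\<close> and \<open>y\<close> cannot be between \<open>x\<close> and \<open>y\<close>, since it would
      then be adjacent to their neighbour \<open>x0\<close>. So \<open>x\<close> or \<open>y\<close> is the middle one of the triple,
      and the labels at \<open>x\<close> and \<open>y\<close> taken from \<open>p\<close> disagree as required.\<close>
    have common: "positive_side x0 y0 x y \<longleftrightarrow> \<not> positive_side x0 y0 y x"
      if p: "p \<in> nonnbrs x0" "p \<in> nonnbrs x" "p \<in> nonnbrs y" for p
    proof -
      have px: "x0 \<in> nonnbrs p" "x \<in> nonnbrs p" "y \<in> nonnbrs p"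
        using p x x0 y nonnbrs_commute by blast+
      have pV: "p \<in> V" "\<not> E p x0" using p px(1) unfolding nonnbrs_def by auto
      have "\<not> B x p y" using UM4[of x p y x0] pV x y x0 6 E_commute by auto
      then have "same_side p x y" using not_same_side[OF pV(1) px(2,3)] \<open>\<not> E x y\<close> by blast
      then have "same_side x p y \<longleftrightarrow> \<not> same_side y p x"
        using independent_sides[OF pV(1) px(2,3) xy] by blast
      then show ?thesis using pos[OF x 6(1) _ xy, of p] pos[OF y 6(2) _ yx, of p] p by auto
    qed
    obtain p q where p: "p \<in> nonnbrs x0" "p \<in> nonnbrs x" and q: "q \<in> nonnbrs x0" "q \<in> nonnbrs y"
      using ref 6 x y by blast
    show ?thesis
    proof (cases "p \<in> nonnbrs y \<or> q \<in> nonnbrs x")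
      case True then show ?thesis using common p q by blast
    next
      case False
      have pqV: "p \<in> V" "q \<in> V" using p q unfolding nonnbrs_def by auto
      have E: "E p y" "E q x"
        using False p q pqV E_commute[of p y] E_commute[of q x] E_commute[of x0 x] x y 6
        unfolding nonnbrs_def by auto
      \<comment> \<open>Without such a vertex, the references \<open>p\<close> for \<open>x\<close> and \<open>q\<close> for \<open>y\<close> form a path \<open>p, y,
        x0, x, q\<close>, and they must be on different sides of \<open>x0\<close>.\<close>
      have "\<not> same_side x0 p q"
      proof -
        have nE: "\<not> E p x" "\<not> E q y" "p \<noteq> q"
          using p q False E_commute[of p x] E_commute[of q y] x y pqV unfolding nonnbrs_def by auto
        have "\<not> B x0 p q" using UM4[of x0 p q x] E nE pqV x x0 6 by auto
        moreover have "\<not> B x0 q p" using UM4[of x0 q p y] E nE pqV y x0 6 by auto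
        ultimately show ?thesis using nE unfolding same_side_def by blast
      qed
      then have "same_side x0 y0 p \<longleftrightarrow> \<not> same_side x0 y0 q" using same_side_iff[OF x0 y0 p(1) q(1)]
        by blast
      moreover have "\<not> same_side x p y" "\<not> same_side y q x" using same_side_edge x y p q xy yx E
        by blast+
      ultimately show ?thesis using pos[OF x 6(1) _ xy, of p] pos[OF y 6(2) _ yx, of q] p q by auto
    qed
  qed
qed

end

section \<open>Orienting a model\<close>

locale circle_model = universal_axioms + extension_axioms
begin

lemma common_nonnbr:
  assumes "x \<in> V" "y \<in> V" "E x y"
  shows "nonnbrs x \<inter> nonnbrs y \<noteq> {}"
proof -
  obtain v where v: "v \<in> V" "\<not> E v x" "\<not> E v y" using EX2a[of x y] assms by auto
  moreover have "v \<noteq> x" "v \<noteq> y" using v assms E_commute by blast+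
  ultimately show ?thesis using assms E_commute unfolding nonnbrs_def by blast
qed

lemma nbr_exists: "x \<in> V \<Longrightarrow> \<exists>v\<in>V. E v x"
  using EX1a[of x x] UE1_loopless by blast

lemma nonnbr_exists:
  assumes "x \<in> V"
  shows "nonnbrs x \<noteq> {}"
  using nbr_exists[OF assms] common_nonnbr assms by blast

lemma orientation_exists:
  "\<exists>out. (\<forall>x\<in>V. \<forall>y. out x y \<longrightarrow> y \<in> nonnbrs x) \<and>
    (\<forall>x\<in>V. \<forall>y\<in>nonnbrs x. out x y \<longleftrightarrow> \<not> out y x) \<and>
    (\<forall>x\<in>V. \<forall>y\<in>nonnbrs x. \<forall>z\<in>nonnbrs x. same_side x y z \<longleftrightarrow> (out x y \<longleftrightarrow> out x z))"
proof -
  obtain x0 where x0: "x0 \<in> V" using EX by blast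
  obtain y0 where y0: "y0 \<in> nonnbrs x0" using nonnbr_exists[OF x0] by blast
  define out where "out x y \<longleftrightarrow> y \<in> nonnbrs x \<and> positive_side x0 y0 x y" for x y
  have "out x y \<longleftrightarrow> \<not> out y x" if "x \<in> V" "y \<in> nonnbrs x" for x y
    using positive_side_antisym[OF x0 y0 that] common_nonnbr[OF x0] nonnbrs_commute[OF that] that
    unfolding out_def by blast
  moreover have "same_side x y z \<longleftrightarrow> (out x y \<longleftrightarrow> out x z)"
    if "x \<in> V" "y \<in> nonnbrs x" "z \<in> nonnbrs x" for x y z
    using positive_side_same_side[OF x0 y0 that] common_nonnbr[OF x0 \<open>x \<in> V\<close>] that unfolding out_def
    by blast
  ultimately show ?thesis by (intro exI[of _ out]) (auto simp: out_def)
qed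

text \<open>Two further vertices are inserted between \<open>p\<close> and \<open>q\<close>, so that \<open>EX1c\<close> provides a neighbour
  of \<open>p\<close> beyond \<open>q\<close>.\<close>
lemma nbr_of_one:
  assumes p: "p \<in> V" and q: "q \<in> nonnbrs p"
  shows "\<exists>v\<in>nonnbrs q. E v p"
proof -
  have qV: "q \<in> V" and "\<not> E p q" "p \<noteq> q" using q unfolding nonnbrs_def by auto
  obtain y where y: "y \<in> V" "B p y q" using EX1b[of p q] p qV \<open>\<not> E p q\<close> \<open>p \<noteq> q\<close> by auto
  obtain x where x: "x \<in> V" "B p x y" using EX1b[of p y] p B_imp[OF p y(1) qV y(2)] y(1) by auto
  have "B q y p" "B y x p" using B_commute p qV x y by blast+
  then have "B q x p" "B q y x" using UB3[of q y p x] p qV x y by auto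
  then have "B p x q" "B x y q" using B_commute p qV x y by blast+
  then obtain v where v: "v \<in> V" "E v p" "B y q v" using EX1c[of p x y q] p qV x y by auto
  then show ?thesis using B_imp[OF y(1) qV v(1,3)] unfolding nonnbrs_def by blast
qed

end

text \<open>\<open>out x y\<close> says that \<open>y\<close> is on the positive side of \<open>x\<close>.\<close>
locale oriented_model = circle_model +
  fixes out :: "'a \<Rightarrow> 'a \<Rightarrow> bool"
  assumes out_nonnbr: "x \<in> V \<Longrightarrow> out x y \<Longrightarrow> y \<in> nonnbrs x"
    and out_antisym: "x \<in> V \<Longrightarrow> y \<in> nonnbrs x \<Longrightarrow> out x y \<longleftrightarrow> \<not> out y x"
    and out_same_side: "x \<in> V \<Longrightarrow> y \<in> nonnbrs x \<Longrightarrow> z \<in> nonnbrs x \<Longrightarrow>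
      same_side x y z \<longleftrightarrow> (out x y \<longleftrightarrow> out x z)"
begin

definition turn :: "'a \<Rightarrow> 'a \<Rightarrow> int" where
  "turn x y = (if out x y then 1 else if out y x then -1 else 0)"

lemma out_asym: "x \<in> V \<Longrightarrow> out x y \<Longrightarrow> \<not> out y x"
  using out_nonnbr out_antisym by blast

lemma nonnbrs_V: "y \<in> nonnbrs x \<Longrightarrow> y \<in> V"
  unfolding nonnbrs_def by blast

lemma nonnbrs_iff:
  assumes "x \<in> V" "y \<in> V"
  shows "y \<in> nonnbrs x \<longleftrightarrow> out x y \<or> out y x"
  using out_nonnbr[of x y] out_nonnbr[of y x] out_antisym[of x y] nonnbrs_commute[of y x] assms
  by blast

lemma turn_eq:
  assumes "x \<in> V" "y \<in> V"
  shows "turn x y = 1 \<longleftrightarrow> out x y" "turn x y = -1 \<longleftrightarrow> out y x" "turn x y = 0 \<longleftrightarrow> x = y \<or> E x y"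
proof -
  show "turn x y = 1 \<longleftrightarrow> out x y" "turn x y = -1 \<longleftrightarrow> out y x"
    using out_asym assms unfolding turn_def by auto
  have "turn x y = 0 \<longleftrightarrow> y \<notin> nonnbrs x" using nonnbrs_iff[OF assms] unfolding turn_def by auto
  then show "turn x y = 0 \<longleftrightarrow> x = y \<or> E x y" using assms unfolding nonnbrs_def by auto
qed

text \<open>Adjacent non-neighbours of \<open>z\<close> are on different sides of \<open>z\<close>. Together with
  \<open>out_transitive\<close> and the absence of triangles in \<open>E\<close> these are all the patterns forbidden by
  the condition on triangles in \<open>turn_structure\<close>.\<close>
lemma out_no_edge:
  assumes "x \<in> V" "y \<in> V" "z \<in> V" "E x y"
  shows "\<not> (out z x \<and> out z y)" "\<not> (out x z \<and> out y z)"
proof -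
  have "\<not> (out z x \<longleftrightarrow> out z y)" if "x \<in> nonnbrs z" "y \<in> nonnbrs z"
    using same_side_edge[of z x y] out_same_side[of z x y] that assms by blast
  moreover have "\<not> out z u \<and> u \<in> nonnbrs z" if "u \<in> V" "out u z" for u
    using that out_nonnbr nonnbrs_commute out_asym by blast
  ultimately show "\<not> (out z x \<and> out z y)" "\<not> (out x z \<and> out y z)"
    using out_nonnbr[of z] assms by blast+
qed

text \<open>In a cyclically oriented independent triple, each vertex would have the other two on
  different sides, against \<open>independent_sides\<close>.\<close>
lemma out_transitive:
  assumes "x \<in> V" "out x y" "out y z"
  shows "\<not> out z x"
proof
  assume "out z x"
  have y: "y \<in> nonnbrs x" "y \<in> V" using assms out_nonnbr nonnbrs_V by blast+
  have z: "z \<in> nonnbrs y" "z \<in> V" using assms out_nonnbr nonnbrs_V y by blast+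
  have zx: "z \<in> nonnbrs x" using \<open>out z x\<close> out_nonnbr nonnbrs_commute z by blast
  have "\<not> same_side x y z" "\<not> same_side y x z"
    using out_same_side[of x y z] out_same_side[of y x z] out_asym[of x y] out_asym[of y z]
    out_asym[of z x]
      nonnbrs_commute[of x y] y z zx assms \<open>out z x\<close> by blast+
  then show False using independent_sides[OF \<open>x \<in> V\<close> y(1) zx z(1)] by blast
qed

lemma B_iff_out:
  assumes V: "x \<in> V" "y \<in> V" "z \<in> V"
  shows "B x y z \<longleftrightarrow> (out x y \<and> out y z \<and> out x z) \<or> (out z y \<and> out y x \<and> out z x)"
proof
  assume B: "B x y z"
  have n: "x \<in> nonnbrs y" "z \<in> nonnbrs y" "y \<in> nonnbrs x" "z \<in> nonnbrs x" "x \<in> nonnbrs z"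
    "y \<in> nonnbrs z"
    using B_imp[OF V B] V E_commute unfolding nonnbrs_def by blast+
  have "\<not> same_side y x z" "same_side x y z" "same_side z x y" using B_same_side[OF V B] by blast+
  then show "(out x y \<and> out y z \<and> out x z) \<or> (out z y \<and> out y x \<and> out z x)"
    using out_same_side n out_antisym V by meson
next
  have *: "B x y z" if V: "x \<in> V" "y \<in> V" "z \<in> V" and o: "out x y" "out y z" "out x z" for x y z
  proof -
    have n: "x \<in> nonnbrs y" "z \<in> nonnbrs y" using o out_nonnbr V nonnbrs_commute by blast+
    then have "\<not> same_side y x z" using out_same_side o out_asym V by blast
    moreover have "\<not> E x z" using out_nonnbr o V unfolding nonnbrs_def by blast
    ultimately show ?thesis using not_same_side n V by blast
  qed
  assume "(out x y \<and> out y z \<and> out x z) \<or> (out z y \<and> out y x \<and> out z x)"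
  then show "B x y z" using * V B_commute by blast
qed

lemma B_out:
  assumes "x \<in> V" "y \<in> V" "z \<in> V" "B x y z"
  shows "out x y \<Longrightarrow> out y z \<and> out x z" "out y x \<Longrightarrow> out z y \<and> out z x"
    "out y z \<Longrightarrow> out x y \<and> out x z" "out z y \<Longrightarrow> out y x \<and> out z x"
  using B_iff_out[OF assms(1-3)] assms out_asym by blast+

lemma out_exists:
  assumes "p \<in> V"
  shows "\<exists>r\<in>V. out p r" "\<exists>r\<in>V. out r p"
proof -
  obtain q where q: "q \<in> V" "\<not> E p q" "p \<noteq> q" using nonnbr_exists[OF assms] unfolding nonnbrs_def
    by auto
  then obtain r where "r \<in> V" "B r p q" using EX1b[of p q] assms by auto
  then show "\<exists>r\<in>V. out p r" "\<exists>r\<in>V. out r p" using B_iff_out[of r p q] assms q by blast+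
qed

text \<open>Up to exchanging \<open>p\<close> and \<open>q\<close>, these are the types over an edge that the forbidden patterns
  permit. Each is obtained by applying an extension axiom to \<open>p\<close> and a pair consisting of \<open>q\<close>
  and an in- or out-neighbour of \<open>q\<close>, which fixes the side on which the new vertex lies.\<close>
lemma realize_over_edge:
  assumes V: "p \<in> V" "q \<in> V" and pq: "E p q"
  shows "\<exists>r\<in>V. out p r \<and> out r q" "\<exists>r\<in>V. E r p \<and> out q r" "\<exists>r\<in>V. E r p \<and> out r q"
proof -
  obtain s where s: "s \<in> V" "out s q" using out_exists V by blast
  have sn: "\<not> E s q" "s \<noteq> q" using out_nonnbr[OF s] unfolding nonnbrs_def by auto
  obtain v where v: "v \<in> V" "\<not> E v p" "\<not> E v q" "B v s q" using EX2b[of p s q] V s sn pq by auto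
  have vq: "out v q" using B_out(3)[of v s q] v s V by blast
  have "p \<in> nonnbrs v" using v pq V E_commute unfolding nonnbrs_def by blast
  then have "out p v" using nonnbrs_iff[of v p] out_no_edge(1)[of p q v] v V pq vq by blast
  then show "\<exists>r\<in>V. out p r \<and> out r q" using v vq by blast
  obtain w where w: "w \<in> V" "E w p" "B s q w" using EX3c[of p s q] V s sn pq by auto
  then show "\<exists>r\<in>V. E r p \<and> out q r" using B_out(1)[of s q w] s V by blast
  obtain t where t: "t \<in> V" "out q t" using out_exists V by blast
  have tn: "\<not> E t q" "t \<noteq> q" using out_nonnbr[OF V(2) t(2)] E_commute V t unfolding nonnbrs_def
    by auto
  obtain u where u: "u \<in> V" "E u p" "B t q u" using EX3c[of p t q] V t tn pq by auto
  then show "\<exists>r\<in>V. E r p \<and> out r q" using B_out(2)[of t q u] t V by blast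
qed

text \<open>Of the nine types over an oriented non-edge, the forbidden patterns exclude the other
  three.\<close>
lemma realize_over_out:
  assumes V: "p \<in> V" "q \<in> V" and pq: "out p q"
  shows "\<exists>r\<in>V. E r p \<and> E r q" "\<exists>r\<in>V. out p r \<and> out r q" "\<exists>r\<in>V. out p r \<and> out q r" "\<exists>r\<in>V. out r p \<and>
      out r q"
    "\<exists>r\<in>V. E r p \<and> out q r" "\<exists>r\<in>V. out r p \<and> E r q"
proof -
  have q: "q \<in> nonnbrs p" and p: "p \<in> nonnbrs q" using out_nonnbr[OF V(1) pq] nonnbrs_commute V
    by blast+
  have n: "\<not> E p q" "p \<noteq> q" using q unfolding nonnbrs_def by auto
  show "\<exists>r\<in>V. E r p \<and> E r q" using EX1a[of p q] V n by auto
  obtain v1 v2 v3 where v: "v1 \<in> V" "v2 \<in> V" "v3 \<in> V" "B v1 p q" "B p v2 q" "B p q v3"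
    using EX1b[of p q] V n by auto
  show "\<exists>r\<in>V. out p r \<and> out r q" using v V pq B_iff_out[of p v2 q] out_asym by blast
  show "\<exists>r\<in>V. out p r \<and> out q r" using v V pq B_out(1)[of p q v3] by blast
  show "\<exists>r\<in>V. out r p \<and> out r q" using v V pq B_out(3)[of v1 p q] by blast
  obtain v where v: "v \<in> nonnbrs q" "E v p" using nbr_of_one[OF V(1) q] by blast
  then show "\<exists>r\<in>V. E r p \<and> out q r"
    using nonnbrs_iff[of q v] nonnbrs_V V out_no_edge(2)[of v p q] pq by blast
  obtain w where w: "w \<in> nonnbrs p" "E w q" using nbr_of_one[OF V(2) p] by blast
  then show "\<exists>r\<in>V. out r p \<and> E r q"
    using nonnbrs_iff[of p w] nonnbrs_V V out_no_edge(1)[of w q p] pq by blast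
qed

lemma turn_structure_turn: "turn_structure V turn"
proof
  show "V \<noteq> {}" using EX by blast
  fix p q c c'
  assume p: "p \<in> V"
  assume c: "c \<in> {-1, 0, 1 :: int}"
  show "\<exists>r\<in>V. r \<noteq> p \<and> turn r p = c"
  proof -
    obtain r1 where "r1 \<in> V" "E r1 p" using nbr_exists p by blast
    moreover obtain r2 r3 where "r2 \<in> V" "out p r2" "r3 \<in> V" "out r3 p" using out_exists p by blast
    moreover have "\<not> out p p" using out_asym p by blast
    ultimately show ?thesis using c turn_eq[of _ p] p UE1_loopless[OF p]
      by (metis insertE singletonD)
  qed
  assume q: "q \<in> V" and pq: "p \<noteq> q" and c': "c' \<in> {-1, 0, 1 :: int}"
    and ok: "\<not> 3 dvd c + turn p q - c'"
  have loop: "\<not> out p p" "\<not> out q q" "\<not> E p p" "\<not> E q q" using out_asym UE1_loopless p q by blast+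
  have *: "\<exists>r\<in>V. r \<noteq> p \<and> r \<noteq> q \<and> turn r p = c \<and> turn r q = c'"
    if "\<exists>r\<in>V. (c = 1 \<and> out r p \<or> c = -1 \<and> out p r \<or> c = 0 \<and> E r p) \<and>
      (c' = 1 \<and> out r q \<or> c' = -1 \<and> out q r \<or> c' = 0 \<and> E r q)"
    using that turn_eq p q loop by (metis (no_types, lifting))
  consider "E p q" | "out p q" | "out q p" using nonnbrs_iff[OF p q] pq q unfolding nonnbrs_def
  by auto
  then show "\<exists>r\<in>V. r \<noteq> p \<and> r \<noteq> q \<and> turn r p = c \<and> turn r q = c'"
  proof cases
    case 1
    then have "turn p q = 0" "E q p" using turn_eq p q E_commute by blast+
    then have "(c, c') \<in> {(-1,0), (-1,1), (0,-1), (0,1), (1,-1), (1,0)}" using ok c c' by auto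
    then show ?thesis
      using realize_over_edge[OF p q 1] realize_over_edge[OF q p \<open>E q p\<close>] by (intro *) auto
  next
    case 2
    then have "turn p q = 1" using turn_eq p q by blast
    then have "(c, c') \<in> {(-1,-1), (-1,1), (0,0), (0,-1), (1,0), (1,1)}" using ok c c' by auto
    then show ?thesis
      using realize_over_out[OF p q 2] by (intro *) auto
  next
    case 3
    then have "turn p q = -1" using turn_eq p q by blast
    then have "(c, c') \<in> {(-1,-1), (1,-1), (0,0), (-1,0), (0,1), (1,1)}" using ok c c' by auto
    then show ?thesis
      using realize_over_out[OF q p 3] by (intro *) auto
  qed
next
  fix x y assume xy: "x \<in> V" "y \<in> V"
  show "turn x y \<in> {-1, 0, 1}" unfolding turn_def by auto
  show "turn y x = - turn x y" using out_asym xy unfolding turn_def by auto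
next
  fix x y z assume V: "x \<in> V" "y \<in> V" "z \<in> V" and dist: "distinct [x, y, z]"
  note eq = turn_eq[OF V(1,2)] turn_eq[OF V(2,3)] turn_eq[OF V(3,1)]
  have "\<not> (E x y \<and> E y z \<and> E z x)" using UE2[of x y z] E_commute[of x z] V by auto
  moreover have "\<not> (out x y \<and> out y z \<and> out z x)" "\<not> (out y x \<and> out z y \<and> out x z)"
    using out_transitive V by blast+
  ultimately have "(turn x y, turn y z, turn z x) \<notin> {(0, 0, 0), (1, 1, 1), (-1, -1, -1),
      (0, 1, -1), (0, -1, 1), (1, 0, -1), (-1, 0, 1), (1, -1, 0), (-1, 1, 0)}"
    using out_no_edge[of x y z] out_no_edge[of y z x] out_no_edge[of z x y] V dist eq by simp blast
  moreover have "turn a b \<in> {-1, 0, 1}" for a b unfolding turn_def by auto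
  then have "turn x y \<in> {-1, 0, 1}" "turn y z \<in> {-1, 0, 1}" "turn z x \<in> {-1, 0, 1}" by blast+
  ultimately show "\<not> 3 dvd turn x y + turn y z + turn z x" by (elim insertE emptyE) simp_all
qed

end

section \<open>Separation in terms of edges and betweenness\<close>

definition ind3 :: "('a \<Rightarrow> 'a \<Rightarrow> bool) \<Rightarrow> 'a \<Rightarrow> 'a \<Rightarrow> 'a \<Rightarrow> bool" where
  "ind3 E x y z \<longleftrightarrow> \<not> E x y \<and> \<not> E y z \<and> \<not> E x z"

text \<open>If some three of the four vertices are independent, separation is read off from
  betweenness. Otherwise the four vertices induce \<open>C\<^sub>4\<close>, \<open>P\<^sub>4\<close> or \<open>2K\<^sub>2\<close>, and two pairs that
  separate each other are edges. For \<open>P\<^sub>4\<close> and \<open>2K\<^sub>2\<close> this is enough. In \<open>C\<^sub>4\<close> two pairings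
  qualify: the non-adjacent pairs are two short arcs, and the question is whether these arcs are
  traversed in the same direction. This is the case if and only if a vertex beyond the first
  pair precedes the second.\<close>
definition separation_of ::
  "'a set \<Rightarrow> ('a \<Rightarrow> 'a \<Rightarrow> bool) \<Rightarrow> ('a \<Rightarrow> 'a \<Rightarrow> 'a \<Rightarrow> bool) \<Rightarrow> 'a \<Rightarrow> 'a \<Rightarrow> 'a \<Rightarrow> 'a \<Rightarrow> bool" where
  "separation_of V E B x1 x2 x3 x4 \<longleftrightarrow> distinct [x1, x2, x3, x4] \<and>
    (if ind3 E x1 x2 x3 then B x1 x2 x3 \<noteq> B x1 x4 x3
     else if ind3 E x2 x3 x4 then B x2 x3 x4 \<noteq> B x2 x1 x4
     else if ind3 E x3 x4 x1 then B x3 x4 x1 \<noteq> B x3 x2 x1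
     else if ind3 E x4 x1 x2 then B x4 x1 x2 \<noteq> B x4 x3 x2
     else E x1 x3 \<and> E x2 x4 \<and>
       (E x1 x4 \<and> E x2 x3 \<longrightarrow> (\<exists>v\<in>V. B x1 x2 v \<and> B v x3 x4)) \<and>
       (E x1 x2 \<and> E x3 x4 \<longrightarrow> (\<exists>v\<in>V. B x2 x3 v \<and> B v x4 x1)))"

context universal_axioms begin

lemma S_rotate: "x1 \<in> V \<Longrightarrow> x2 \<in> V \<Longrightarrow> x3 \<in> V \<Longrightarrow> x4 \<in> V \<Longrightarrow> S x1 x2 x3 x4 \<longleftrightarrow> S x2 x3 x4 x1"
  using US2[of x1 x2 x3 x4] by auto

lemma S_if_ind3:
  assumes V: "x1 \<in> V" "x2 \<in> V" "x3 \<in> V" "x4 \<in> V" and d: "distinct [x1, x2, x3, x4]"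
    and i: "ind3 E x1 x2 x3"
  shows "S x1 x2 x3 x4 \<longleftrightarrow> B x1 x2 x3 \<noteq> B x1 x4 x3"
proof -
  have "independent_set E {x1, x2, x3}"
    using i UE1_loopless[of x1] UE1_loopless[of x2] UE1_loopless[of x3] E_commute[of x2 x1]
    E_commute[of x3 x2] E_commute[of x3 x1] V
    unfolding independent_set_def ind3_def by auto
  then show ?thesis using UM8[of x1 x2 x3 x4] V d by auto
qed

text \<open>The two remaining pairs \<open>b, c\<close> and \<open>a, d\<close> may or may not be edges; the four possibilities
  give \<open>C\<^sub>4\<close>, \<open>P\<^sub>4\<close> (twice) and \<open>2K\<^sub>2\<close>.\<close>
lemma induces_if_matching:
  assumes V: "a \<in> V" "b \<in> V" "c \<in> V" "d \<in> V" "distinct [a, b, c, d]"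
    and E: "E a b" "E c d" and nE: "\<not> E a c" "\<not> E b d"
  shows "induces_C4 E {a, b, c, d} \<or> induces_P4 E {a, b, c, d} \<or> induces_2K2 E {a, b, c, d}"
proof -
  have sym: "E b a" "E d c" "\<not> E c a" "\<not> E d b" "E c b \<longleftrightarrow> E b c" "E d a \<longleftrightarrow> E a d"
    using E nE E_commute V(1-4) by blast+
  consider "E b c" "E d a" | "E b c" "\<not> E d a" | "\<not> E b c" "E d a" | "\<not> E b c" "\<not> E d a" by blast
  then show ?thesis
  proof cases
    case 1
    then have "induces_C4 E {a, b, c, d}" unfolding induces_C4_def using E nE V by blast
    then show ?thesis by blast
  next
    case 2
    then have "induces_P4 E {a, b, c, d}" unfolding induces_P4_def using E nE V sym by blast
    then show ?thesis by blast
  next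
    case 3
    have "{a, b, c, d} = {b, a, d, c}" "distinct [b, a, d, c]" using V by auto
    then have "induces_P4 E {a, b, c, d}" unfolding induces_P4_def using 3 E nE V sym by blast
    then show ?thesis by blast
  next
    case 4
    then have "induces_2K2 E {a, b, c, d}" unfolding induces_2K2_def using E nE V sym by blast
    then show ?thesis by blast
  qed
qed

text \<open>Neither \<open>E\<close> nor its complement has a triangle on the four vertices. Both therefore contain
  a perfect matching, and \<open>induces_if_matching\<close> applies to one of the six choices of the two.\<close>
lemma S_diagonals:
  assumes V: "x1 \<in> V" "x2 \<in> V" "x3 \<in> V" "x4 \<in> V" and S: "S x1 x2 x3 x4"
    and n: "\<not> ind3 E x1 x2 x3" "\<not> ind3 E x2 x3 x4" "\<not> ind3 E x3 x4 x1" "\<not> ind3 E x4 x1 x2"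
  shows "E x1 x3 \<and> E x2 x4"
proof -
  have d: "distinct [x1, x2, x3, x4]" using S_distinct S V by blast
  let ?ind = "\<lambda>X. induces_C4 E X \<or> induces_P4 E X \<or> induces_2K2 E X"
  have perm: "{x1, x2, x4, x3} = {x1, x2, x3, x4}" "{x1, x3, x2, x4} = {x1, x2, x3, x4}"
    "{x1, x3, x4, x2} = {x1, x2, x3, x4}" "{x1, x4, x2, x3} = {x1, x2, x3, x4}"
    "{x1, x4, x3, x2} = {x1, x2, x3, x4}"
    by auto
  have sym: "E x2 x1 \<longleftrightarrow> E x1 x2" "E x3 x1 \<longleftrightarrow> E x1 x3" "E x4 x1 \<longleftrightarrow> E x1 x4" "E x3 x2 \<longleftrightarrow>
    E x2 x3" "E x4 x2 \<longleftrightarrow> E x2 x4" "E x4 x3 \<longleftrightarrow> E x3 x4"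
    using E_commute V by blast+
  have m: "?ind {x1, x2, x3, x4}" if "E x1 x2" "E x3 x4" "\<not> E x1 x3" "\<not> E x2 x4"
    using induces_if_matching[of x1 x2 x3 x4] that V d by blast
  have m2: "?ind {x1, x2, x4, x3}" if "E x1 x2" "E x3 x4" "\<not> E x1 x4" "\<not> E x2 x3"
    by (rule induces_if_matching) (use that V d sym in auto)
  have m3: "?ind {x1, x3, x2, x4}" if "E x1 x3" "E x2 x4" "\<not> E x1 x2" "\<not> E x3 x4"
    by (rule induces_if_matching) (use that V d sym in auto)
  have m4: "?ind {x1, x3, x4, x2}" if "E x1 x3" "E x2 x4" "\<not> E x1 x4" "\<not> E x2 x3"
    by (rule induces_if_matching) (use that V d sym in auto)
  have m5: "?ind {x1, x4, x2, x3}" if "E x1 x4" "E x2 x3" "\<not> E x1 x2" "\<not> E x3 x4"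
    by (rule induces_if_matching) (use that V d sym in auto)
  have m6: "?ind {x1, x4, x3, x2}" if "E x1 x4" "E x2 x3" "\<not> E x1 x3" "\<not> E x2 x4"
    by (rule induces_if_matching) (use that V d sym in auto)
  have "?ind {x1, x2, x3, x4}"
    using m m2[unfolded perm] m3[unfolded perm] m4[unfolded perm] m5[unfolded perm]
    m6[unfolded perm] n
      UE2[of x1 x2 x3] UE2[of x2 x3 x4] UE2[of x1 x3 x4] UE2[of x1 x2 x4] V
    unfolding ind3_def sym by (simp only: insert_subset empty_subsetI simp_thms) argo
  then show ?thesis using UM7[of x1 x2 x3 x4] S V by auto
qed

end

context circle_model begin

lemma oriented_model_exists: "\<exists>out. oriented_model V E B S out"
proof -
  obtain out where "\<forall>x\<in>V. \<forall>y. out x y \<longrightarrow> y \<in> nonnbrs x"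
    "\<forall>x\<in>V. \<forall>y\<in>nonnbrs x. out x y \<longleftrightarrow> \<not> out y x"
    "\<forall>x\<in>V. \<forall>y\<in>nonnbrs x. \<forall>z\<in>nonnbrs x. same_side x y z \<longleftrightarrow> (out x y \<longleftrightarrow> out x z)"
    using orientation_exists by (elim exE conjE)
  then have "oriented_model V E B S out" by unfold_locales blast+
  then show ?thesis by blast
qed

text \<open>The vertex between the two pairs in the case of \<open>C\<^sub>4\<close> exists by \<open>EX2c\<close>, and it enforces
  separation by \<open>UM6\<close>. The converse excludes the other two pairings of \<open>US1\<close>.\<close>
lemma S_iff_separation_of:
  assumes V: "x1 \<in> V" "x2 \<in> V" "x3 \<in> V" "x4 \<in> V"
  shows "S x1 x2 x3 x4 \<longleftrightarrow> separation_of V E B x1 x2 x3 x4"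
proof (cases "distinct [x1, x2, x3, x4]")
  case False
  then have "\<not> S x1 x2 x3 x4" using S_distinct[of x1 x2 x3 x4] V by blast
  then show ?thesis unfolding separation_of_def by (simp only: False simp_thms)
next
  case d: True
  have d': "distinct [x2, x3, x4, x1]" "distinct [x3, x4, x1, x2]" "distinct [x4, x1, x2, x3]"
    using d by auto
  have rot: "S x1 x2 x3 x4 \<longleftrightarrow> S x2 x3 x4 x1" "S x1 x2 x3 x4 \<longleftrightarrow> S x3 x4 x1 x2" "S x1 x2 x3 x4 \<longleftrightarrow>
    S x4 x1 x2 x3"
    using S_rotate V by blast+
  have sym: "E x2 x1 \<longleftrightarrow> E x1 x2" "E x3 x1 \<longleftrightarrow> E x1 x3" "E x4 x1 \<longleftrightarrow> E x1 x4" "E x3 x2 \<longleftrightarrow>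
    E x2 x3" "E x4 x2 \<longleftrightarrow> E x2 x4" "E x4 x3 \<longleftrightarrow> E x3 x4"
    using E_commute V by blast+
  show ?thesis
  proof (cases "ind3 E x1 x2 x3 \<or> ind3 E x2 x3 x4 \<or> ind3 E x3 x4 x1 \<or> ind3 E x4 x1 x2")
    case True
    moreover have "S x1 x2 x3 x4 \<longleftrightarrow> B x1 x2 x3 \<noteq> B x1 x4 x3" if "ind3 E x1 x2 x3"
      using S_if_ind3[OF V d that] .
    moreover have "S x1 x2 x3 x4 \<longleftrightarrow> B x2 x3 x4 \<noteq> B x2 x1 x4" if "ind3 E x2 x3 x4"
      using S_if_ind3[OF V(2-4,1) d'(1) that] rot(1) by simp
    moreover have "S x1 x2 x3 x4 \<longleftrightarrow> B x3 x4 x1 \<noteq> B x3 x2 x1" if "ind3 E x3 x4 x1"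
      using S_if_ind3[OF V(3,4,1,2) d'(2) that] rot(2) by simp
    moreover have "S x1 x2 x3 x4 \<longleftrightarrow> B x4 x1 x2 \<noteq> B x4 x3 x2" if "ind3 E x4 x1 x2"
      using S_if_ind3[OF V(4,1-3) d'(3) that] rot(3) by simp
    ultimately show ?thesis using d unfolding separation_of_def
      by (simp split del: if_split) presburger
  next
    case False
    then have n: "\<not> ind3 E x1 x2 x3" "\<not> ind3 E x2 x3 x4" "\<not> ind3 E x3 x4 x1" "\<not> ind3 E x4 x1 x2"
      by blast+
    have c4: "S x1 x2 x3 x4 \<longleftrightarrow> (\<exists>v\<in>V. B x1 x2 v \<and> B v x3 x4)"
      if V: "x1 \<in> V" "x2 \<in> V" "x3 \<in> V" "x4 \<in> V" and E: "E x1 x3" "E x2 x4" "E x1 x4" for x1 x2 x3 x4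
    proof
      assume "S x1 x2 x3 x4"
      moreover have "\<not> E x1 x2" "\<not> E x3 x4" using UE2[of x1 x2 x4] UE2[of x1 x3 x4] E V by auto
      ultimately show "\<exists>v\<in>V. B x1 x2 v \<and> B v x3 x4" using EX2c[of x1 x2 x3 x4] E V by auto
    next
      assume "\<exists>v\<in>V. B x1 x2 v \<and> B v x3 x4"
      then show "S x1 x2 x3 x4" using UM6 E V by auto
    qed
    have "S x1 x2 x3 x4 \<longleftrightarrow> E x1 x3 \<and> E x2 x4 \<and>
       (E x1 x4 \<and> E x2 x3 \<longrightarrow> (\<exists>v\<in>V. B x1 x2 v \<and> B v x3 x4)) \<and>
       (E x1 x2 \<and> E x3 x4 \<longrightarrow> (\<exists>v\<in>V. B x2 x3 v \<and> B v x4 x1))" (is "_ \<longleftrightarrow> ?R")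
    proof
      assume S: "S x1 x2 x3 x4"
      then have "E x1 x3" "E x2 x4" using S_diagonals[OF V S n] by auto
      then show ?R using S rot(1) c4[OF V] c4[OF V(2-4,1)] sym by blast
    next
      assume R: ?R
      have "S x1 x2 x3 x4 \<or> S x1 x2 x4 x3 \<or> S x1 x3 x2 x4" using US1[of x1 x2 x3 x4] V d by auto
      moreover have "E x1 x4 \<and> E x2 x3" if "S x1 x2 x4 x3"
        using S_diagonals[OF V(1,2,4,3) that] n sym unfolding ind3_def by blast
      moreover have "E x1 x2 \<and> E x3 x4" if "S x1 x3 x2 x4"
        using S_diagonals[OF V(1,3,2,4) that] n sym unfolding ind3_def by blast
      ultimately show "S x1 x2 x3 x4" using R rot(1) c4[OF V] c4[OF V(2-4,1)] sym by blast
    qed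
    then show ?thesis using n d unfolding separation_of_def by simp
  qed
qed

end

lemma separation_of_bij:
  assumes f: "bij_betw f V W"
    and E: "\<And>x y. x \<in> V \<Longrightarrow> y \<in> V \<Longrightarrow> E x y \<longleftrightarrow> E' (f x) (f y)"
    and B: "\<And>x y z. x \<in> V \<Longrightarrow> y \<in> V \<Longrightarrow> z \<in> V \<Longrightarrow> B x y z \<longleftrightarrow> B' (f x) (f y) (f z)"
    and V: "x1 \<in> V" "x2 \<in> V" "x3 \<in> V" "x4 \<in> V"
  shows "separation_of V E B x1 x2 x3 x4 \<longleftrightarrow> separation_of W E' B' (f x1) (f x2) (f x3) (f x4)"
proof -
  have "f x = f y \<longleftrightarrow> x = y" if "x \<in> V" "y \<in> V" for x y
    using f that unfolding bij_betw_def inj_on_def by blast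
  moreover have "(\<exists>w\<in>W. P w) \<longleftrightarrow> (\<exists>v\<in>V. P (f v))" for P
    using f unfolding bij_betw_def by blast
  ultimately show ?thesis using V unfolding separation_of_def ind3_def
    by (simp add: E B cong: bex_cong)
qed

text \<open>The orientations of the two models are chosen independently of each other; any choice
  yields turn structures, and these are isomorphic.\<close>
theorem circle_models_isomorphic:
  assumes "circle_model V E B S" "countable V" "circle_model W E' B' S'" "countable W"
  shows "isomorphic_EBS V E B S W E' B' S'"
proof -
  interpret V: circle_model V E B S by fact
  interpret W: circle_model W E' B' S' by fact
  obtain out where "oriented_model V E B S out"
    using V.oriented_model_exists by blast
  then interpret V: oriented_model V E B S out .
  obtain out' where "oriented_model W E' B' S' out'"
    using W.oriented_model_exists by blast
  then interpret W: oriented_model W E' B' S' out' .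
  obtain f where f: "bij_betw f V W" and turn: "\<And>a b. a \<in> V \<Longrightarrow> b \<in> V \<Longrightarrow>
    V.turn a b = W.turn (f a) (f b)"
    using turn_structure_unique[OF V.turn_structure_turn assms(2) W.turn_structure_turn assms(4)]
    by blast
  have fW: "f x \<in> W" if "x \<in> V" for x using f that bij_betwE by blast
  have inj: "f x = f y \<longleftrightarrow> x = y" if "x \<in> V" "y \<in> V" for x y
    using f that unfolding bij_betw_def inj_on_def by blast
  have out: "out x y \<longleftrightarrow> out' (f x) (f y)" if "x \<in> V" "y \<in> V" for x y
    using turn[OF that] V.turn_eq(1)[OF that] W.turn_eq(1)[OF fW fW, OF that] by simp
  have E: "E x y \<longleftrightarrow> E' (f x) (f y)" if "x \<in> V" "y \<in> V" for x y
    using turn[OF that] V.turn_eq(3)[OF that] W.turn_eq(3)[OF fW fW, OF that] inj[OF that]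
      V.UE1_loopless[of x] W.UE1_loopless[of "f x"] fW that by metis
  have B: "B x y z \<longleftrightarrow> B' (f x) (f y) (f z)" if "x \<in> V" "y \<in> V" "z \<in> V" for x y z
    using V.B_iff_out[OF that] W.B_iff_out[OF fW fW fW, OF that] out that by simp
  have "S x y z w \<longleftrightarrow> S' (f x) (f y) (f z) (f w)" if "x \<in> V" "y \<in> V" "z \<in> V" "w \<in> V" for x y z w
    using V.S_iff_separation_of[OF that] W.S_iff_separation_of[OF fW fW fW fW, OF that]
      separation_of_bij[where f = f and V = V and E = E and E' = E' and B = B and B' = B', OF f E B
      that] by simp
  then show ?thesis unfolding isomorphic_EBS_def using f E B by blast
qed

section \<open>Points on a circle of length three\<close>

text \<open>Points of the circle are represented by reals in the interval from 0 to 3, so that a third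
  of the circumference has length 1 and all thresholds are integers. Adjacent points are far
  apart, and \<open>ahead s t\<close> says that \<open>t\<close> lies less than a third of the circumference
  counterclockwise of \<open>s\<close>.\<close>
definition far :: "real \<Rightarrow> real \<Rightarrow> bool" where
  "far s t \<longleftrightarrow> 1 < t - s \<and> t - s < 2 \<or> 1 < s - t \<and> s - t < 2"

definition ahead :: "real \<Rightarrow> real \<Rightarrow> bool" where
  "ahead s t \<longleftrightarrow> 0 < t - s \<and> t - s < 1 \<or> 2 < s - t"

definition lies_between :: "real \<Rightarrow> real \<Rightarrow> real \<Rightarrow> bool" where
  "lies_between s t u \<longleftrightarrow> ahead s t \<and> ahead t u \<and> ahead s u \<or> ahead u t \<and> ahead t s \<and> ahead u s"

definition ccw_order :: "real \<Rightarrow> real \<Rightarrow> real \<Rightarrow> bool" where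
  "ccw_order s t u \<longleftrightarrow> s < t \<and> t < u \<or> t < u \<and> u < s \<or> u < s \<and> s < t"

definition separated :: "real \<Rightarrow> real \<Rightarrow> real \<Rightarrow> real \<Rightarrow> bool" where
  "separated a b c d \<longleftrightarrow> ccw_order a b c \<and> ccw_order c d a \<or> ccw_order c b a \<and> ccw_order a d c"

definition rebase :: "real \<Rightarrow> real \<Rightarrow> real" where
  "rebase b s = (if b \<le> s then s - b else s - b + 3)"

definition mirror :: "real \<Rightarrow> real" where
  "mirror s = (if s = 0 then 0 else 3 - s)"

abbreviation on_circle where
  "on_circle s \<equiv> 0 \<le> s \<and> s < (3::real)"

abbreviation off_thirds where
  "off_thirds s t \<equiv> s - t \<noteq> 1 \<and> t - s \<noteq> 1 \<and> s - t \<noteq> 2 \<and> t - s \<noteq> (2::real)"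

lemma rebase_range:
  "on_circle b \<Longrightarrow> on_circle s \<Longrightarrow> on_circle (rebase b s)"
  unfolding rebase_def
  by auto

lemma far_rebase:
  "on_circle b \<Longrightarrow> on_circle s \<Longrightarrow> on_circle t \<Longrightarrow> far (rebase b s) (rebase b t) \<longleftrightarrow> far s t"
  unfolding rebase_def far_def
  by (cases "b \<le> s"; cases "b \<le> t"; auto)

lemma ahead_rebase:
  "on_circle b \<Longrightarrow> on_circle s \<Longrightarrow> on_circle t \<Longrightarrow> ahead (rebase b s) (rebase b t) \<longleftrightarrow> ahead s t"
  unfolding rebase_def ahead_def
  by (cases "b \<le> s"; cases "b \<le> t"; auto)

lemma ccw_order_rebase:
  "on_circle b \<Longrightarrow> on_circle s \<Longrightarrow> on_circle t \<Longrightarrow> on_circle u \<Longrightarrow>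
  ccw_order (rebase b s) (rebase b t) (rebase b u) \<longleftrightarrow> ccw_order s t u"
  unfolding rebase_def ccw_order_def
  by (cases "b \<le> s"; cases "b \<le> t"; cases "b \<le> u"; auto)

lemma mirror_range:
  "on_circle s \<Longrightarrow> on_circle (mirror s)"
  unfolding mirror_def
  by auto

lemma far_mirror:
  "on_circle s \<Longrightarrow> on_circle t \<Longrightarrow> far (mirror s) (mirror t) \<longleftrightarrow> far s t"
  unfolding mirror_def far_def
  by (cases "s = 0"; cases "t = 0"; auto)

lemma ahead_mirror:
  "on_circle s \<Longrightarrow> on_circle t \<Longrightarrow> ahead (mirror s) (mirror t) \<longleftrightarrow> ahead t s"
  unfolding mirror_def ahead_def
  by (cases "s = 0"; cases "t = 0"; auto)

lemma ccw_order_mirror: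
  "on_circle s \<Longrightarrow> on_circle t \<Longrightarrow> on_circle u \<Longrightarrow>
  ccw_order (mirror s) (mirror t) (mirror u) \<longleftrightarrow> ccw_order u t s"
  unfolding mirror_def ccw_order_def
  by (cases "s = 0"; cases "t = 0"; cases "u = 0"; auto)

lemma far_sym:
  "far x y \<longleftrightarrow> far y x"
  unfolding far_def
  by auto

lemma far_triangle_free:
  "on_circle x \<Longrightarrow> on_circle y \<Longrightarrow> on_circle z \<Longrightarrow> \<not> (far x y \<and> far y z \<and> far x z)"
  unfolding far_def
  by (smt (verit))

lemma no_ahead_cycle:
  "on_circle x \<Longrightarrow> on_circle y \<Longrightarrow> on_circle z \<Longrightarrow> ahead x y \<Longrightarrow> ahead y z \<Longrightarrow> ahead z x \<Longrightarrow> False"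
  unfolding ahead_def
  by (smt (verit))

lemma ahead_cases:
  "on_circle x \<Longrightarrow> on_circle y \<Longrightarrow> off_thirds x y \<Longrightarrow> far x y \<or> ahead x y \<or> ahead y x \<or> x = y"
  unfolding ahead_def far_def
  by (smt (verit))

lemma ahead_exclusive:
  "on_circle x \<Longrightarrow> on_circle y \<Longrightarrow> ahead x y \<Longrightarrow> \<not> ahead y x \<and> \<not> far x y \<and> \<not> far y x \<and> x \<noteq> y"
  unfolding ahead_def far_def
  by (smt (verit))

lemma separated_trichotomy:
  "x1 \<noteq> x2 \<and> x1 \<noteq> x3 \<and> x1 \<noteq> x4 \<and> x2 \<noteq> x3 \<and> x2 \<noteq> x4 \<and> x3 \<noteq> x4 \<Longrightarrow>
  (separated x1 x2 x3 x4 \<and> \<not> separated x1 x2 x4 x3 \<and> \<not> separated x1 x3 x2 x4) \<or>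
        (\<not> separated x1 x2 x3 x4 \<and> separated x1 x2 x4 x3 \<and> \<not> separated x1 x3 x2 x4) \<or>
        (\<not> separated x1 x2 x3 x4 \<and> \<not> separated x1 x2 x4 x3 \<and> separated x1 x3 x2 x4)"
  unfolding separated_def ccw_order_def
  by (smt (verit))

lemma separated_rotate:
  "separated x1 x2 x3 x4 \<longleftrightarrow> separated x2 x3 x4 x1"
  unfolding separated_def ccw_order_def
  by (smt (verit))

lemma separated_reverse:
  "separated x1 x2 x3 x4 \<longleftrightarrow> separated x4 x3 x2 x1"
  unfolding separated_def ccw_order_def
  by (smt (verit))

lemma separated_trans:
  "separated x1 x2 x3 x4 \<Longrightarrow> separated x1 x3 x4 x5 \<Longrightarrow> separated x1 x2 x4 x5"
  unfolding separated_def ccw_order_def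
  by (smt (verit))

lemma lies_between_exclusive:
  "on_circle x \<Longrightarrow> on_circle y \<Longrightarrow> on_circle z \<Longrightarrow> lies_between x y z \<Longrightarrow> \<not> lies_between y z x"
  unfolding lies_between_def using ahead_exclusive
  by blast

lemma lies_between_inner_trans:
  "on_circle x \<Longrightarrow> on_circle y \<Longrightarrow> on_circle z \<Longrightarrow> on_circle w \<Longrightarrow> lies_between x y z \<Longrightarrow> lies_between y w z \<Longrightarrow>
  lies_between x w z \<and> lies_between x y w"
  unfolding lies_between_def ahead_def
  by (smt (verit))

lemma lies_between_total:
  "on_circle x \<Longrightarrow> on_circle y \<Longrightarrow> on_circle z \<Longrightarrow> on_circle w \<Longrightarrow> lies_between x y z \<Longrightarrow> lies_between x y w \<Longrightarrow>
  z \<noteq> w \<Longrightarrow> lies_between x z w \<or> lies_between x w z"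
  unfolding lies_between_def ahead_def
  by (smt (verit))

lemma nonfar_triple_iff:
  "on_circle x \<Longrightarrow> on_circle y \<Longrightarrow> on_circle z \<Longrightarrow> off_thirds x y \<Longrightarrow> off_thirds y z \<Longrightarrow> off_thirds x z \<Longrightarrow>
  x \<noteq> y \<and> y \<noteq> z \<and> x \<noteq> z \<and> \<not> far x y \<and> \<not> far y z \<and> \<not> far x z \<longleftrightarrow>
  lies_between x y z \<or> lies_between y z x \<or> lies_between z x y"
  unfolding lies_between_def
  using ahead_cases[of x y] ahead_cases[of y z] ahead_cases[of x z] ahead_exclusive[of x y]
  ahead_exclusive[of y x] ahead_exclusive[of y z] ahead_exclusive[of z y] ahead_exclusive[of x z]
  ahead_exclusive[of z x] no_ahead_cycle[of x y z] no_ahead_cycle[of x z y]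
  by argo

lemma lies_between_outer_trans:
  "on_circle x \<Longrightarrow> on_circle y \<Longrightarrow> on_circle z \<Longrightarrow> on_circle w \<Longrightarrow> off_thirds x w \<Longrightarrow> lies_between x y z \<Longrightarrow>
  lies_between y z w \<Longrightarrow> \<not> far x w \<Longrightarrow> lies_between x y w \<and> lies_between x z w"
  unfolding lies_between_def ahead_def far_def
  by (smt (verit))

lemma far_from_middle:
  "on_circle x \<Longrightarrow> on_circle y \<Longrightarrow> on_circle z \<Longrightarrow> on_circle w \<Longrightarrow> lies_between x y z \<Longrightarrow> far y w \<Longrightarrow>
  off_thirds x w \<Longrightarrow> off_thirds z w \<Longrightarrow> far x w \<or> far z w"
  unfolding lies_between_def far_def ahead_def
  by (smt (verit))

lemma far_from_both_ends:
  "on_circle x \<Longrightarrow> on_circle y \<Longrightarrow> on_circle z \<Longrightarrow> on_circle w \<Longrightarrow> lies_between x y z \<Longrightarrow> far x w \<Longrightarrow> far z w \<Longrightarrow>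
  far y w"
  unfolding lies_between_def far_def ahead_def
  by (smt (verit))

lemma separated_on_short_arc:
  "on_circle x1 \<Longrightarrow> on_circle x2 \<Longrightarrow> on_circle x3 \<Longrightarrow> on_circle x4 \<Longrightarrow> on_circle x5 \<Longrightarrow> far x1 x4 \<Longrightarrow>
  lies_between x3 x5 x4 \<Longrightarrow> separated x1 x2 x3 x4 \<Longrightarrow> separated x1 x2 x3 x5"
  unfolding ccw_order_def far_def ahead_def lies_between_def separated_def
  by (smt (verit))

lemma separated_if_chained:
  "on_circle x \<Longrightarrow> on_circle y1 \<Longrightarrow> on_circle y2 \<Longrightarrow> on_circle z1 \<Longrightarrow> on_circle z2 \<Longrightarrow> far y1 z2 \<Longrightarrow>
  lies_between y1 y2 x \<Longrightarrow> lies_between x z1 z2 \<Longrightarrow> separated y1 y2 z1 z2"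
  unfolding ccw_order_def far_def ahead_def lies_between_def separated_def
  by (smt (verit))

text \<open>If \<open>x1\<close> and \<open>x3\<close> are near, then one of \<open>x2\<close> and \<open>x4\<close> lies on the short arc between them.\<close>
lemma nonfar_triple_if_diagonal_nonfar:
  "on_circle x1 \<Longrightarrow> on_circle x2 \<Longrightarrow> on_circle x3 \<Longrightarrow> on_circle x4 \<Longrightarrow> off_thirds x1 x3 \<Longrightarrow>
  separated x1 x2 x3 x4 \<Longrightarrow> \<not> far x1 x3 \<Longrightarrow> (\<not> far x1 x2 \<and> \<not> far x2 x3) \<or> (\<not> far x3 x4 \<and> \<not> far x4 x1)"
  unfolding ccw_order_def far_def separated_def
  by (smt (verit))

lemma separated_iff_not_lies_between:
  "on_circle x1 \<Longrightarrow> on_circle x2 \<Longrightarrow> on_circle x3 \<Longrightarrow> on_circle x4 \<Longrightarrow> x4 \<noteq> x1 \<Longrightarrow> x4 \<noteq> x2 \<Longrightarrow> x4 \<noteq> x3 \<Longrightarrow>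
  lies_between x1 x2 x3 \<Longrightarrow> separated x1 x2 x3 x4 \<longleftrightarrow> \<not> lies_between x1 x4 x3"
  unfolding ccw_order_def ahead_def lies_between_def separated_def
  by (smt (verit))

lemma separated_iff_lies_between:
  "on_circle x1 \<Longrightarrow> on_circle x2 \<Longrightarrow> on_circle x3 \<Longrightarrow> on_circle x4 \<Longrightarrow> x4 \<noteq> x1 \<Longrightarrow> x4 \<noteq> x2 \<Longrightarrow> x4 \<noteq> x3 \<Longrightarrow>
  lies_between x2 x1 x3 \<or> lies_between x1 x3 x2 \<Longrightarrow> separated x1 x2 x3 x4 \<longleftrightarrow> lies_between x1 x4 x3"
  unfolding ccw_order_def ahead_def lies_between_def separated_def
  by (smt (verit))

section \<open>Charts and the universal axioms\<close>

text \<open>The right-hand side is the formula for \<open>separated\<close>, with indices in place of positions.\<close>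
lemma index_sep_iff: "index_sep a b c d \<longleftrightarrow>
   (a < b \<and> b < c \<or> b < c \<and> c < a \<or> c < a \<and> a < b) \<and> (c < d \<and> d < a \<or> d < a \<and> a < c \<or>
   a < c \<and> c < d) \<or>
   (c < b \<and> b < a \<or> b < a \<and> a < c \<or> a < c \<and> c < b) \<and> (a < d \<and> d < c \<or> d < c \<and> c < a \<or>
   c < a \<and> a < d)"
  unfolding index_sep_def by (cases "a < c"; cases "c < a"; auto)

text \<open>Lengths 1 and 2 between two points do not occur, so that two points are either at distance
  more than a third of the circumference or less than that.\<close>
locale circle_chart =
  fixes V :: "'a set" and E B S and \<theta> :: "'a \<Rightarrow> real"
  assumes inj: "x \<in> V \<Longrightarrow> y \<in> V \<Longrightarrow> \<theta> x = \<theta> y \<Longrightarrow> x = y"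
    and range: "x \<in> V \<Longrightarrow> 0 \<le> \<theta> x \<and> \<theta> x < 3"
    and dense: "0 \<le> l \<Longrightarrow> l < u \<Longrightarrow> u \<le> 3 \<Longrightarrow> \<exists>v\<in>V. l < \<theta> v \<and> \<theta> v < u"
    and gap: "x \<in> V \<Longrightarrow> y \<in> V \<Longrightarrow> \<theta> x - \<theta> y \<noteq> 1 \<and> \<theta> x - \<theta> y \<noteq> 2"
    and E_iff: "x \<in> V \<Longrightarrow> y \<in> V \<Longrightarrow> E x y \<longleftrightarrow> far (\<theta> x) (\<theta> y)"
    and B_iff: "x \<in> V \<Longrightarrow> y \<in> V \<Longrightarrow> z \<in> V \<Longrightarrow> B x y z \<longleftrightarrow> lies_between (\<theta> x) (\<theta> y) (\<theta> z)"
    and S_iff: "x \<in> V \<Longrightarrow> y \<in> V \<Longrightarrow> z \<in> V \<Longrightarrow> w \<in> V \<Longrightarrow> S x y z w \<longleftrightarrow> separated (\<theta> x) (\<theta> y) (\<theta> z) (\<theta> w)"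
begin

lemma gap': "x \<in> V \<Longrightarrow> y \<in> V \<Longrightarrow> off_thirds (\<theta> x) (\<theta> y)"
  using gap[of x y] gap[of y x] by blast

lemma E_sym: "x \<in> V \<Longrightarrow> y \<in> V \<Longrightarrow> E x y \<longleftrightarrow> E y x"
  using E_iff far_sym by blast

lemma not_E_self: "x \<in> V \<Longrightarrow> \<not> E x x"
  using E_iff[of x x] unfolding far_def by simp

text \<open>Each of the three graphs contains two disjoint edges, and any three of the four vertices
  include both ends of one of them.\<close>
lemma edge_in_triple:
  assumes "induces_C4 E X \<or> induces_P4 E X \<or> induces_2K2 E X" "X \<subseteq> V"
    "x \<in> X" "y \<in> X" "z \<in> X" "x \<noteq> y" "y \<noteq> z" "x \<noteq> z"
  shows "E x y \<or> E y z \<or> E x z"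
proof -
  obtain a b c d where X: "X = {a, b, c, d}" and E: "E a b" "E c d" and "a \<noteq> c" "a \<noteq> d" "b \<noteq> c"
    "b \<noteq> d"
    using assms(1) unfolding induces_C4_def induces_P4_def induces_2K2_def by auto
  have "E b a" "E d c" using E E_sym X assms(2) by auto
  then show ?thesis using E assms(3-8) unfolding X by auto
qed

lemma universal_axioms: "universal_axioms V E B S"
proof
  fix x1 x2 x3 x4 assume "{x1, x2, x3, x4} \<subseteq> V" "S x1 x2 x3 x4"
  then show "distinct [x1, x2, x3, x4]" using S_iff[of x1 x2 x3 x4]
    unfolding separated_def ccw_order_def by auto
next
  fix x assume "x \<in> V" then show "\<not> E x x" using not_E_self by blast
next
  fix x y assume "{x, y} \<subseteq> V" "E x y" then show "E y x" using E_sym by blast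
next
  fix x y z assume "{x, y, z} \<subseteq> V"
  then have V: "x \<in> V" "y \<in> V" "z \<in> V" by auto
  note r = range[OF V(1)] range[OF V(2)] range[OF V(3)]
  show "\<not> (E x y \<and> E y z \<and> E x z)" using far_triangle_free[OF r] E_iff V by simp
  show "B x y z \<longleftrightarrow> B z y x" using B_iff V unfolding lies_between_def by auto
  show "B x y z \<Longrightarrow> \<not> B y z x" using lies_between_exclusive[OF r] B_iff V by simp
  have "independent_set E {x, y, z} \<longleftrightarrow> \<not> E x y \<and> \<not> E y z \<and> \<not> E x z"
    using not_E_self V E_sym unfolding independent_set_def by blast
  moreover have "\<theta> x = \<theta> y \<longleftrightarrow> x = y" "\<theta> y = \<theta> z \<longleftrightarrow> y = z" "\<theta> x = \<theta> z \<longleftrightarrow> x = z" using inj V by blast+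
  ultimately show "distinct [x, y, z] \<and> independent_set E {x, y, z} \<longleftrightarrow> B x y z \<or> B y z x \<or> B z x y"
    using nonfar_triple_iff[OF r gap'[OF V(1,2)] gap'[OF V(2,3)] gap'[OF V(1,3)]] V
    by (auto simp: E_iff B_iff)
next
  fix x y z w assume "{x, y, z, w} \<subseteq> V"
  then have V: "x \<in> V" "y \<in> V" "z \<in> V" "w \<in> V" by auto
  note r = range[OF V(1)] range[OF V(2)] range[OF V(3)] range[OF V(4)]
  show "B x y z \<Longrightarrow> B y w z \<Longrightarrow> B x w z \<and> B x y w" using lies_between_inner_trans[OF r] V
    by (simp add: B_iff)
  show "B x y z \<Longrightarrow> B x y w \<Longrightarrow> z \<noteq> w \<Longrightarrow> B x z w \<or> B x w z" using lies_between_total[OF r] V inj[of z w]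
    by (auto simp: B_iff)
  show "B x y z \<Longrightarrow> B y z w \<Longrightarrow> \<not> E x w \<Longrightarrow> B x y w \<and> B x z w"
    using lies_between_outer_trans[OF r gap'[OF V(1,4)]] V by (simp add: B_iff E_iff)
  show "B x y z \<Longrightarrow> E y w \<Longrightarrow> E x w \<or> E z w"
    using far_from_middle[OF r _ _ gap'[OF V(1,4)] gap'[OF V(3,4)]] V by (simp add: B_iff E_iff)
  show "B x y z \<Longrightarrow> E x w \<Longrightarrow> E z w \<Longrightarrow> E y w"
    using far_from_both_ends[OF r] V by (simp add: B_iff E_iff)
next
  fix x1 x2 x3 x4 assume sub: "{x1, x2, x3, x4} \<subseteq> V"
  then have V: "x1 \<in> V" "x2 \<in> V" "x3 \<in> V" "x4 \<in> V" by auto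
  note r = range[OF V(1)] range[OF V(2)] range[OF V(3)] range[OF V(4)]
  have eq: "\<theta> x = \<theta> y \<longleftrightarrow> x = y" if "x \<in> V" "y \<in> V" for x y using inj that by blast
  show "S x1 x2 x3 x4 \<longleftrightarrow> S x2 x3 x4 x1" "S x1 x2 x3 x4 \<longleftrightarrow> S x4 x3 x2 x1"
    using separated_rotate[of "\<theta> x1" "\<theta> x2" "\<theta> x3" "\<theta> x4"] separated_reverse[of "\<theta> x1" "\<theta> x2" "\<theta> x3"
    "\<theta> x4"] V
    by (simp_all only: S_iff)
  show "distinct [x1, x2, x3, x4] \<Longrightarrow>
        (S x1 x2 x3 x4 \<and> \<not> S x1 x2 x4 x3 \<and> \<not> S x1 x3 x2 x4) \<or>
        (\<not> S x1 x2 x3 x4 \<and> S x1 x2 x4 x3 \<and> \<not> S x1 x3 x2 x4) \<or>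
        (\<not> S x1 x2 x3 x4 \<and> \<not> S x1 x2 x4 x3 \<and> S x1 x3 x2 x4)"
    using separated_trichotomy[of "\<theta> x1" "\<theta> x2" "\<theta> x3" "\<theta> x4"] V eq by (simp add: S_iff)
  show "E x1 x3 \<and> E x2 x4" if C: "induces_C4 E {x1, x2, x3, x4} \<or> induces_P4 E {x1, x2, x3, x4} \<or>
        induces_2K2 E {x1, x2, x3, x4}" and S: "S x1 x2 x3 x4"
  proof -
    have "distinct [x1, x2, x3, x4]" using S V S_iff[of x1 x2 x3 x4]
      unfolding separated_def ccw_order_def by auto
    then have "E x1 x2 \<or> E x2 x3 \<or> E x1 x3" "E x3 x4 \<or> E x4 x1 \<or> E x3 x1" "E x2 x3 \<or> E x3 x4 \<or>
      E x2 x4" "E x4 x1 \<or> E x1 x2 \<or> E x4 x2"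
      using edge_in_triple[OF C sub] by auto
    moreover have "separated (\<theta> x1) (\<theta> x2) (\<theta> x3) (\<theta> x4)" "separated (\<theta> x2) (\<theta> x3) (\<theta> x4) (\<theta> x1)"
      using S V S_iff separated_rotate by blast+
    ultimately show ?thesis
      using nonfar_triple_if_diagonal_nonfar[OF r gap'[OF V(1,3)]]
      nonfar_triple_if_diagonal_nonfar[OF r(2-4,1) gap'[OF V(2,4)]] E_iff V far_sym by metis
  qed
  show "S x1 x2 x3 x4 \<longleftrightarrow> (B x1 x2 x3 \<and> \<not> B x1 x4 x3) \<or> (B x1 x4 x3 \<and> \<not> B x1 x2 x3)"
    if d: "distinct [x1, x2, x3]" and i: "independent_set E {x1, x2, x3}" and x4: "x4 \<notin> {x1, x2,
    x3}"
  proof -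
    have "\<not> E x1 x2" "\<not> E x2 x3" "\<not> E x1 x3" using i unfolding independent_set_def by auto
    then have "lies_between (\<theta> x1) (\<theta> x2) (\<theta> x3) \<or> lies_between (\<theta> x2) (\<theta> x1) (\<theta> x3) \<or>
      lies_between (\<theta> x1) (\<theta> x3) (\<theta> x2)"
      using nonfar_triple_iff[OF r(1-3) gap'[OF V(1,2)] gap'[OF V(2,3)] gap'[OF V(1,3)]] d V eq
      unfolding lies_between_def by (auto simp: E_iff)
    moreover have "\<theta> x4 \<noteq> \<theta> x1" "\<theta> x4 \<noteq> \<theta> x2" "\<theta> x4 \<noteq> \<theta> x3" using x4 eq V by auto
    moreover have "\<not> lies_between (\<theta> x1) (\<theta> x2) (\<theta> x3)"
      if "lies_between (\<theta> x2) (\<theta> x1) (\<theta> x3) \<or> lies_between (\<theta> x1) (\<theta> x3) (\<theta> x2)"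
      using that ahead_exclusive[OF r(1,2)] ahead_exclusive[OF r(2,3)] ahead_exclusive[OF r(1,3)]
      ahead_exclusive[OF r(2,1)] ahead_exclusive[OF r(3,2)] ahead_exclusive[OF r(3,1)]
      unfolding lies_between_def by blast
    ultimately show ?thesis
      using separated_iff_not_lies_between[OF r] separated_iff_lies_between[OF r] V
      by (auto simp: S_iff B_iff)
  qed
next
  fix x1 x2 x3 x4 x5 assume "{x1, x2, x3, x4, x5} \<subseteq> V"
  then have V: "x1 \<in> V" "x2 \<in> V" "x3 \<in> V" "x4 \<in> V" "x5 \<in> V" by auto
  note r = range[OF V(1)] range[OF V(2)] range[OF V(3)] range[OF V(4)] range[OF V(5)]
  show "S x1 x2 x3 x4 \<Longrightarrow> S x1 x3 x4 x5 \<Longrightarrow> S x1 x2 x4 x5"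
    using separated_trans[of "\<theta> x1" "\<theta> x2" "\<theta> x3" "\<theta> x4" "\<theta> x5"] V by (simp add: S_iff)
  show "S x1 x2 x3 x4 \<Longrightarrow> E x1 x4 \<Longrightarrow> B x3 x5 x4 \<Longrightarrow> S x1 x2 x3 x5"
    using separated_on_short_arc[OF r] V by (simp add: S_iff B_iff E_iff)
next
  fix x y1 y2 z1 z2 assume "{x, y1, y2, z1, z2} \<subseteq> V"
  then have V: "x \<in> V" "y1 \<in> V" "y2 \<in> V" "z1 \<in> V" "z2 \<in> V" by auto
  note r = range[OF V(1)] range[OF V(2)] range[OF V(3)] range[OF V(4)] range[OF V(5)]
  show "B y1 y2 x \<Longrightarrow> B x z1 z2 \<Longrightarrow> E y1 z2 \<Longrightarrow> S y1 y2 z1 z2"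
    using separated_if_chained[OF r] V by (simp add: S_iff B_iff E_iff)
qed

text \<open>Rotations and reflections of a chart are charts. They are used to move the points of an
  axiom into a standard position: the first one at 0, the others in increasing order.\<close>
lemma chart_rebase:
  assumes b: "b \<in> V"
  shows "circle_chart V E B S (\<lambda>x. rebase (\<theta> b) (\<theta> x))"
proof
  fix x y assume V: "x \<in> V" "y \<in> V"
  note r = range[OF b] range[OF V(1)] range[OF V(2)]
  show "rebase (\<theta> b) (\<theta> x) = rebase (\<theta> b) (\<theta> y) \<Longrightarrow> x = y" using inj[OF V] r unfolding rebase_def
    by (auto split: if_splits)
  show "0 \<le> rebase (\<theta> b) (\<theta> x) \<and> rebase (\<theta> b) (\<theta> x) < 3" using rebase_range r by blast
  show "rebase (\<theta> b) (\<theta> x) - rebase (\<theta> b) (\<theta> y) \<noteq> 1 \<and> rebase (\<theta> b) (\<theta> x) - rebase (\<theta> b) (\<theta> y) \<noteq> 2"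
    using r gap'[OF V] unfolding rebase_def by (auto simp: algebra_simps)
  show "E x y \<longleftrightarrow> far (rebase (\<theta> b) (\<theta> x)) (rebase (\<theta> b) (\<theta> y))" using far_rebase[OF r] E_iff[OF V]
    by simp
next
  fix x y z assume V: "x \<in> V" "y \<in> V" "z \<in> V"
  then show "B x y z \<longleftrightarrow> lies_between (rebase (\<theta> b) (\<theta> x)) (rebase (\<theta> b) (\<theta> y)) (rebase (\<theta> b) (\<theta> z))"
    using range b by (simp add: B_iff lies_between_def ahead_rebase)
next
  fix x y z w assume V: "x \<in> V" "y \<in> V" "z \<in> V" "w \<in> V"
  then show "S x y z w \<longleftrightarrow>
    separated (rebase (\<theta> b) (\<theta> x)) (rebase (\<theta> b) (\<theta> y)) (rebase (\<theta> b) (\<theta> z)) (rebase (\<theta> b) (\<theta> w))"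
    using range b by (simp add: S_iff separated_def ccw_order_rebase)
next
  fix l u :: real assume lu: "0 \<le> l" "l < u" "u \<le> 3"
  note rb = range[OF b]
  show "\<exists>v\<in>V. l < rebase (\<theta> b) (\<theta> v) \<and> rebase (\<theta> b) (\<theta> v) < u"
  \<comment> \<open>The preimage of the interval may run past the point 0; its initial part is then used.\<close>
  proof (cases "l + \<theta> b < 3")
    case True
    then obtain v where "v \<in> V" "l + \<theta> b < \<theta> v" "\<theta> v < min (u + \<theta> b) 3"
      using dense[of "l + \<theta> b" "min (u + \<theta> b) 3"] lu rb by auto
    then show ?thesis using lu by (intro bexI[of _ v]) (auto simp: rebase_def)
  next
    case False
    then obtain v where "v \<in> V" "l + \<theta> b - 3 < \<theta> v" "\<theta> v < u + \<theta> b - 3"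
      using dense[of "l + \<theta> b - 3" "u + \<theta> b - 3"] lu rb by auto
    then show ?thesis using lu rb by (intro bexI[of _ v]) (auto simp: rebase_def)
  qed
qed

lemma chart_mirror: "circle_chart V E B S (\<lambda>x. mirror (\<theta> x))"
proof
  fix x y assume V: "x \<in> V" "y \<in> V"
  note r = range[OF V(1)] range[OF V(2)]
  show "mirror (\<theta> x) = mirror (\<theta> y) \<Longrightarrow> x = y" using inj[OF V] r unfolding mirror_def
    by (auto split: if_splits)
  show "0 \<le> mirror (\<theta> x) \<and> mirror (\<theta> x) < 3" using mirror_range r by blast
  show "mirror (\<theta> x) - mirror (\<theta> y) \<noteq> 1 \<and> mirror (\<theta> x) - mirror (\<theta> y) \<noteq> 2"
    using r gap'[OF V] unfolding mirror_def by (auto simp: algebra_simps)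
  show "E x y \<longleftrightarrow> far (mirror (\<theta> x)) (mirror (\<theta> y))" using far_mirror[OF r] E_iff[OF V] by simp
next
  fix x y z assume V: "x \<in> V" "y \<in> V" "z \<in> V"
  then show "B x y z \<longleftrightarrow> lies_between (mirror (\<theta> x)) (mirror (\<theta> y)) (mirror (\<theta> z))"
    using range by (auto simp add: B_iff lies_between_def ahead_mirror)
next
  fix x y z w assume V: "x \<in> V" "y \<in> V" "z \<in> V" "w \<in> V"
  then show "S x y z w \<longleftrightarrow> separated (mirror (\<theta> x)) (mirror (\<theta> y)) (mirror (\<theta> z)) (mirror (\<theta> w))"
    using range by (auto simp add: S_iff separated_def ccw_order_mirror)
next
  fix l u :: real assume lu: "0 \<le> l" "l < u" "u \<le> 3"
  obtain v where "v \<in> V" "3 - u < \<theta> v" "\<theta> v < 3 - l" using dense[of "3 - u" "3 - l"] lu by auto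
  then show "\<exists>v\<in>V. l < mirror (\<theta> v) \<and> mirror (\<theta> v) < u" using lu
    by (intro bexI[of _ v]) (auto simp: mirror_def)
qed

lemma chart_at:
  assumes "x \<in> V"
  obtains \<theta>' where "circle_chart V E B S \<theta>'" "\<theta>' x = 0"
  using chart_rebase[OF assms] by (auto simp: rebase_def)

lemma chart_at_ordered:
  assumes V: "x \<in> V" "y \<in> V" "z \<in> V" and d: "distinct [x, y, z]"
  obtains \<theta>' where "circle_chart V E B S \<theta>'" "\<theta>' x = 0" "0 < \<theta>' y" "\<theta>' y < \<theta>' z"
proof -
  obtain \<phi> where \<phi>: "circle_chart V E B S \<phi>" "\<phi> x = 0" using chart_at[OF V(1)] .
  interpret C: circle_chart V E B S \<phi> by fact
  have "\<phi> y \<noteq> 0" "\<phi> z \<noteq> 0" "\<phi> y \<noteq> \<phi> z" using C.inj V d \<phi>(2) by (metis distinct_length_2_or_more)+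
  then consider "0 < \<phi> y" "\<phi> y < \<phi> z" | "0 < \<phi> z" "\<phi> z < \<phi> y"
    using C.range[OF V(2)] C.range[OF V(3)] by linarith
  then show ?thesis
  proof cases
    case 1 then show ?thesis using that \<phi> by blast
  next
    case 2 then show ?thesis using that[OF C.chart_mirror] C.range[OF V(2)] \<phi>(2)
    by (auto simp: mirror_def)
  qed
qed

lemma chart_at_nonedge:
  assumes V: "x \<in> V" "y \<in> V" and d: "x \<noteq> y" "\<not> E x y"
  obtains \<theta>' where "circle_chart V E B S \<theta>'" "\<theta>' x = 0" "0 < \<theta>' y" "\<theta>' y < 1"
proof -
  obtain \<phi> where \<phi>: "circle_chart V E B S \<phi>" "\<phi> x = 0" using chart_at[OF V(1)] .
  interpret C: circle_chart V E B S \<phi> by fact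
  have "\<phi> y \<noteq> 0" using C.inj V d \<phi>(2) by metis
  then consider "0 < \<phi> y" "\<phi> y < 1" | "2 < \<phi> y"
    using C.range[OF V(2)] C.E_iff[OF V] C.gap'[OF V] d(2) \<phi>(2) unfolding far_def by fastforce
  then show ?thesis
  proof cases
    case 1 then show ?thesis using that \<phi> by blast
  next
    case 2 then show ?thesis using that[OF C.chart_mirror] C.range[OF V(2)] \<phi>(2)
    by (auto simp: mirror_def)
  qed
qed

lemma chart_at_S:
  assumes V: "x1 \<in> V" "x2 \<in> V" "x3 \<in> V" "x4 \<in> V" and S: "S x1 x2 x3 x4"
  obtains \<theta>' where "circle_chart V E B S \<theta>'" "\<theta>' x1 = 0" "0 < \<theta>' x2" "\<theta>' x2 < \<theta>' x3" "\<theta>' x3 < \<theta>' x4"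
    "\<theta>' x4 < 3"
proof -
  obtain \<phi> where \<phi>: "circle_chart V E B S \<phi>" "\<phi> x1 = 0" using chart_at[OF V(1)] .
  interpret C: circle_chart V E B S \<phi> by fact
  have "separated 0 (\<phi> x2) (\<phi> x3) (\<phi> x4)" using C.S_iff[OF V] S \<phi>(2) by simp
  then consider "0 < \<phi> x2" "\<phi> x2 < \<phi> x3" "\<phi> x3 < \<phi> x4" | "0 < \<phi> x4" "\<phi> x4 < \<phi> x3" "\<phi> x3 < \<phi> x2"
    using C.range[OF V(2)] C.range[OF V(3)] C.range[OF V(4)] unfolding separated_def ccw_order_def
    by fastforce
  then show ?thesis
  proof cases
    case 1 then show ?thesis using that \<phi> C.range[OF V(4)] by blast
  next
    case 2 then show ?thesis using that[OF C.chart_mirror] C.range[OF V(2)] \<phi>(2)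
    by (auto simp: mirror_def)
  qed
qed

lemma Sep_sorted:
  assumes V: "set xs \<subseteq> V" and sorted: "sorted_wrt (<) (map \<theta> xs)"
  shows "Sep S xs"
proof -
  have "\<theta> (xs ! i) < \<theta> (xs ! j) \<longleftrightarrow> i < j" if "i < length xs" "j < length xs" for i j
    using sorted that by (metis (no_types, lifting) length_map linorder_neqE_nat nth_map
    order_less_asym order_less_irrefl sorted_wrt_iff_nth_less)
  then have "S (xs ! a) (xs ! b) (xs ! c) (xs ! d) \<longleftrightarrow> index_sep a b c d"
    if "a < length xs" "b < length xs" "c < length xs" "d < length xs" for a b c d
    using that S_iff V unfolding index_sep_iff separated_def ccw_order_def by (simp add: subset_iff)
  then show ?thesis unfolding Sep_def by blast
qed

lemma chart_at_Sep5:
  assumes V: "{x1, x2, x3, x4, x5} \<subseteq> V" and S: "Sep S [x1, x2, x3, x4, x5]"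
  obtains \<theta>' where "circle_chart V E B S \<theta>'" "\<theta>' x1 = 0" "0 < \<theta>' x2" "\<theta>' x2 < \<theta>' x3" "\<theta>' x3 < \<theta>' x4"
    "\<theta>' x4 < \<theta>' x5" "\<theta>' x5 < 3"
proof -
  have V': "x1 \<in> V" "x2 \<in> V" "x3 \<in> V" "x4 \<in> V" "x5 \<in> V" using V by auto
  have "S x1 x2 x3 x4" "S x1 x3 x4 x5"
    using S[unfolded Sep_def, rule_format, of 0 1 2 3] S[unfolded Sep_def, rule_format, of 0 2 3 4]
    unfolding index_sep_def by simp_all
  note quads = this
  obtain \<phi> where \<phi>: "circle_chart V E B S \<phi>" "\<phi> x1 = 0" "0 < \<phi> x2" "\<phi> x2 < \<phi> x3" "\<phi> x3 < \<phi> x4"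
    "\<phi> x4 < 3"
    using chart_at_S[OF V'(1-4) quads(1)] .
  interpret C: circle_chart V E B S \<phi> by fact
  have "\<phi> x4 < \<phi> x5" using quads(2) \<phi> C.S_iff[OF V'(1,3-5)] C.range[OF V'(5)]
    unfolding separated_def ccw_order_def by auto
  then show ?thesis using that \<phi> C.range[OF V'(5)] by blast
qed

lemma chart_at_Sep6:
  assumes V: "{x1, x2, x3, x4, x5, x6} \<subseteq> V" and S: "Sep S [x1, x2, x3, x4, x5, x6]"
  obtains \<theta>' where "circle_chart V E B S \<theta>'" "\<theta>' x1 = 0" "0 < \<theta>' x2" "\<theta>' x2 < \<theta>' x3" "\<theta>' x3 < \<theta>' x4"
    "\<theta>' x4 < \<theta>' x5" "\<theta>' x5 < \<theta>' x6" "\<theta>' x6 < 3"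
proof -
  have V': "x1 \<in> V" "x2 \<in> V" "x3 \<in> V" "x4 \<in> V" "x5 \<in> V" "x6 \<in> V" using V by auto
  have "S x1 x2 x3 x4" "S x1 x3 x4 x5" "S x1 x4 x5 x6"
    using S[unfolded Sep_def, rule_format, of 0 1 2 3] S[unfolded Sep_def, rule_format, of 0 2 3 4]
      S[unfolded Sep_def, rule_format, of 0 3 4 5]
    unfolding index_sep_def by simp_all
  note quads = this
  obtain \<phi> where \<phi>: "circle_chart V E B S \<phi>" "\<phi> x1 = 0" "0 < \<phi> x2" "\<phi> x2 < \<phi> x3" "\<phi> x3 < \<phi> x4"
    "\<phi> x4 < 3"
    using chart_at_S[OF V'(1-4) quads(1)] .
  interpret C: circle_chart V E B S \<phi> by fact
  have "\<phi> x4 < \<phi> x5" "\<phi> x5 < \<phi> x6"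
    using quads(2,3) \<phi> C.S_iff[OF V'(1,3-5)] C.S_iff[OF V'(1,4-6)] C.range[OF V'(5)]
    C.range[OF V'(6)] unfolding separated_def ccw_order_def by auto
  then show ?thesis using that \<phi> C.range[OF V'(6)] by blast
qed

end

section \<open>Charts and the extension axioms\<close>

lemma induces_edge_triple: "induces_edge E {x, y, z} \<longleftrightarrow>
  E x x \<or> E x y \<or> E x z \<or> E y x \<or> E y y \<or> E y z \<or> E z x \<or> E z y \<or> E z z"
  unfolding induces_edge_def by auto

context circle_chart begin

lemma pick:
  assumes "finite L" "finite U" "\<forall>l\<in>L. l < 3" "\<forall>u\<in>U. 0 < u" "\<forall>l\<in>L. \<forall>u\<in>U. l < u"
  shows "\<exists>v\<in>V. (\<forall>l\<in>L. l < \<theta> v) \<and> (\<forall>u\<in>U. \<theta> v < u)"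
proof -
  have "Max (insert 0 L) < Min (insert 3 U)" using assms by auto
  then obtain v where "v \<in> V" "Max (insert 0 L) < \<theta> v" "\<theta> v < Min (insert 3 U)"
    using dense[of "Max (insert 0 L)" "Min (insert 3 U)"] assms(1,2) by auto
  then show ?thesis using assms(1,2) by (intro bexI[of _ v]) auto
qed

lemma edge_in_triple_iff:
  assumes "x \<in> V" "y \<in> V" "z \<in> V"
  shows "induces_edge E {x, y, z} \<longleftrightarrow> far (\<theta> x) (\<theta> y) \<or> far (\<theta> y) (\<theta> z) \<or> far (\<theta> x) (\<theta> z)"
  using assms not_E_self far_sym by (auto simp: induces_edge_triple E_iff)

lemma near_iff:
  assumes "x \<in> V" "y \<in> V" "\<theta> x \<le> \<theta> y"
  shows "E x y \<longleftrightarrow> 1 < \<theta> y - \<theta> x \<and> \<theta> y - \<theta> x < 2"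
    "\<not> E x y \<longleftrightarrow> \<theta> y - \<theta> x < 1 \<or> 2 < \<theta> y - \<theta> x"
  using E_iff[OF assms(1,2)] gap'[OF assms(1,2)] assms(3) unfolding far_def by auto

lemma B_if_increasing:
  assumes "x \<in> V" "y \<in> V" "z \<in> V" "\<theta> x < \<theta> y" "\<theta> y < \<theta> z" "\<theta> z < \<theta> x + 1"
  shows "B x y z"
  using assms by (auto simp: B_iff lies_between_def ahead_def)

lemma S_if_increasing:
  assumes "x \<in> V" "y \<in> V" "z \<in> V" "w \<in> V" "\<theta> x < \<theta> y" "\<theta> y < \<theta> z" "\<theta> z < \<theta> w"
  shows "S x y z w"
  using assms by (auto simp: S_iff separated_def ccw_order_def)

text \<open>In each of the following lemmas the required adjacencies become bounds on the position of
  the new vertex: in a chart that starts at \<open>x\<close>, a neighbour of \<open>x\<close> is between 1 and 2, and a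
  non-neighbour ahead of \<open>y\<close> is below \<open>\<phi> y + 1\<close>. The work lies in deriving the inequalities
  between these bounds from the hypotheses.\<close>
lemma common_nbr_and_nonnbr:
  assumes "x1 \<in> V" "x2 \<in> V" "\<not> E x1 x2"
  shows "\<exists>v1\<in>V. \<exists>v2\<in>V. E v1 x1 \<and> E v1 x2 \<and> \<not> E v2 x1 \<and> \<not> E v2 x2"
proof -
  have "\<exists>v\<in>V. E v x1 \<and> E v x2"
  proof (cases "x1 = x2")
    case True
    obtain \<phi> where \<phi>: "circle_chart V E B S \<phi>" "\<phi> x1 = 0" using chart_at assms by blast
    interpret C: circle_chart V E B S \<phi> by fact
    obtain v where "v \<in> V" "1 < \<phi> v" "\<phi> v < 2" using C.pick[of "{1}" "{2}"] by auto
    then show ?thesis using True assms \<phi>(2) by (intro bexI[of _ v]) (auto simp: C.E_iff far_def)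
  next
    case False
    obtain \<phi> where \<phi>: "circle_chart V E B S \<phi>" "\<phi> x1 = 0" "0 < \<phi> x2" "\<phi> x2 < 1"
      using chart_at_nonedge assms False by metis
    interpret C: circle_chart V E B S \<phi> by fact
    obtain v where "v \<in> V" "1 + \<phi> x2 < \<phi> v" "\<phi> v < 2" using C.pick[of "{1 + \<phi> x2}" "{2}"] \<phi> by auto
    then show ?thesis using assms \<phi>(2-) by (intro bexI[of _ v]) (auto simp: C.E_iff far_def)
  qed
  then show ?thesis using assms not_E_self E_sym by blast
qed

lemma near_pair_extends:
  assumes V: "y1 \<in> V" "y2 \<in> V" and E: "\<not> E y1 y2" "y1 \<noteq> y2"
  shows "\<exists>v1\<in>V. \<exists>v2\<in>V. \<exists>v3\<in>V. B v1 y1 y2 \<and> B y1 v2 y2 \<and> B y1 y2 v3"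
proof -
  obtain \<phi> where \<phi>: "circle_chart V E B S \<phi>" "\<phi> y1 = 0" "0 < \<phi> y2" "\<phi> y2 < 1"
    using chart_at_nonedge assms by metis
  interpret C: circle_chart V E B S \<phi> by fact
  obtain v1 where "v1 \<in> V" "2 + \<phi> y2 < \<phi> v1" "\<phi> v1 < 3" using C.pick[of "{2 + \<phi> y2}" "{3}"] \<phi>
    by auto
  moreover from this have "B v1 y1 y2" using V \<phi> by (auto simp: C.B_iff lies_between_def ahead_def)
  moreover obtain v2 where "v2 \<in> V" "0 < \<phi> v2" "\<phi> v2 < \<phi> y2" using C.pick[of "{0}" "{\<phi> y2}"] \<phi>
    by auto
  moreover from this have "B y1 v2 y2" using V \<phi> C.B_if_increasing by auto
  moreover obtain v3 where "v3 \<in> V" "\<phi> y2 < \<phi> v3" "\<phi> v3 < 1" using C.pick[of "{\<phi> y2}" "{1}"] \<phi>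
    by auto
  moreover from this have "B y1 y2 v3" using V \<phi> C.B_if_increasing by auto
  ultimately show ?thesis by blast
qed

lemma nbr_of_first_beyond_second:
  assumes V: "x1 \<in> V" "x2 \<in> V" "y1 \<in> V" "y2 \<in> V"
    and B: "B x1 y1 y2" "B x2 y1 y2" "B x1 x2 y1" "B x1 x2 y2"
  shows "\<exists>v\<in>V. E v x1 \<and> E v x2 \<and> B y1 y2 v"
proof -
  have "x1 \<noteq> x2" "\<not> E x1 x2"
    using B(3) V range[OF V(1)] range[OF V(2)]
    unfolding B_iff[OF V(1-3)] E_iff[OF V(1,2)] lies_between_def ahead_def far_def by auto
  then obtain \<phi> where \<phi>: "circle_chart V E B S \<phi>" "\<phi> x1 = 0" "0 < \<phi> x2" "\<phi> x2 < 1"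
    using chart_at_nonedge V by metis
  interpret C: circle_chart V E B S \<phi> by fact
  have "\<phi> x2 < \<phi> y1" "\<phi> y1 < 1" "\<phi> x2 < \<phi> y2" "\<phi> y2 < 1"
    using B(3,4) V \<phi>(2-) C.range[OF V(3)] C.range[OF V(4)]
    by (auto simp: C.B_iff lies_between_def ahead_def)
  moreover from this have "\<phi> y1 < \<phi> y2" using B(1) V \<phi>(2-)
    by (auto simp: C.B_iff lies_between_def ahead_def)
  moreover from calculation obtain v where "v \<in> V" "1 + \<phi> x2 < \<phi> v" "\<phi> v < 1 + \<phi> y1"
    using C.pick[of "{1 + \<phi> x2}" "{1 + \<phi> y1}"] \<phi>(2-) by auto
  ultimately show ?thesis using V \<phi>(2-) C.B_if_increasing[OF V(3,4)]
    by (intro bexI[of _ v]) (auto simp: C.E_iff far_def)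
qed

lemma common_nonnbr_of_edge:
  assumes V: "y \<in> V" "z \<in> V" and E: "E y z"
  shows "\<exists>v\<in>V. \<not> E v y \<and> \<not> E v z"
proof -
  obtain \<phi> where \<phi>: "circle_chart V E B S \<phi>" "\<phi> y = 0" using chart_at V by blast
  interpret C: circle_chart V E B S \<phi> by fact
  have z: "1 < \<phi> z" "\<phi> z < 2" using E V \<phi>(2) C.range[OF V(2)] by (auto simp: C.E_iff far_def)
  obtain v where "v \<in> V" "\<phi> z - 1 < \<phi> v" "\<phi> v < 1" using C.pick[of "{\<phi> z - 1}" "{1}"] z by auto
  then show ?thesis using V \<phi>(2) z by (intro bexI[of _ v]) (auto simp: C.E_iff far_def)
qed

lemma nonnbr_before_near_pair:
  assumes V: "y \<in> V" "z1 \<in> V" "z2 \<in> V" and E: "E y z2" "\<not> E z1 z2" "z1 \<noteq> z2"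
  shows "\<exists>v\<in>V. \<not> E v y \<and> \<not> E v z1 \<and> \<not> E v z2 \<and> B v z1 z2 \<and> S y v z1 z2"
proof -
  obtain \<phi> where \<phi>: "circle_chart V E B S \<phi>" "\<phi> z1 = 0" "0 < \<phi> z2" "\<phi> z2 < 1"
    using chart_at_nonedge V E by metis
  interpret C: circle_chart V E B S \<phi> by fact
  have y: "1 + \<phi> z2 < \<phi> y" "\<phi> y < 2 + \<phi> z2" using E V \<phi>(2-) C.range[OF V(1)]
    by (auto simp: C.E_iff far_def)
  obtain v where "v \<in> V" "2 + \<phi> z2 < \<phi> v" "\<phi> v < 3" "\<phi> v < \<phi> y + 1"
    using C.pick[of "{2 + \<phi> z2}" "{3, \<phi> y + 1}"] y \<phi>(2-) by auto
  then show ?thesis using V \<phi>(2-) y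
    by (intro bexI[of _ v]) (auto simp: C.E_iff far_def C.B_iff lies_between_def ahead_def C.S_iff
    separated_def ccw_order_def)
qed

lemma nonnbr_between_near_pairs:
  assumes V: "y1 \<in> V" "y2 \<in> V" "z1 \<in> V" "z2 \<in> V"
    and S: "S y1 y2 z1 z2" and E: "\<not> E y1 y2" "\<not> E z1 z2" "E y1 z2"
  shows "\<exists>v\<in>V. \<not> E y1 v \<and> \<not> E y2 v \<and> \<not> E z1 v \<and> \<not> E z2 v \<and>
          B y1 y2 v \<and> B v z1 z2 \<and> Sep S [y1, y2, v, z1, z2]"
proof -
  obtain \<phi> where \<phi>: "circle_chart V E B S \<phi>" "\<phi> y1 = 0" and
    o: "0 < \<phi> y2" "\<phi> y2 < \<phi> z1" "\<phi> z1 < \<phi> z2" "\<phi> z2 < 3"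
    using chart_at_S[OF V S] by metis
  interpret C: circle_chart V E B S \<phi> by fact
  have z2: "1 < \<phi> z2" "\<phi> z2 < 2" using C.near_iff(1)[of y1 z2] V E o \<phi>(2) by auto
  have y2: "\<phi> y2 < 1" using C.near_iff(2)[of y1 y2] V E o z2 \<phi>(2) by auto
  have z12: "\<phi> z2 - \<phi> z1 < 1" using C.near_iff(2)[of z1 z2] V E o z2 by auto
  obtain v where v: "v \<in> V" "\<phi> y2 < \<phi> v" "\<phi> z2 - 1 < \<phi> v" "\<phi> v < \<phi> z1" "\<phi> v < 1"
    using C.pick[of "{\<phi> y2, \<phi> z2 - 1}" "{\<phi> z1, 1}"] o y2 z2 z12 by auto
  have "B y1 y2 v" "B v z1 z2" by (intro C.B_if_increasing; use V v o \<phi>(2) in auto)+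
  moreover have "Sep S [y1, y2, v, z1, z2]" by (rule C.Sep_sorted) (use V v o \<phi>(2) in auto)
  moreover have "\<not> E y1 v" "\<not> E y2 v" "\<not> E z1 v" "\<not> E z2 v"
    using V v o \<phi>(2) y2 z2 by (auto simp: C.E_iff far_def)
  ultimately show ?thesis using v by blast
qed

lemma nbr_of_one_end:
  assumes V: "x \<in> V" "y \<in> V" and E: "E x y"
  shows "\<exists>v\<in>V. E v x \<and> \<not> E v y"
proof -
  obtain \<phi> where \<phi>: "circle_chart V E B S \<phi>" "\<phi> x = 0" using chart_at V by blast
  interpret C: circle_chart V E B S \<phi> by fact
  have y: "1 < \<phi> y" "\<phi> y < 2" using E V \<phi>(2) C.range[OF V(2)] by (auto simp: C.E_iff far_def)
  obtain v where "v \<in> V" "1 < \<phi> v" "\<phi> v < \<phi> y" using C.pick[of "{1}" "{\<phi> y}"] y by auto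
  then show ?thesis using V \<phi>(2) y by (intro bexI[of _ v]) (auto simp: C.E_iff far_def)
qed

lemma nbr_of_near_pair_not_of_third:
  assumes V: "x1 \<in> V" "x2 \<in> V" "y \<in> V" and E: "\<not> E x1 x2" "E x1 y" "x1 \<noteq> x2"
  shows "\<exists>v\<in>V. E v x1 \<and> E v x2 \<and> \<not> E v y \<and> S y v x1 x2"
proof -
  obtain \<phi> where \<phi>: "circle_chart V E B S \<phi>" "\<phi> x1 = 0" "0 < \<phi> x2" "\<phi> x2 < 1"
    using chart_at_nonedge V E by metis
  interpret C: circle_chart V E B S \<phi> by fact
  have y: "1 < \<phi> y" "\<phi> y < 2" using E V \<phi>(2-) C.range[OF V(3)] by (auto simp: C.E_iff far_def)
  obtain v where "v \<in> V" "\<phi> y < \<phi> v" "\<phi> x2 + 1 < \<phi> v" "\<phi> v < 2"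
    using C.pick[of "{\<phi> y, \<phi> x2 + 1}" "{2}"] y \<phi>(2-) by auto
  then show ?thesis using V \<phi>(2-) y
    by (intro bexI[of _ v]) (auto simp: C.E_iff far_def C.S_iff separated_def ccw_order_def)
qed

lemma nbr_beyond_near_pair:
  assumes V: "x \<in> V" "y1 \<in> V" "y2 \<in> V" and E: "E x y2" "\<not> E y1 y2" "y1 \<noteq> y2"
  shows "\<exists>v\<in>V. E v x \<and> B y1 y2 v"
proof -
  obtain \<phi> where \<phi>: "circle_chart V E B S \<phi>" "\<phi> y1 = 0" "0 < \<phi> y2" "\<phi> y2 < 1"
    using chart_at_nonedge V E by metis
  interpret C: circle_chart V E B S \<phi> by fact
  have x: "1 + \<phi> y2 < \<phi> x" "\<phi> x < 2 + \<phi> y2" using E V \<phi>(2-) C.range[OF V(1)]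
    by (auto simp: C.E_iff far_def)
  obtain v where "v \<in> V" "\<phi> y2 < \<phi> v" "\<phi> v < 1" "\<phi> v < \<phi> x - 1"
    using C.pick[of "{\<phi> y2}" "{1, \<phi> x - 1}"] x \<phi>(2-) by auto
  then show ?thesis using V \<phi>(2-) x
    by (intro bexI[of _ v]) (auto simp: C.E_iff far_def C.B_iff lies_between_def ahead_def)
qed

lemma nbr_of_near_pair_beyond_near_pair:
  assumes V: "x1 \<in> V" "x2 \<in> V" "y1 \<in> V" "y2 \<in> V"
    and E: "\<not> E x1 x2" "\<not> E y1 y2" "E x1 y2" and S: "S x1 x2 y1 y2"
  shows "\<exists>v\<in>V. E v x1 \<and> E v x2 \<and> \<not> E v y1 \<and> \<not> E v y2 \<and> B y1 y2 v \<and> Sep S [x1, x2, y1, y2, v]"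
proof -
  obtain \<phi> where \<phi>: "circle_chart V E B S \<phi>" "\<phi> x1 = 0" and
    o: "0 < \<phi> x2" "\<phi> x2 < \<phi> y1" "\<phi> y1 < \<phi> y2" "\<phi> y2 < 3"
    using chart_at_S[OF V S] by metis
  interpret C: circle_chart V E B S \<phi> by fact
  have y2: "1 < \<phi> y2" "\<phi> y2 < 2" using C.near_iff(1)[of x1 y2] V E o \<phi>(2) by auto
  have x2: "\<phi> x2 < 1" using C.near_iff(2)[of x1 x2] V E o y2 \<phi>(2) by auto
  have y12: "\<phi> y2 - \<phi> y1 < 1" using C.near_iff(2)[of y1 y2] V E o y2 by auto
  obtain v where v: "v \<in> V" "\<phi> y2 < \<phi> v" "\<phi> x2 + 1 < \<phi> v" "\<phi> v < 2" "\<phi> v < \<phi> y1 + 1"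
    using C.pick[of "{\<phi> y2, \<phi> x2 + 1}" "{2, \<phi> y1 + 1}"] o y2 x2 y12 by auto
  have "B y1 y2 v" by (intro C.B_if_increasing; use V v o \<phi>(2) in auto)
  moreover have "Sep S [x1, x2, y1, y2, v]" by (rule C.Sep_sorted) (use V v o \<phi>(2) in auto)
  moreover have "E v x1" "E v x2" "\<not> E v y1" "\<not> E v y2"
    using V v o \<phi>(2) y2 by (auto simp: C.E_iff far_def)
  ultimately show ?thesis using v by blast
qed

text \<open>The last six extension axioms ask for a vertex opposite to \<open>x\<close>, between \<open>y\<close> and \<open>z\<close> and
  near to both, where each of the three may be replaced by a near pair. The extreme bounds come
  from one point each of \<open>x\<close>, \<open>y\<close> and \<open>z\<close>, and they are compatible because three points without
  an edge lie on an arc shorter than a third of the circumference. The names list the kinds of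
  the three arguments.\<close>
lemma opposite_x_y_z:
  assumes V: "x \<in> V" "y \<in> V" "z \<in> V" and d: "distinct [x, y, z]" and e: "induces_edge E {x, y, z}"
  shows "\<exists>v\<in>V. E v x \<and> \<not> E v y \<and> \<not> E v z \<and> S x y v z"
proof -
  have *: "\<exists>v\<in>V. E v x \<and> \<not> E v y \<and> \<not> E v z \<and> S x y v z"
    if \<phi>: "circle_chart V E B S \<phi>" "\<phi> x = 0" and o: "0 < \<phi> y" "\<phi> y < \<phi> z" for \<phi>
  proof -
    interpret C: circle_chart V E B S \<phi> by fact
    have e': "far 0 (\<phi> y) \<or> far (\<phi> y) (\<phi> z) \<or> far 0 (\<phi> z)" using C.edge_in_triple_iff[OF V] e \<phi>(2)
      by simp
    have "\<phi> y < 2" "1 < \<phi> z" "\<phi> z - \<phi> y < 2"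
      using e' o C.range[OF V(3)] unfolding far_def by auto
    then obtain v where v: "v \<in> V" "\<phi> y < \<phi> v" "1 < \<phi> v" "\<phi> z - 1 < \<phi> v" "\<phi> v < \<phi> z" "\<phi> v < 2"
      "\<phi> v < \<phi> y + 1"
      using C.pick[of "{\<phi> y, 1, \<phi> z - 1}" "{\<phi> z, 2, \<phi> y + 1}"] o C.range[OF V(3)] by auto
    have "S x y v z" by (rule C.S_if_increasing) (use V v o \<phi>(2) in auto)
    moreover have "E v x" "\<not> E v y" "\<not> E v z" using V v o \<phi>(2) by (auto simp: C.E_iff far_def)
    ultimately show ?thesis using v by blast
  qed
  show ?thesis using chart_at_ordered[OF V d] * by metis
qed

lemma opposite_xx_y_z:
  assumes V: "x1 \<in> V" "x2 \<in> V" "y \<in> V" "z \<in> V" and S: "S x1 x2 y z" and E: "\<not> E x1 x2"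
    and e: "\<And>x. x \<in> {x1, x2} \<Longrightarrow> induces_edge E {x, y, z}"
  shows "\<exists>v\<in>V. E v x1 \<and> E v x2 \<and> \<not> E v y \<and> \<not> E v z \<and> Sep S [x1, x2, y, v, z]"
proof -
  obtain \<phi> where \<phi>: "circle_chart V E B S \<phi>" "\<phi> x1 = 0" and
    o: "0 < \<phi> x2" "\<phi> x2 < \<phi> y" "\<phi> y < \<phi> z" "\<phi> z < 3"
    using chart_at_S[OF V S] by metis
  interpret C: circle_chart V E B S \<phi> by fact
  have e': "far 0 (\<phi> y) \<or> far (\<phi> y) (\<phi> z) \<or> far 0 (\<phi> z)"
    "far (\<phi> x2) (\<phi> y) \<or> far (\<phi> y) (\<phi> z) \<or> far (\<phi> x2) (\<phi> z)"
    using C.edge_in_triple_iff[of _ y z] V e \<phi>(2) by force+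
  have c: "\<phi> y < 2" "1 < \<phi> z - \<phi> x2" "\<phi> z - \<phi> y < 2" using e' o unfolding far_def by auto
  have x2: "\<phi> x2 < 1" using C.near_iff(2)[of x1 x2] V E o c \<phi>(2) by auto
  obtain v where v: "v \<in> V" "\<phi> y < \<phi> v" "\<phi> x2 + 1 < \<phi> v" "\<phi> z - 1 < \<phi> v" "\<phi> v < \<phi> z" "\<phi> v < 2"
    "\<phi> v < \<phi> y + 1"
    using C.pick[of "{\<phi> y, \<phi> x2 + 1, \<phi> z - 1}" "{\<phi> z, 2, \<phi> y + 1}"] o c x2 by auto
  have "Sep S [x1, x2, y, v, z]" by (rule C.Sep_sorted) (use V v o \<phi>(2) in auto)
  moreover have "E v x1" "E v x2" "\<not> E v y" "\<not> E v z"
    using V v o \<phi>(2) by (auto simp: C.E_iff far_def)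
  ultimately show ?thesis using v by blast
qed

lemma opposite_x_yy_z:
  assumes V: "x \<in> V" "y1 \<in> V" "y2 \<in> V" "z \<in> V" and S: "S x y1 y2 z" and E: "\<not> E y1 y2"
    and e: "\<And>y. y \<in> {y1, y2} \<Longrightarrow> induces_edge E {x, y, z}"
  shows "\<exists>v\<in>V. E v x \<and> \<not> E v z \<and> B y1 y2 v \<and> Sep S [x, y1, y2, v, z]"
proof -
  obtain \<phi> where \<phi>: "circle_chart V E B S \<phi>" "\<phi> x = 0" and
    o: "0 < \<phi> y1" "\<phi> y1 < \<phi> y2" "\<phi> y2 < \<phi> z" "\<phi> z < 3"
    using chart_at_S[OF V S] by metis
  interpret C: circle_chart V E B S \<phi> by fact
  have e': "far 0 (\<phi> y1) \<or> far (\<phi> y1) (\<phi> z) \<or> far 0 (\<phi> z)"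
    "far 0 (\<phi> y2) \<or> far (\<phi> y2) (\<phi> z) \<or> far 0 (\<phi> z)"
    using C.edge_in_triple_iff[of x _ z] V e \<phi>(2) by force+
  have c: "\<phi> y2 < 2" "1 < \<phi> z" "\<phi> z - \<phi> y1 < 2" using e' o unfolding far_def by auto
  have y12: "\<phi> y2 - \<phi> y1 < 1" using C.near_iff(2)[of y1 y2] V E o c by auto
  obtain v where v: "v \<in> V" "\<phi> y2 < \<phi> v" "1 < \<phi> v" "\<phi> z - 1 < \<phi> v" "\<phi> v < \<phi> z" "\<phi> v < 2"
    "\<phi> v < \<phi> y1 + 1"
    using C.pick[of "{\<phi> y2, 1, \<phi> z - 1}" "{\<phi> z, 2, \<phi> y1 + 1}"] o c y12 by auto
  have "B y1 y2 v" by (intro C.B_if_increasing; use V v o \<phi>(2) in auto)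
  moreover have "Sep S [x, y1, y2, v, z]" by (rule C.Sep_sorted) (use V v o \<phi>(2) in auto)
  moreover have "E v x" "\<not> E v z" using V v o \<phi>(2) by (auto simp: C.E_iff far_def)
  ultimately show ?thesis using v by blast
qed

lemma opposite_xx_yy_z:
  assumes V': "{x1, x2, y1, y2, z} \<subseteq> V" and S: "Sep S [x1, x2, y1, y2, z]"
    and E: "\<not> E x1 x2" "\<not> E y1 y2"
    and e: "\<And>x y. x \<in> {x1, x2} \<Longrightarrow> y \<in> {y1, y2} \<Longrightarrow> induces_edge E {x, y, z}"
  shows "\<exists>v\<in>V. E v x1 \<and> E v x2 \<and> \<not> E v z \<and> B y1 y2 v \<and> Sep S [x1, x2, y1, y2, v, z]"
proof -
  have V: "x1 \<in> V" "x2 \<in> V" "y1 \<in> V" "y2 \<in> V" "z \<in> V" using V' by auto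
  obtain \<phi> where \<phi>: "circle_chart V E B S \<phi>" "\<phi> x1 = 0" and
    o: "0 < \<phi> x2" "\<phi> x2 < \<phi> y1" "\<phi> y1 < \<phi> y2" "\<phi> y2 < \<phi> z" "\<phi> z < 3"
    using chart_at_Sep5[OF V' S] by metis
  interpret C: circle_chart V E B S \<phi> by fact
  have e': "far 0 (\<phi> y1) \<or> far (\<phi> y1) (\<phi> z) \<or> far 0 (\<phi> z)"
    "far 0 (\<phi> y2) \<or> far (\<phi> y2) (\<phi> z) \<or> far 0 (\<phi> z)"
    "far (\<phi> x2) (\<phi> y1) \<or> far (\<phi> y1) (\<phi> z) \<or> far (\<phi> x2) (\<phi> z)"
    using C.edge_in_triple_iff[of _ _ z] V e \<phi>(2) by force+
  have c: "\<phi> y2 < 2" "1 < \<phi> z - \<phi> x2" "\<phi> z - \<phi> y1 < 2" using e' o unfolding far_def by auto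
  have x2: "\<phi> x2 < 1" using C.near_iff(2)[of x1 x2] V E o c \<phi>(2) by auto
  have y12: "\<phi> y2 - \<phi> y1 < 1" using C.near_iff(2)[of y1 y2] V E o c by auto
  obtain v where v: "v \<in> V" "\<phi> y2 < \<phi> v" "\<phi> x2 + 1 < \<phi> v" "\<phi> z - 1 < \<phi> v" "\<phi> v < \<phi> z" "\<phi> v < 2"
    "\<phi> v < \<phi> y1 + 1"
    using C.pick[of "{\<phi> y2, \<phi> x2 + 1, \<phi> z - 1}" "{\<phi> z, 2, \<phi> y1 + 1}"] o c x2 y12 by auto
  have "B y1 y2 v" by (intro C.B_if_increasing; use V v o \<phi>(2) in auto)
  moreover have "Sep S [x1, x2, y1, y2, v, z]" by (rule C.Sep_sorted) (use V v o \<phi>(2) in auto)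
  moreover have "E v x1" "E v x2" "\<not> E v z" using V v o \<phi>(2) by (auto simp: C.E_iff far_def)
  ultimately show ?thesis using v by blast
qed

lemma opposite_x_yy_zz:
  assumes V': "{x, y1, y2, z1, z2} \<subseteq> V" and S: "Sep S [x, y1, y2, z1, z2]"
    and E: "\<not> E y1 y2" "\<not> E z1 z2"
    and e: "\<And>y z. y \<in> {y1, y2} \<Longrightarrow> z \<in> {z1, z2} \<Longrightarrow> induces_edge E {x, y, z}"
  shows "\<exists>v\<in>V. E v x \<and> B y1 y2 v \<and> B v z1 z2 \<and> Sep S [x, y1, y2, v, z1, z2]"
proof -
  have V: "x \<in> V" "y1 \<in> V" "y2 \<in> V" "z1 \<in> V" "z2 \<in> V" using V' by auto
  obtain \<phi> where \<phi>: "circle_chart V E B S \<phi>" "\<phi> x = 0" and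
    o: "0 < \<phi> y1" "\<phi> y1 < \<phi> y2" "\<phi> y2 < \<phi> z1" "\<phi> z1 < \<phi> z2" "\<phi> z2 < 3"
    using chart_at_Sep5[OF V' S] by metis
  interpret C: circle_chart V E B S \<phi> by fact
  have e': "far 0 (\<phi> y1) \<or> far (\<phi> y1) (\<phi> z1) \<or> far 0 (\<phi> z1)"
    "far 0 (\<phi> y2) \<or> far (\<phi> y2) (\<phi> z1) \<or> far 0 (\<phi> z1)"
    "far 0 (\<phi> y1) \<or> far (\<phi> y1) (\<phi> z2) \<or> far 0 (\<phi> z2)"
    using C.edge_in_triple_iff[of x] V e \<phi>(2) by force+
  have c: "\<phi> y2 < 2" "1 < \<phi> z1" "\<phi> z2 - \<phi> y1 < 2" using e' o unfolding far_def by auto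
  have y12: "\<phi> y2 - \<phi> y1 < 1" using C.near_iff(2)[of y1 y2] V E o c by auto
  have z12: "\<phi> z2 - \<phi> z1 < 1" using C.near_iff(2)[of z1 z2] V E o c by auto
  obtain v where v: "v \<in> V" "\<phi> y2 < \<phi> v" "1 < \<phi> v" "\<phi> z2 - 1 < \<phi> v" "\<phi> v < \<phi> z1" "\<phi> v < 2"
    "\<phi> v < \<phi> y1 + 1"
    using C.pick[of "{\<phi> y2, 1, \<phi> z2 - 1}" "{\<phi> z1, 2, \<phi> y1 + 1}"] o c y12 z12 by auto
  have "B y1 y2 v" "B v z1 z2" by (intro C.B_if_increasing; use V v o \<phi>(2) in auto)+
  moreover have "Sep S [x, y1, y2, v, z1, z2]" by (rule C.Sep_sorted) (use V v o \<phi>(2) in auto)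
  moreover have "E v x" using V v o \<phi>(2) by (auto simp: C.E_iff far_def)
  ultimately show ?thesis using v by blast
qed

lemma opposite_xx_yy_zz:
  assumes V': "{x1, x2, y1, y2, z1, z2} \<subseteq> V" and S: "Sep S [x1, x2, y1, y2, z1, z2]"
    and E: "\<not> E x1 x2" "\<not> E y1 y2" "\<not> E z1 z2"
    and e: "\<And>x y z. x \<in> {x1, x2} \<Longrightarrow> y \<in> {y1, y2} \<Longrightarrow> z \<in> {z1, z2} \<Longrightarrow> induces_edge E {x, y, z}"
  shows "\<exists>v\<in>V. E v x1 \<and> E v x2 \<and> B y1 y2 v \<and> B v z1 z2 \<and> Sep S [x1, x2, y1, y2, v, z1, z2]"
proof -
  have V: "x1 \<in> V" "x2 \<in> V" "y1 \<in> V" "y2 \<in> V" "z1 \<in> V" "z2 \<in> V" using V' by auto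
  obtain \<phi> where \<phi>: "circle_chart V E B S \<phi>" "\<phi> x1 = 0" and
    o: "0 < \<phi> x2" "\<phi> x2 < \<phi> y1" "\<phi> y1 < \<phi> y2" "\<phi> y2 < \<phi> z1" "\<phi> z1 < \<phi> z2" "\<phi> z2 < 3"
    using chart_at_Sep6[OF V' S] by metis
  interpret C: circle_chart V E B S \<phi> by fact
  have e': "far 0 (\<phi> y2) \<or> far (\<phi> y2) (\<phi> z1) \<or> far 0 (\<phi> z1)"
    "far 0 (\<phi> y1) \<or> far (\<phi> y1) (\<phi> z2) \<or> far 0 (\<phi> z2)"
    "far (\<phi> x2) (\<phi> y1) \<or> far (\<phi> y1) (\<phi> z1) \<or> far (\<phi> x2) (\<phi> z1)"
    using C.edge_in_triple_iff V e \<phi>(2) by force+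
  have c: "\<phi> y2 < 2" "1 < \<phi> z1 - \<phi> x2" "\<phi> z2 - \<phi> y1 < 2" using e' o unfolding far_def by auto
  have x2: "\<phi> x2 < 1" using C.near_iff(2)[of x1 x2] V E o c \<phi>(2) by auto
  have y12: "\<phi> y2 - \<phi> y1 < 1" using C.near_iff(2)[of y1 y2] V E o c by auto
  have z12: "\<phi> z2 - \<phi> z1 < 1" using C.near_iff(2)[of z1 z2] V E o c by auto
  obtain v where v: "v \<in> V" "\<phi> y2 < \<phi> v" "\<phi> x2 + 1 < \<phi> v" "\<phi> z2 - 1 < \<phi> v" "\<phi> v < \<phi> z1" "\<phi> v < 2"
    "\<phi> v < \<phi> y1 + 1"
    using C.pick[of "{\<phi> y2, \<phi> x2 + 1, \<phi> z2 - 1}" "{\<phi> z1, 2, \<phi> y1 + 1}"] o c x2 y12 z12 by auto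
  have "B y1 y2 v" "B v z1 z2" by (intro C.B_if_increasing; use V v o \<phi>(2) in auto)+
  moreover have "Sep S [x1, x2, y1, y2, v, z1, z2]" by (rule C.Sep_sorted) (use V v o \<phi>(2) in auto)
  moreover have "E v x1" "E v x2" using V v o \<phi>(2) by (auto simp: C.E_iff far_def)
  ultimately show ?thesis using v by blast
qed

lemma extension_axioms: "extension_axioms V E B S"
  by (rule extension_axioms.intro;
      (rule common_nbr_and_nonnbr near_pair_extends nbr_of_first_beyond_second common_nonnbr_of_edge
      nonnbr_before_near_pair nonnbr_between_near_pairs nbr_of_one_end nbr_of_near_pair_not_of_third
      nbr_beyond_near_pair nbr_of_near_pair_beyond_near_pair opposite_x_y_z opposite_xx_y_z
      opposite_x_yy_z opposite_xx_yy_z opposite_x_yy_zz opposite_xx_yy_zz)?)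
    (use dense[of 0 3] in auto)

end

section \<open>The irrationality of \<open>pi\<close>\<close>

lemma poly_higher_pderiv_0: "poly ((pderiv ^^ j) p) 0 = fact j * coeff p j"
  for p :: "real poly"
  by (simp add: poly_0_coeff_0 coeff_higher_pderiv pochhammer_fact)

text \<open>This is Niven's proof. For a polynomial \<open>f\<close>, the alternating sum \<open>F\<close> of its even
  derivatives satisfies \<open>F + F'' = f\<close>, so \<open>F' sin - F cos\<close> is an antiderivative of \<open>f sin\<close>.\<close>
definition alternating_sum :: "nat \<Rightarrow> real poly \<Rightarrow> real poly" where
  "alternating_sum n p = (\<Sum>k\<le>n. smult ((-1) ^ k) ((pderiv ^^ (2 * k)) p))"

lemma alternating_sum_ode:
  assumes "degree p < 2 * n + 2"
  shows "alternating_sum n p + pderiv (pderiv (alternating_sum n p)) = p"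
proof -
  have "alternating_sum m p + pderiv (pderiv (alternating_sum m p)) =
      p + smult ((-1) ^ m) ((pderiv ^^ (2 * m + 2)) p)" for m
  proof (induction m)
    case (Suc m)
    define X where "X = smult ((-1) ^ m) ((pderiv ^^ (2 * m + 2)) p)"
    have step: "alternating_sum (Suc m) p = alternating_sum m p - X"
      unfolding alternating_sum_def X_def by simp
    have rest: "smult ((-1) ^ Suc m) ((pderiv ^^ (2 * Suc m + 2)) p) = - pderiv (pderiv X)"
      unfolding X_def by (simp add: pderiv_smult)
    have "alternating_sum m p + pderiv (pderiv (alternating_sum m p)) = p + X"
      using Suc unfolding X_def .
    then show ?case unfolding step rest by (simp add: pderiv_diff algebra_simps)
  qed (simp add: alternating_sum_def pderiv_smult)
  moreover have "(pderiv ^^ (2 * n + 2)) p = 0"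
  proof (rule poly_eqI)
    show "coeff ((pderiv ^^ (2 * n + 2)) p) k = coeff 0 k" for k
      using assms by (simp add: coeff_higher_pderiv coeff_eq_0 del: funpow.simps)
  qed
  ultimately show ?thesis by simp
qed

lemma even_pderiv_reflect:
  "((pderiv ^^ (2 * k)) p) \<circ>\<^sub>p [:c, -1:]
  = (pderiv ^^ (2 * k)) (p \<circ>\<^sub>p [:c, -1:])" for p :: "real poly"
proof (induction k)
  case (Suc k)
  have "pderiv (pderiv (q \<circ>\<^sub>p [:c, -1:])) = pderiv (pderiv q) \<circ>\<^sub>p [:c, -1:]" for q :: "real poly"
    by (simp add: pderiv_pcompose pderiv_pCons pderiv_mult pderiv_minus)
  then show ?case by (simp flip: Suc)
qed simp

lemma coeff_mult_Ints:
  "(\<And>i. coeff p i \<in> \<int>) \<Longrightarrow> (\<And>i. coeff q i \<in> \<int>) \<Longrightarrow> coeff (p * q) i \<in> \<int>"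
  for p q :: "real poly"
  unfolding coeff_mult by (intro Ints_sum Ints_mult)

lemma coeff_power_Ints: "(\<And>i. coeff p i \<in> \<int>) \<Longrightarrow> coeff (p ^ n) i \<in> \<int>" for p :: "real poly"
proof (induction n arbitrary: i)
  case 0 then show ?case by (cases i) auto
next
  case (Suc n) then show ?case by (simp add: coeff_mult_Ints)
qed

text \<open>If \<open>pi = a / b\<close>, take \<open>f = x^n (a - b x)^n\<close>, which is positive between 0 and \<open>pi\<close> and
  invariant under \<open>x \<mapsto> pi - x\<close>. The integral of \<open>f sin\<close> from 0 to \<open>pi\<close> is \<open>2 F 0\<close>, a multiple of
  \<open>n!\<close>. It is positive, yet at most \<open>pi (pi a)^n\<close>, which is less than \<open>n!\<close> for large \<open>n\<close>. The
  mean value theorem takes the place of the integral.\<close>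
lemma pi_irrational: "pi \<notin> \<rat>"
proof
  assume "pi \<in> \<rat>"
  then obtain a b :: int where ab: "b > 0" "pi = of_int a / of_int b" by (auto elim: Rats_cases')
  have a: "of_int a > (0::real)" using pi_gt_zero ab(1) unfolding ab(2)
    by (simp add: zero_less_divide_iff)
  have "(\<lambda>n. (pi * of_int a) ^ n / fact n) \<longlonglongrightarrow> 0"
    using summable_LIMSEQ_zero[OF summable_exp[of "pi * of_int a"]] by (simp add: field_simps)
  then have "\<forall>\<^sub>F n in sequentially. (pi * of_int a) ^ n / fact n < 1 / pi"
    by (rule order_tendstoD) simp
  then obtain n where "(pi * of_int a) ^ n / fact n < 1 / pi"
    using eventually_happens'[OF sequentially_bot] by blast
  then have "pi * ((pi * of_int a) ^ n / fact n) < pi * (1 / pi)"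
    by (intro mult_strict_left_mono) auto
  then have n: "pi * (pi * of_int a) ^ n < fact n" by (simp add: divide_less_eq)
  define f :: "real poly" where "f = monom 1 n * [:of_int a, - of_int b:] ^ n"
  define F where "F = alternating_sum n f"
  define G where "G x = poly (pderiv F) x * sin x - poly F x * cos x" for x
  have f_eq: "poly f x = x ^ n * (of_int a - of_int b * x) ^ n" for x
    unfolding f_def by (simp add: poly_monom algebra_simps)
  have "degree ([:of_int a, - of_int b:] ^ n :: real poly) \<le> n"
    using degree_power_le[of "[:of_int a, - of_int b:] :: real poly" n] by (simp split: if_splits)
  then have "degree f \<le> 2 * n"
    unfolding f_def using degree_mult_le[of "monom 1 n :: real poly"
    "[:of_int a, - of_int b:] ^ n"] degree_monom_le[of "1::real" n] by linarith
  then have ode: "F + pderiv (pderiv F) = f" unfolding F_def by (intro alternating_sum_ode) simp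
  have "(G has_real_derivative poly f x * sin x) (at x)" for x
  proof -
    have "poly f x = poly F x + poly (pderiv (pderiv F)) x" by (simp flip: ode)
    then show ?thesis unfolding G_def by (auto intro!: derivative_eq_intros simp: algebra_simps)
  qed
  then obtain \<xi> where \<xi>: "0 < \<xi>" "\<xi> < pi" "G pi - G 0 = pi * (poly f \<xi> * sin \<xi>)"
    using MVT2[of 0 pi G "\<lambda>x. poly f x * sin x"] by auto
  have "f \<circ>\<^sub>p [:pi, -1:] = f"
  proof (rule iffD1[OF poly_eq_poly_eq_iff])
    show "poly (f \<circ>\<^sub>p [:pi, -1:]) = poly f"
    proof
      fix x
      have "of_int b * (pi - x) = of_int a - of_int b * x"
        "of_int a - of_int b * (pi - x) = of_int b * x"
        using ab by (auto simp: field_simps)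
      then have "of_int b ^ n * poly (f \<circ>\<^sub>p [:pi, -1:]) x = of_int b ^ n * poly f x"
        by (simp add: poly_pcompose f_eq flip: power_mult_distrib) (simp add: algebra_simps)
      then show "poly (f \<circ>\<^sub>p [:pi, -1:]) x = poly f x" using ab(1) by simp
    qed
  qed
  then have "F \<circ>\<^sub>p [:pi, -1:] = F"
    unfolding F_def alternating_sum_def
    by (simp add: pcompose_sum pcompose_smult even_pderiv_reflect)
  then have "poly F pi = poly F 0"
    by (metis poly_pcompose poly_pCons poly_0 mult_zero_left add.right_neutral)
  then have G: "G pi - G 0 = 2 * poly F 0" unfolding G_def by simp
  have "poly F 0 / fact n \<in> \<int>"
  proof -
    have "coeff ([:of_int a, - of_int b:] :: real poly) i \<in> \<int>" for i
      by (auto simp: coeff_pCons split: nat.split)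
    then have coeff: "coeff f j \<in> \<int>" "j < n \<Longrightarrow> coeff f j = 0" for j
      unfolding f_def by (auto simp: coeff_monom_mult coeff_power_Ints)
    have "fact j * coeff f j / fact n \<in> \<int>" for j
    proof (cases "j < n")
      case False
      then have "fact n dvd (fact j :: nat)" by (simp add: fact_dvd)
      then obtain m where "fact j = (fact n * m :: nat)" by blast
      then have "(fact j :: real) = fact n * of_nat m" by (metis of_nat_fact of_nat_mult)
      then show ?thesis using coeff(1) by simp
    qed (simp add: coeff(2))
    then have "(\<Sum>k\<le>n. (-1) ^ k * (fact (2 * k) * coeff f (2 * k) / fact n)) \<in> \<int>"
      by (intro Ints_sum Ints_mult) auto
    also have "(\<Sum>k\<le>n. (-1) ^ k * (fact (2 * k) * coeff f (2 * k) / fact n)) = poly F 0 / fact n"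
      unfolding F_def alternating_sum_def
      by (simp add: poly_sum poly_higher_pderiv_0 sum_divide_distrib)
    finally show ?thesis .
  qed
  then obtain N :: int where "poly F 0 / fact n = of_int N" by (auto elim: Ints_cases)
  then have N: "pi * (poly f \<xi> * sin \<xi>) = 2 * of_int N * fact n" using \<xi>(3) G
    by (simp add: field_simps)
  have "of_int b * \<xi> < of_int b * pi" using \<xi>(2) ab(1) by (intro mult_strict_left_mono) auto
  moreover have "of_int b * pi = of_int a" using ab(1) unfolding ab(2) by simp
  ultimately have b\<xi>: "0 < of_int a - of_int b * \<xi>" by linarith
  have "0 < sin \<xi>" using sin_gt_zero \<xi> by blast
  have f_pos: "0 < poly f \<xi>" using b\<xi> \<xi>(1) unfolding f_eq by simp
  have "0 < 2 * of_int N * (fact n :: real)" using f_pos \<open>0 < sin \<xi>\<close> unfolding N[symmetric] by simp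
  then have "0 < N" by (simp add: zero_less_mult_iff)
  have "\<xi> * (of_int a - of_int b * \<xi>) \<le> pi * of_int a"
    using \<xi> ab(1) b\<xi> a by (intro mult_mono) auto
  then have "poly f \<xi> \<le> (pi * of_int a) ^ n"
    unfolding f_eq power_mult_distrib[symmetric] using \<xi>(1) b\<xi> by (intro power_mono) auto
  moreover have "poly f \<xi> * sin \<xi> \<le> poly f \<xi> * 1" using f_pos by (intro mult_left_mono) auto
  ultimately have "pi * (poly f \<xi> * sin \<xi>) \<le> pi * (pi * of_int a) ^ n"
    by (intro mult_left_mono) auto
  then have "2 * of_int N * fact n < (fact n :: real)" using n N by linarith
  then have "2 * of_int N < (1::real)"
    using mult_less_cancel_right_pos[of "fact n :: real" "2 * of_int N" 1] by simp
  then show False using \<open>0 < N\<close> by linarith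
qed

section \<open>A chart of the unit circle\<close>

lemma cis_Arg2pi: "norm z = 1 \<Longrightarrow> cis (Arg2pi z) = z"
  by (metis cis_conv_exp complex_norm_eq_1_exp)

lemma Arg2pi_cis: "0 \<le> t \<Longrightarrow> t < 2 * pi \<Longrightarrow> Arg2pi (cis t) = t"
  by (rule Arg2pi_unique[of 1]) (auto simp: cis_conv_exp)

lemma ccw_length_range: "0 \<le> ccw_length x y" "ccw_length x y < 2 * pi"
  unfolding ccw_length_def using Arg2pi_ge_0 Arg2pi_lt_2pi by auto

lemma rotate_ccw_length: "norm x = 1 \<Longrightarrow> norm y = 1 \<Longrightarrow> x * cis (ccw_length x y) = y"
  unfolding ccw_length_def using cis_Arg2pi[of "y / x"] by (auto simp: norm_divide)

lemma ccw_length_rotate: "norm x = 1 \<Longrightarrow> 0 \<le> t \<Longrightarrow> t < 2 * pi \<Longrightarrow> ccw_length x (x * cis t) = t"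
proof -
  assume "norm x = 1" and t: "0 \<le> t" "t < 2 * pi"
  then have "x * cis t / x = cis t" by auto
  then show ?thesis unfolding ccw_length_def using Arg2pi_cis[OF t] by simp
qed

lemma ccw_length_self: "norm x = 1 \<Longrightarrow> ccw_length x x = 0"
  using ccw_length_rotate[of x 0] by simp

lemma ccw_length_inj: "norm x = 1 \<Longrightarrow> norm y = 1 \<Longrightarrow> norm z = 1 \<Longrightarrow> ccw_length x y = ccw_length x z \<Longrightarrow>
  y = z"
  using rotate_ccw_length by metis

lemma mem_ccw_arc:
  assumes "norm x = 1" "norm y = 1"
  shows "y \<in> ccw_arc x z \<longleftrightarrow> ccw_length x y \<le> ccw_length x z"
proof
  assume "y \<in> ccw_arc x z"
  then obtain t where t: "0 \<le> t" "t \<le> ccw_length x z" "y = x * cis t" unfolding ccw_arc_def by auto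
  then have "t < 2 * pi" using ccw_length_range(2)[of x z] by linarith
  then have "ccw_length x y = t" using ccw_length_rotate[OF assms(1), of t] t by simp
  then show "ccw_length x y \<le> ccw_length x z" using t by simp
next
  assume "ccw_length x y \<le> ccw_length x z"
  then show "y \<in> ccw_arc x z"
    unfolding ccw_arc_def using rotate_ccw_length[OF assms] ccw_length_range(1)[of x y]
    by (intro image_eqI[of _ _ "ccw_length x y"]) auto
qed

text \<open>Lengths of arcs from \<open>x\<close> are differences of lengths of arcs from a fixed base point \<open>b\<close>.\<close>
lemma ccw_length_base:
  assumes "norm b = 1" "norm x = 1" "norm y = 1"
  shows "ccw_length x y = (if ccw_length b x \<le> ccw_length b y then ccw_length b y - ccw_length b x
    else ccw_length b y - ccw_length b x + 2 * pi)" (is "_ = ?t")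
proof -
  have "x * cis ?t = b * cis (ccw_length b x) * cis ?t" using rotate_ccw_length[OF assms(1,2)]
    by simp
  also have "\<dots> = b * cis (ccw_length b y)"
  proof -
    have "cis (t + 2 * pi) = cis t" for t by (simp flip: cis_mult)
    then have "cis (ccw_length b x) * cis ?t = cis (ccw_length b y)" by (simp add: cis_mult)
    then show ?thesis by (simp only: mult.assoc)
  qed
  also have "\<dots> = y" using rotate_ccw_length[OF assms(1,3)] .
  finally have "x * cis ?t = y" .
  moreover have "0 \<le> ?t" "?t < 2 * pi"
    using ccw_length_range[of b x] ccw_length_range[of b y] by auto
  ultimately show ?thesis using ccw_length_rotate[OF assms(2)] by metis
qed

text \<open>The angle from \<open>x1\<close> is continuous on the circle without \<open>x1\<close>, so on a connected set that
  avoids \<open>x3\<close> it cannot pass the angle of \<open>x3\<close>. Conversely, the arc between two points on the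
  same side of \<open>x3\<close> is connected.\<close>
lemma connected_component_circle_iff:
  assumes "norm x1 = 1" "norm x2 = 1" "norm x3 = 1" "norm x4 = 1" and d: "distinct [x1, x2, x3, x4]"
  shows "connected_component (sphere 0 1 - {x1, x3}) x2 x4 \<longleftrightarrow>
    (ccw_length x1 x2 < ccw_length x1 x3 \<longleftrightarrow> ccw_length x1 x4 < ccw_length x1 x3)"
proof -
  let ?g = "ccw_length x1"
  have g_neq: "?g x2 \<noteq> ?g x3" "?g x4 \<noteq> ?g x3" using ccw_length_inj assms
    by (metis distinct_length_2_or_more)+
  have g_pos: "0 < ?g z" if "norm z = 1" "z \<noteq> x1" for z
    using ccw_length_inj[of x1 z x1] ccw_length_self that assms(1) ccw_length_range(1)[of x1 z]
    by force
  show ?thesis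
  proof
    assume "connected_component (sphere 0 1 - {x1, x3}) x2 x4"
    then obtain T where T: "connected T" "T \<subseteq> sphere 0 1 - {x1, x3}" "x2 \<in> T" "x4 \<in> T"
      unfolding connected_component_def by blast
    have "isCont ?g z" if "z \<in> T" for z
    proof -
      have z: "norm z = 1" "z \<noteq> x1" using T(2) that by auto
      have "Arg2pi (z / x1) \<noteq> 0" using g_pos[OF z] unfolding ccw_length_def by simp
      then have "z / x1 \<notin> \<real>\<^sub>\<ge>\<^sub>0"
        by (auto simp: Arg2pi_eq_0 complex_nonneg_Reals_iff complex_is_Real_iff)
      then have "isCont Arg2pi (z / x1)" by (rule continuous_at_Arg2pi)
      moreover have "isCont (\<lambda>z. z / x1) z" using assms(1) by (intro continuous_intros) auto
      ultimately show ?thesis unfolding ccw_length_def by (rule isCont_o2[rotated])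
    qed
    then have "connected (?g ` T)"
      using T(1) continuous_at_imp_continuous_on connected_continuous_image by blast
    moreover have "?g x3 \<notin> ?g ` T"
      using ccw_length_inj[OF assms(1) _ assms(3)] T(2) by force
    ultimately show "?g x2 < ?g x3 \<longleftrightarrow> ?g x4 < ?g x3"
      using connectedD_interval[of "?g ` T" "?g x2" "?g x4" "?g x3"] connectedD_interval[of "?g ` T"
      "?g x4" "?g x2" "?g x3"]
        T(3,4) g_neq by force
  next
    assume side: "?g x2 < ?g x3 \<longleftrightarrow> ?g x4 < ?g x3"
    let ?I = "{min (?g x2) (?g x4)..max (?g x2) (?g x4)}"
    let ?T = "(\<lambda>t. x1 * cis t) ` ?I"
    have I: "0 < t" "t < 2 * pi" "t \<noteq> ?g x3" if "t \<in> ?I" for t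
      using that side g_neq g_pos[of x2] g_pos[of x4] assms ccw_length_range(2)[of x1 x2]
      ccw_length_range(2)[of x1 x4]
      by (auto simp: min_def max_def split: if_splits)
    have "connected ?T" by (intro connected_continuous_image continuous_intros) simp
    moreover have "?T \<subseteq> sphere 0 1 - {x1, x3}"
    proof (rule image_subsetI)
      fix t assume t: "t \<in> ?I"
      have "?g (x1 * cis t) = t" using ccw_length_rotate[OF assms(1)] I[OF t] by simp
      then have "x1 * cis t \<noteq> x1" "x1 * cis t \<noteq> x3" using I[OF t] ccw_length_self[OF assms(1)]
        by auto
      then show "x1 * cis t \<in> sphere 0 1 - {x1, x3}" using assms(1) by (simp add: norm_mult)
    qed
    moreover have "x2 \<in> ?T" using rotate_ccw_length[of x1 x2] assms
      by (intro image_eqI[of _ _ "?g x2"]) auto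
    moreover have "x4 \<in> ?T" using rotate_ccw_length[of x1 x4] assms
      by (intro image_eqI[of _ _ "?g x4"]) auto
    ultimately show "connected_component (sphere 0 1 - {x1, x3}) x2 x4"
      unfolding connected_component_def by blast
  qed
qed

text \<open>The length of the counterclockwise arc from \<open>s\<close> to \<open>t\<close>.\<close>
definition forward :: "real \<Rightarrow> real \<Rightarrow> real" where
  "forward s t = (if s \<le> t then t - s else t - s + 3)"

lemma not_far_self: "\<not> far s s"
  unfolding far_def by simp

lemma far_iff_forward: "on_circle s \<Longrightarrow> on_circle t \<Longrightarrow> far s t \<longleftrightarrow> 1 < forward s t \<and> 1 < forward t s"
  unfolding far_def forward_def by auto

lemma ccw_order_iff_forward: "on_circle s \<Longrightarrow> on_circle t \<Longrightarrow> on_circle u \<Longrightarrow> s \<noteq> t \<Longrightarrow> s \<noteq> u \<Longrightarrow> t \<noteq> u \<Longrightarrow>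
  ccw_order s t u \<longleftrightarrow> forward s t < forward s u"
  unfolding ccw_order_def forward_def by auto

lemma forward_swap: "s \<noteq> t \<Longrightarrow> forward t s = 3 - forward s t"
  unfolding forward_def by auto

lemma ahead_iff_forward: "on_circle s \<Longrightarrow> on_circle t \<Longrightarrow> s \<noteq> t \<Longrightarrow> ahead s t \<longleftrightarrow> forward s t < 1"
  unfolding ahead_def forward_def by auto

lemma forward_cycle: "forward s t + forward t u + forward u s \<in> {0, 3, 6}"
  unfolding forward_def by auto

lemma forward_gap: "off_thirds s t \<Longrightarrow> forward s t \<noteq> 1 \<and> forward s t \<noteq> 2"
  unfolding forward_def by (cases "s \<le> t") (simp; linarith)+

text \<open>The three successive arcs \<open>p\<close>, \<open>q\<close>, \<open>r\<close> add up to one or two turns of the circle,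
  according to whether \<open>s\<close>, \<open>t\<close>, \<open>u\<close> are met counterclockwise or clockwise. Either way the claim
  is a linear statement about \<open>p\<close>, \<open>q\<close>, \<open>r\<close>.\<close>
lemma lies_between_iff_forward:
  assumes rng: "on_circle s" "on_circle t" "on_circle u" and d: "s \<noteq> t" "s \<noteq> u"
      "t \<noteq> u" and gap: "off_thirds s t" "off_thirds t u" "off_thirds s u"
  shows "lies_between s t u \<longleftrightarrow> \<not> far s t \<and> \<not> far t u \<and> \<not> far s u \<and>
    (forward s u < forward u s \<and> forward s t \<le> forward s u \<or>
     forward u s < forward s u \<and> forward u t \<le> forward u s)"
proof -
  define p q r where "p = forward s t" and "q = forward t u" and "r = forward u s"
  have rev: "forward t s = 3 - p" "forward u t = 3 - q" "forward s u = 3 - r"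
    unfolding p_def q_def r_def
    using d forward_swap[of s t] forward_swap[of t u] forward_swap[of u s] by simp_all
  have pos: "0 < p" "p < 3" "0 < q" "q < 3" "0 < r" "r < 3"
    unfolding p_def q_def r_def forward_def using rng d by auto
  have sum: "p + q + r = 3 \<or> p + q + r = 6"
    using forward_cycle[of s t u] pos unfolding p_def q_def r_def by auto
  have ne: "p \<noteq> 1" "p \<noteq> 2" "q \<noteq> 1" "q \<noteq> 2" "r \<noteq> 1" "r \<noteq> 2"
    unfolding p_def q_def r_def
    using gap forward_gap[of s t] forward_gap[of t u] forward_gap[of u s] by blast+
  have lies_between: "lies_between s t u \<longleftrightarrow>
    p < 1 \<and> q < 1 \<and> 3 - r < 1 \<or> 3 - q < 1 \<and> 3 - p < 1 \<and> r < 1"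
    unfolding lies_between_def using ahead_iff_forward rng d rev by (simp add: p_def q_def r_def)
  have far: "far s t \<longleftrightarrow> 1 < p \<and> p < 2" "far t u \<longleftrightarrow> 1 < q \<and> q < 2" "far s u \<longleftrightarrow> 1 < r \<and> r < 2"
    using far_iff_forward rng rev by (auto simp: p_def q_def r_def)
  show ?thesis
    unfolding lies_between far rev p_def[symmetric] r_def[symmetric] using sum pos ne
    by (smt (verit))
qed

lemma separated_iff_ccw_order:
  assumes "a \<noteq> b" "a \<noteq> c" "a \<noteq> d" "b \<noteq> c" "c \<noteq> d"
  shows "separated a b c d \<longleftrightarrow> ccw_order a b c \<noteq> ccw_order a d c"
  using assms unfolding separated_def ccw_order_def by (smt (verit))

definition coordinate :: "complex \<Rightarrow> complex \<Rightarrow> real" where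
  "coordinate b z = 3 / (2 * pi) * ccw_length b z"

lemma ccw_length_coordinate:
  assumes "norm b = 1" "norm x = 1" "norm y = 1"
  shows "ccw_length x y = 2 * pi / 3 * forward (coordinate b x) (coordinate b y)"
proof -
  have "coordinate b x \<le> coordinate b y \<longleftrightarrow> ccw_length b x \<le> ccw_length b y"
    unfolding coordinate_def using pi_gt_zero by (simp add: divide_le_cancel)
  then show ?thesis unfolding ccw_length_base[OF assms] forward_def coordinate_def
    by (simp add: field_simps)
qed

lemma coordinate_range: "0 \<le> coordinate b z \<and> coordinate b z < 3"
  unfolding coordinate_def using ccw_length_range[of b z] by (simp add: field_simps)

lemma coordinate_inj: "norm b = 1 \<Longrightarrow> norm x = 1 \<Longrightarrow> norm y = 1 \<Longrightarrow> coordinate b x = coordinate b y \<Longrightarrow>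
  x = y"
  unfolding coordinate_def using ccw_length_inj[of b x y] by simp

text \<open>A difference of 1 or 2 would make the rational angle \<open>q\<close> a rational non-zero multiple of
  \<open>pi\<close>.\<close>
lemma coordinate_gap:
  assumes "norm b = 1" "norm x = 1" "y = x * cis q" "q \<in> \<rat>"
  shows "coordinate b y - coordinate b x \<noteq> 1 \<and> coordinate b y - coordinate b x \<noteq> 2"
proof -
  have y: "norm y = 1" using assms by (simp add: norm_mult)
  have no: False if m: "coordinate b y - coordinate b x = of_int m" "\<not> 3 dvd m" for m
  proof -
    have "ccw_length b y - ccw_length b x = 2 * pi / 3 * (coordinate b y - coordinate b x)"
      unfolding coordinate_def by (simp add: algebra_simps)
    then have diff: "ccw_length b y - ccw_length b x = 2 * pi / 3 * of_int m" using m by simp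
    have "x * cis q = x * cis (ccw_length b y - ccw_length b x)"
    proof -
      have "x * cis (ccw_length b y - ccw_length b x) = b * cis (ccw_length b x) * cis (ccw_length b
        y - ccw_length b x)"
        using rotate_ccw_length[OF assms(1,2)] by simp
      also have "\<dots> = y" using rotate_ccw_length[OF assms(1) y] by (simp add: mult.assoc cis_mult)
      finally show ?thesis using assms(3) by metis
    qed
    then have "cis q = cis (2 * pi / 3 * of_int m)" using assms(2) diff by auto
    then have "exp (\<i> * of_real q) = exp (\<i> * of_real (2 * pi / 3 * of_int m))"
      by (simp add: cis_conv_exp)
    then obtain n :: int where "\<i> * of_real q = \<i> * of_real (2 * pi / 3 * of_int m) + (of_int (2 *
      n) * pi) * \<i>"
      unfolding exp_eq by blast
    then have "\<i> * of_real q = \<i> * of_real (2 * pi / 3 * of_int m + of_int (2 * n) * pi)"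
      by (simp add: algebra_simps)
    then have "q = 2 * pi / 3 * of_int m + of_int (2 * n) * pi"
      using of_real_eq_iff mult_cancel_left complex_i_not_zero by metis
    then have q: "3 * q = pi * of_int (2 * (m + 3 * n))" by (simp add: algebra_simps)
    have nz: "of_int (2 * (m + 3 * n)) \<noteq> (0::real)" using m(2)
      by (simp only: of_int_eq_0_iff) presburger
    then have "pi = 3 * q / of_int (2 * (m + 3 * n))" using q by (simp add: field_simps)
    moreover have "3 * q / of_int (2 * (m + 3 * n)) \<in> \<rat>" using assms(4)
      by (intro Rats_divide Rats_mult) auto
    ultimately show False using pi_irrational by simp
  qed
  show ?thesis using no[of 1] no[of 2] by auto
qed

theorem chart_C3:
  assumes P: "C3_vertices P" and b: "b \<in> P"
  shows "circle_chart P C3_E C3_B C3_S (coordinate b)"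
proof
  have norm: "norm z = 1" if "z \<in> P" for z using P that unfolding C3_vertices_def by auto
  note nb = norm[OF b]
  note inj = coordinate_inj[OF nb norm norm]
  show "x = y" if "x \<in> P" "y \<in> P" "coordinate b x = coordinate b y" for x y using inj that by blast
  show "0 \<le> coordinate b x \<and> coordinate b x < 3" for x using coordinate_range .
  have gap: "coordinate b x - coordinate b y \<noteq> 1 \<and> coordinate b x - coordinate b y \<noteq> 2"
    if V: "x \<in> P" "y \<in> P" for x y
  proof (cases "x = y")
    case False
    have "\<forall>x\<in>P. \<forall>y\<in>P. x \<noteq> y \<longrightarrow> (\<exists>q\<in>\<rat>. y = x * cis q)" using P unfolding C3_vertices_def by simp
    then obtain q where "q \<in> \<rat>" "x = y * cis q" using V False by metis
    then show ?thesis using coordinate_gap[OF nb norm[OF V(2)]] by blast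
  qed simp
  then show "x \<in> P \<Longrightarrow> y \<in> P \<Longrightarrow>
    coordinate b x - coordinate b y \<noteq> 1 \<and> coordinate b x - coordinate b y \<noteq> 2" for x y .
  note len = ccw_length_coordinate[OF nb norm norm]
  have less: "ccw_length x y < ccw_length z w \<longleftrightarrow>
      forward (coordinate b x) (coordinate b y) < forward (coordinate b z) (coordinate b w)"
    if "x \<in> P" "y \<in> P" "z \<in> P" "w \<in> P" for x y z w
    unfolding len[OF that(1,2)] len[OF that(3,4)] by simp
  have E: "C3_E x y \<longleftrightarrow> far (coordinate b x) (coordinate b y)" if "x \<in> P" "y \<in> P" for x y
    unfolding C3_E_def len[OF that] len[OF that(2,1)]
    far_iff_forward[OF coordinate_range coordinate_range]
    by (simp add: field_simps)
  then show "x \<in> P \<Longrightarrow> y \<in> P \<Longrightarrow> C3_E x y \<longleftrightarrow> far (coordinate b x) (coordinate b y)" for x y .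
  show "C3_B x y z \<longleftrightarrow> lies_between (coordinate b x) (coordinate b y) (coordinate b z)"
    if V: "x \<in> P" "y \<in> P" "z \<in> P" for x y z
  proof (cases "distinct [x, y, z]")
    case False
    then show ?thesis unfolding C3_B_def lies_between_def ahead_def by auto
  next
    case True
    then have d: "coordinate b x \<noteq> coordinate b y" "coordinate b x \<noteq> coordinate b z"
      "coordinate b y \<noteq> coordinate b z"
      using inj V by auto
    have g: "off_thirds (coordinate b x) (coordinate b y)" if "x \<in> P" "y \<in> P" for x y using gap that
      by blast
    have arc: "y \<in> ccw_arc x z \<longleftrightarrow>
      forward (coordinate b x) (coordinate b y) \<le> forward (coordinate b x) (coordinate b z)"
      if "x \<in> P" "y \<in> P" "z \<in> P" for x y z
      using mem_ccw_arc[OF norm norm, OF that(1,2)] less[OF that(1,3,1,2)] by (simp flip: not_less)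
    have cmp: "ccw_length x z < ccw_length z x \<longleftrightarrow>
      forward (coordinate b x) (coordinate b z) < forward (coordinate b z) (coordinate b x)"
      if "x \<in> P" "z \<in> P" for x z
      using less[OF that that(2,1)] .
    have "independent_set C3_E {x, y, z} \<longleftrightarrow> \<not> far (coordinate b x) (coordinate b y) \<and>
      \<not> far (coordinate b y) (coordinate b z) \<and> \<not> far (coordinate b x) (coordinate b z)"
      using far_sym not_far_self V by (simp add: independent_set_def E) blast
    then show ?thesis
      using True lies_between_iff_forward[OF coordinate_range coordinate_range coordinate_range d
      g[OF V(1,2)] g[OF V(2,3)] g[OF V(1,3)]]
        arc V cmp unfolding C3_B_def by simp
  qed
  show "C3_S x y z w \<longleftrightarrow>
    separated (coordinate b x) (coordinate b y) (coordinate b z) (coordinate b w)"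
    if V: "x \<in> P" "y \<in> P" "z \<in> P" "w \<in> P" for x y z w
  proof (cases "distinct [x, y, z, w]")
    case False
    then show ?thesis unfolding C3_S_def separated_def ccw_order_def by auto
  next
    case True
    have c: "ccw_length x y < ccw_length x z \<longleftrightarrow>
      ccw_order (coordinate b x) (coordinate b y) (coordinate b z)"
      if "x \<in> P" "y \<in> P" "z \<in> P" "distinct [x, y, z]" for x y z
    proof -
      have "coordinate b x \<noteq> coordinate b y" "coordinate b x \<noteq> coordinate b z"
        "coordinate b y \<noteq> coordinate b z"
        using inj that by auto
      then show ?thesis using ccw_order_iff_forward[OF coordinate_range coordinate_range
        coordinate_range] less[OF that(1,2,1,3)] by simp
    qed
    have ne: "coordinate b x \<noteq> coordinate b y" if "x \<in> P" "y \<in> P" "x \<noteq> y" for x y using inj that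
      by blast
    have "C3_S x y z w \<longleftrightarrow>
      ccw_order (coordinate b x) (coordinate b y) (coordinate b z) \<noteq> ccw_order (coordinate b x)
      (coordinate b w) (coordinate b z)"
      using True connected_component_circle_iff[OF norm norm norm norm True, OF V] c[of x y z]
      c[of x w z] V
      unfolding C3_S_def by auto
    also have "\<dots> \<longleftrightarrow> separated (coordinate b x) (coordinate b y) (coordinate b z) (coordinate b w)"
      using separated_iff_ccw_order[OF ne[OF V(1,2)] ne[OF V(1,3)] ne[OF V(1,4)] ne[OF V(2,3)]
      ne[OF V(3,4)]] True by simp
    finally show ?thesis .
  qed
  \<comment> \<open>The coordinate is continuous at the midpoint of the arc, which is a limit of points of
    \<open>P\<close>.\<close>
  show "\<exists>v\<in>P. l < coordinate b v \<and> coordinate b v < u" if lu: "0 \<le> l" "l < u" "u \<le> 3" for l u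
  proof -
    define t where "t = 2 * pi / 3 * ((l + u) / 2)"
    define z where "z = b * cis t"
    have m: "(l + u) / 2 < 3" "0 < (l + u) / 2" using lu by auto
    then have "2 * pi / 3 * ((l + u) / 2) < 2 * pi / 3 * 3" by (intro mult_strict_left_mono) auto
    then have t: "0 < t" "t < 2 * pi" using m(2) unfolding t_def by simp_all
    have gz: "Arg2pi (z / b) = t" using ccw_length_rotate[OF nb, of t] t
      unfolding z_def ccw_length_def by simp
    then have "z / b \<notin> \<real>\<^sub>\<ge>\<^sub>0" using t(1) Arg2pi_eq_0[of "z / b"]
      by (auto simp: complex_nonneg_Reals_iff complex_is_Real_iff)
    then have "isCont Arg2pi (z / b)" by (rule continuous_at_Arg2pi)
    moreover have "isCont (\<lambda>z. z / b) z" using nb by (intro continuous_intros) auto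
    ultimately have "isCont (\<lambda>z. Arg2pi (z / b)) z" by (rule isCont_o2[rotated])
    then have "isCont (coordinate b) z" unfolding coordinate_def ccw_length_def
      by (intro continuous_intros)
    moreover have "coordinate b z = (l + u) / 2" unfolding coordinate_def ccw_length_def gz t_def
      by simp
    ultimately have lim: "(coordinate b \<longlongrightarrow> (l + u) / 2) (at z)" unfolding isCont_def by simp
    have "\<forall>\<^sub>F w in at z. l < coordinate b w \<and> coordinate b w < u"
      using eventually_conj[OF order_tendstoD(1)[OF lim] order_tendstoD(2)[OF lim]] lu by simp
    then have "\<forall>\<^sub>F w in nhds z. l < coordinate b w \<and> coordinate b w < u"
      unfolding eventually_at_filter using \<open>coordinate b z = (l + u) / 2\<close> lu
      by (elim eventually_mono) auto
    then obtain U where U: "open U" "z \<in> U" "\<And>w. w \<in> U \<Longrightarrow> l < coordinate b w \<and> coordinate b w < u"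
      unfolding eventually_nhds by blast
    have "z \<in> closure P" using P nb unfolding C3_vertices_def z_def by (auto simp: norm_mult)
    then obtain v where "v \<in> P" "v \<in> U" using U(1,2)
      by (meson closure_iff_nhds_not_empty disjoint_iff subset_refl)
    then show ?thesis using U(3) by blast
  qed
qed

lemma circle_chart_transfer:
  assumes chart: "circle_chart W E' B' S' \<theta>" and iso: "isomorphic_EBS V E B S W E' B' S'"
  shows "\<exists>\<phi>. circle_chart V E B S \<phi>"
proof -
  interpret circle_chart W E' B' S' \<theta> by fact
  obtain f where f: "bij_betw f V W"
    and E: "\<forall>x\<in>V. \<forall>y\<in>V. E x y \<longleftrightarrow> E' (f x) (f y)"
    and B: "\<forall>x\<in>V. \<forall>y\<in>V. \<forall>z\<in>V. B x y z \<longleftrightarrow> B' (f x) (f y) (f z)"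
    and S: "\<forall>x\<in>V. \<forall>y\<in>V. \<forall>z\<in>V. \<forall>w\<in>V. S x y z w \<longleftrightarrow> S' (f x) (f y) (f z) (f w)"
    using iso unfolding isomorphic_EBS_def by blast
  have fW: "f x \<in> W" if "x \<in> V" for x using f that bij_betwE by blast
  have "circle_chart V E B S (\<lambda>x. \<theta> (f x))"
  proof
    show "x = y" if "x \<in> V" "y \<in> V" "\<theta> (f x) = \<theta> (f y)" for x y
      using inj[OF fW fW, OF that] f that unfolding bij_betw_def inj_on_def by blast
    show "\<exists>v\<in>V. l < \<theta> (f v) \<and> \<theta> (f v) < u" if "0 \<le> l" "l < u" "u \<le> 3" for l u
      using dense[OF that] f unfolding bij_betw_def by blast
  qed (use range gap E B S E_iff B_iff S_iff fW in simp_all)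
  then show ?thesis by blast
qed

section \<open>The characterization\<close>

theorem theorem40:
  fixes V :: "'a set"
    and E :: "'a \<Rightarrow> 'a \<Rightarrow> bool"
    and B :: "'a \<Rightarrow> 'a \<Rightarrow> 'a \<Rightarrow> bool"
    and S :: "'a \<Rightarrow> 'a \<Rightarrow> 'a \<Rightarrow> 'a \<Rightarrow> bool"
    and P :: "complex set"
  assumes "countable V"
    and "C3_vertices P"
  shows "universal_axioms V E B S \<and> extension_axioms V E B S
    \<longleftrightarrow> isomorphic_EBS V E B S P C3_E C3_B C3_S"
proof -
  have "1 \<in> closure P" using assms(2) unfolding C3_vertices_def by auto
  then obtain b where "b \<in> P" by (metis closure_empty empty_iff ex_in_conv)
  then have chart: "circle_chart P C3_E C3_B C3_S (coordinate b)" using chart_C3[OF assms(2)]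
    by blast
  show ?thesis
  proof
    assume "universal_axioms V E B S \<and> extension_axioms V E B S"
    then have "circle_model V E B S" unfolding circle_model_def by blast
    moreover have "circle_model P C3_E C3_B C3_S"
      using circle_chart.universal_axioms[OF chart] circle_chart.extension_axioms[OF chart]
      unfolding circle_model_def by blast
    moreover have "countable P" using assms(2) unfolding C3_vertices_def by blast
    ultimately show "isomorphic_EBS V E B S P C3_E C3_B C3_S"
      using circle_models_isomorphic assms(1) by blast
  next
    assume "isomorphic_EBS V E B S P C3_E C3_B C3_S"
    then obtain \<phi> where "circle_chart V E B S \<phi>" using circle_chart_transfer[OF chart] by blast
    then show "universal_axioms V E B S \<and> extension_axioms V E B S"
      using circle_chart.universal_axioms circle_chart.extension_axioms by blast
  qed
qed

end
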